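(* If $\mathfrak{a}$ is a finite-dimensional Lie algebra over a field of prime characteristic, then the continuous dual $U(\mathfrak{a})^\circ$ is injective as a left and as a right $U(\mathfrak{a})$-module.
   Context: Let $\mathbb{F}$ be the ground field and $U(\mathfrak{a})$ the universal enveloping algebra. The linear dual $U(\mathfrak{a})^* = \mathrm{Hom}_{\mathbb{F}}(U(\mathfrak{a}),\mathbb{F})$ is a left and a right $U(\mathfrak{a})$-module (the coregular module) via $(u\cdot f)(v) = f(vu)$ and $(f\cdot u)(v) = f(uv)$ for $u,v\in U(\mathfrak{a})$, $f \in U(\mathfrak{a})^*$. A module is locally finite if every finitely generated submodule is finite-dimensional over $\mathbb{F}$. The continuous dual $U(\mathfrak{a})^\circ$ is the largest locally finite submodule of the left and right $U(\mathfrak{a})$-module $U(\mathfrak{a})^*$; equivalently, it consists of all linear forms on $U(\mathfrak{a})$ that vanish on some two-sided ideal of finite codimension in $U(\mathfrak{a})$. *)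

theory Defs
  imports
    "HOL-Algebra.QuotRing"
    "HOL-Algebra.Multiplicative_Group"
    "HOL-Computational_Algebra.Primes"
    "Jordan_Normal_Form.Missing_VectorSpace"
begin

section \<open>Lie algebras\<close>

locale lie_algebra = vectorspace K L
    for K :: "('k, 'c) ring_scheme" (structure) and L :: "('k, 'l, 'd) module_scheme" (structure) +
  fixes br :: "'l \<Rightarrow> 'l \<Rightarrow> 'l"
  assumes br_closed:
      "\<lbrakk>x \<in> carrier L; y \<in> carrier L\<rbrakk> \<Longrightarrow> br x y \<in> carrier L"
    and br_add_left:
      "\<lbrakk>x \<in> carrier L; y \<in> carrier L; z \<in> carrier L\<rbrakk> \<Longrightarrow>
        br (x \<oplus>\<^bsub>L\<^esub> y) z = br x z \<oplus>\<^bsub>L\<^esub> br y z"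
    and br_add_right:
      "\<lbrakk>x \<in> carrier L; y \<in> carrier L; z \<in> carrier L\<rbrakk> \<Longrightarrow>
        br x (y \<oplus>\<^bsub>L\<^esub> z) = br x y \<oplus>\<^bsub>L\<^esub> br x z"
    and br_smult_left:
      "\<lbrakk>c \<in> carrier K; x \<in> carrier L; y \<in> carrier L\<rbrakk> \<Longrightarrow>
        br (c \<odot>\<^bsub>L\<^esub> x) y = c \<odot>\<^bsub>L\<^esub> br x y"
    and br_smult_right:
      "\<lbrakk>c \<in> carrier K; x \<in> carrier L; y \<in> carrier L\<rbrakk> \<Longrightarrow>
        br x (c \<odot>\<^bsub>L\<^esub> y) = c \<odot>\<^bsub>L\<^esub> br x y"
    and br_alternating:
      "x \<in> carrier L \<Longrightarrow> br x x = \<zero>\<^bsub>L\<^esub>"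
    and br_jacobi:
      "\<lbrakk>x \<in> carrier L; y \<in> carrier L; z \<in> carrier L\<rbrakk> \<Longrightarrow>
        br x (br y z) \<oplus>\<^bsub>L\<^esub> br y (br z x) \<oplus>\<^bsub>L\<^esub> br z (br x y) = \<zero>\<^bsub>L\<^esub>"

text \<open>The order of an element of infinite order is 0, so this is the usual characteristic.\<close>

definition ring_char :: "('k, 'c) ring_scheme \<Rightarrow> nat" where
  "ring_char R = group.ord (add_monoid R) \<one>\<^bsub>R\<^esub>"


section \<open>The universal enveloping algebra\<close>

text \<open>An associative algebra over \<open>K\<close> is a \<open>module\<close> record: its fields \<open>mult\<close> and \<open>one\<close> give the
  (noncommutative) ring structure and \<open>smult\<close> the scalar multiplication.

  The free algebra consists of the finitely supported functions on the words over \<open>G\<close>; its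
  multiplication extends concatenation of words bilinearly, so the coefficient of \<open>w\<close> in a product
  is a sum over all ways to split \<open>w\<close> into a prefix and a suffix.\<close>

definition free_algebra :: "('k, 'c) ring_scheme \<Rightarrow> 'x set \<Rightarrow> ('k, 'x list \<Rightarrow> 'k) module" where
  "free_algebra K G =
    \<lparr>carrier = {f. range f \<subseteq> carrier K \<and> finite {w. f w \<noteq> \<zero>\<^bsub>K\<^esub>} \<and> {w. f w \<noteq> \<zero>\<^bsub>K\<^esub>} \<subseteq> lists G},
     monoid.mult = (\<lambda>f g w. \<Oplus>\<^bsub>K\<^esub> i \<in> {..length w}. f (take i w) \<otimes>\<^bsub>K\<^esub> g (drop i w)),
     one = (\<lambda>w. if w = [] then \<one>\<^bsub>K\<^esub> else \<zero>\<^bsub>K\<^esub>),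
     zero = (\<lambda>w. \<zero>\<^bsub>K\<^esub>),
     add = (\<lambda>f g w. f w \<oplus>\<^bsub>K\<^esub> g w),
     smult = (\<lambda>c f w. c \<otimes>\<^bsub>K\<^esub> f w)\<rparr>"

definition free_gen :: "('k, 'c) ring_scheme \<Rightarrow> 'x \<Rightarrow> 'x list \<Rightarrow> 'k" where
  "free_gen K x = (\<lambda>w. if w = [x] then \<one>\<^bsub>K\<^esub> else \<zero>\<^bsub>K\<^esub>)"

text \<open>The free algebra is taken on the underlying set of \<open>L\<close>. Its quotient by the first two families
  of relations is the tensor algebra of the vector space \<open>L\<close>; the third family is
  \<open>x y - y x = [x, y]\<close>.\<close>

definition uea_relations ::
    "('k, 'c) ring_scheme \<Rightarrow> ('k, 'l, 'd) module_scheme \<Rightarrow> ('l \<Rightarrow> 'l \<Rightarrow> 'l) \<Rightarrow> ('l list \<Rightarrow> 'k) set" where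
  "uea_relations K L br =
    (let T = free_algebra K (carrier L); \<iota> = free_gen K in
      {\<iota> (x \<oplus>\<^bsub>L\<^esub> y) \<ominus>\<^bsub>T\<^esub> (\<iota> x \<oplus>\<^bsub>T\<^esub> \<iota> y) | x y. x \<in> carrier L \<and> y \<in> carrier L} \<union>
      {\<iota> (c \<odot>\<^bsub>L\<^esub> x) \<ominus>\<^bsub>T\<^esub> (c \<odot>\<^bsub>T\<^esub> \<iota> x) | c x. c \<in> carrier K \<and> x \<in> carrier L} \<union>
      {(\<iota> x \<otimes>\<^bsub>T\<^esub> \<iota> y \<ominus>\<^bsub>T\<^esub> \<iota> y \<otimes>\<^bsub>T\<^esub> \<iota> x) \<ominus>\<^bsub>T\<^esub> \<iota> (br x y) | x y. x \<in> carrier L \<and> y \<in> carrier L})"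

definition uea ::
    "('k, 'c) ring_scheme \<Rightarrow> ('k, 'l, 'd) module_scheme \<Rightarrow> ('l \<Rightarrow> 'l \<Rightarrow> 'l) \<Rightarrow>
      ('k, ('l list \<Rightarrow> 'k) set) module" where
  "uea K L br =
    (let T = free_algebra K (carrier L); I = Idl\<^bsub>T\<^esub> (uea_relations K L br); Q = T Quot I in
      \<lparr>carrier = carrier Q, monoid.mult = monoid.mult Q, one = one Q, zero = zero Q, add = add Q,
       smult = (\<lambda>c u. (I +>\<^bsub>T\<^esub> (c \<odot>\<^bsub>T\<^esub> \<one>\<^bsub>T\<^esub>)) \<otimes>\<^bsub>Q\<^esub> u)\<rparr>)"


section \<open>Left and right modules over a noncommutative ring\<close>

locale left_module = R?: ring R + M?: abelian_group M
    for R :: "('r, 'c) ring_scheme" (structure) and M :: "('r, 'm, 'd) module_scheme" (structure) +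
  assumes smult_closed:
      "\<lbrakk>a \<in> carrier R; x \<in> carrier M\<rbrakk> \<Longrightarrow> a \<odot>\<^bsub>M\<^esub> x \<in> carrier M"
    and smult_l_distr:
      "\<lbrakk>a \<in> carrier R; b \<in> carrier R; x \<in> carrier M\<rbrakk> \<Longrightarrow>
        (a \<oplus>\<^bsub>R\<^esub> b) \<odot>\<^bsub>M\<^esub> x = a \<odot>\<^bsub>M\<^esub> x \<oplus>\<^bsub>M\<^esub> b \<odot>\<^bsub>M\<^esub> x"
    and smult_r_distr:
      "\<lbrakk>a \<in> carrier R; x \<in> carrier M; y \<in> carrier M\<rbrakk> \<Longrightarrow>
        a \<odot>\<^bsub>M\<^esub> (x \<oplus>\<^bsub>M\<^esub> y) = a \<odot>\<^bsub>M\<^esub> x \<oplus>\<^bsub>M\<^esub> a \<odot>\<^bsub>M\<^esub> y"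
    and smult_assoc:
      "\<lbrakk>a \<in> carrier R; b \<in> carrier R; x \<in> carrier M\<rbrakk> \<Longrightarrow>
        (a \<otimes>\<^bsub>R\<^esub> b) \<odot>\<^bsub>M\<^esub> x = a \<odot>\<^bsub>M\<^esub> (b \<odot>\<^bsub>M\<^esub> x)"
    and smult_one:
      "x \<in> carrier M \<Longrightarrow> \<one>\<^bsub>R\<^esub> \<odot>\<^bsub>M\<^esub> x = x"

text \<open>In a right module \<open>a \<odot>\<^bsub>M\<^esub> x\<close> stands for \<open>x \<cdot> a\<close>.\<close>

locale right_module = R?: ring R + M?: abelian_group M
    for R :: "('r, 'c) ring_scheme" (structure) and M :: "('r, 'm, 'd) module_scheme" (structure) +
  assumes smult_closed:
      "\<lbrakk>a \<in> carrier R; x \<in> carrier M\<rbrakk> \<Longrightarrow> a \<odot>\<^bsub>M\<^esub> x \<in> carrier M"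
    and smult_l_distr:
      "\<lbrakk>a \<in> carrier R; b \<in> carrier R; x \<in> carrier M\<rbrakk> \<Longrightarrow>
        (a \<oplus>\<^bsub>R\<^esub> b) \<odot>\<^bsub>M\<^esub> x = a \<odot>\<^bsub>M\<^esub> x \<oplus>\<^bsub>M\<^esub> b \<odot>\<^bsub>M\<^esub> x"
    and smult_r_distr:
      "\<lbrakk>a \<in> carrier R; x \<in> carrier M; y \<in> carrier M\<rbrakk> \<Longrightarrow>
        a \<odot>\<^bsub>M\<^esub> (x \<oplus>\<^bsub>M\<^esub> y) = a \<odot>\<^bsub>M\<^esub> x \<oplus>\<^bsub>M\<^esub> a \<odot>\<^bsub>M\<^esub> y"
    and smult_assoc:
      "\<lbrakk>a \<in> carrier R; b \<in> carrier R; x \<in> carrier M\<rbrakk> \<Longrightarrow>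
        (a \<otimes>\<^bsub>R\<^esub> b) \<odot>\<^bsub>M\<^esub> x = b \<odot>\<^bsub>M\<^esub> (a \<odot>\<^bsub>M\<^esub> x)"
    and smult_one:
      "x \<in> carrier M \<Longrightarrow> \<one>\<^bsub>R\<^esub> \<odot>\<^bsub>M\<^esub> x = x"

text \<open>\<open>Q\<close> is injective if every homomorphism \<open>g : M \<rightarrow> Q\<close> extends along every injective homomorphism
  \<open>i : M \<rightarrow> N\<close>. HOL cannot quantify over types inside a formula, so the types of the elements of \<open>M\<close>
  and \<open>N\<close> are parameters; a theorem in which they are type variables quantifies over all modules.
  \<open>module_hom\<close> does not need the scalars to commute and serves for left and right modules alike.\<close>

definition injective_left_module ::
    "'m itself \<Rightarrow> 'n itself \<Rightarrow> ('r, 'c) ring_scheme \<Rightarrow> ('r, 'q, 'd) module_scheme \<Rightarrow> bool" where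
  "injective_left_module _ _ R Q \<longleftrightarrow>
    left_module R Q \<and>
    (\<forall>(M :: ('r, 'm) module) (N :: ('r, 'n) module) i g.
      left_module R M \<and> left_module R N \<and>
      i \<in> module_hom R M N \<and> inj_on i (carrier M) \<and> g \<in> module_hom R M Q \<longrightarrow>
      (\<exists>h \<in> module_hom R N Q. \<forall>x \<in> carrier M. h (i x) = g x))"

definition injective_right_module ::
    "'m itself \<Rightarrow> 'n itself \<Rightarrow> ('r, 'c) ring_scheme \<Rightarrow> ('r, 'q, 'd) module_scheme \<Rightarrow> bool" where
  "injective_right_module _ _ R Q \<longleftrightarrow>
    right_module R Q \<and>
    (\<forall>(M :: ('r, 'm) module) (N :: ('r, 'n) module) i g.
      right_module R M \<and> right_module R N \<and>
      i \<in> module_hom R M N \<and> inj_on i (carrier M) \<and> g \<in> module_hom R M Q \<longrightarrow>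
      (\<exists>h \<in> module_hom R N Q. \<forall>x \<in> carrier M. h (i x) = g x))"

text \<open>Submodules are those of \<^theory>\<open>HOL-Algebra.Module\<close>; the VectorSpace locale of the same name
  requires commutative scalars.\<close>

definition generated_submodule ::
    "('r, 'c) ring_scheme \<Rightarrow> ('r, 'm, 'd) module_scheme \<Rightarrow> 'm set \<Rightarrow> 'm set" where
  "generated_submodule R M S = \<Inter>{H. Module.submodule H R M \<and> S \<subseteq> H}"

text \<open>A module over a \<open>K\<close>-algebra \<open>A\<close> is a vector space over \<open>K\<close> through \<open>c \<mapsto> c 1\<^sub>A\<close>.\<close>

definition restrict_scalars ::
    "('k, 'a, 'c) module_scheme \<Rightarrow> ('a, 'm, 'd) module_scheme \<Rightarrow> ('k, 'm) module" where
  "restrict_scalars A M =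
    \<lparr>carrier = carrier M, monoid.mult = monoid.mult M, one = one M, zero = zero M, add = add M,
     smult = (\<lambda>c x. (c \<odot>\<^bsub>A\<^esub> \<one>\<^bsub>A\<^esub>) \<odot>\<^bsub>M\<^esub> x)\<rparr>"

definition locally_finite ::
    "('k, 'c) ring_scheme \<Rightarrow> ('k, 'a, 'd) module_scheme \<Rightarrow> ('a, 'm, 'e) module_scheme \<Rightarrow> bool" where
  "locally_finite K A M \<longleftrightarrow>
    (\<forall>S. finite S \<and> S \<subseteq> carrier M \<longrightarrow>
      vectorspace.fin_dim K (restrict_scalars A (M\<lparr>carrier := generated_submodule A M S\<rparr>)))"


section \<open>The coregular modules and the continuous dual\<close>

definition linear_forms ::
    "('k, 'c) ring_scheme \<Rightarrow> ('k, 'a, 'd) module_scheme \<Rightarrow> ('a \<Rightarrow> 'k) set" where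
  "linear_forms K A =
    {f \<in> carrier A \<rightarrow>\<^sub>E carrier K.
      (\<forall>u \<in> carrier A. \<forall>v \<in> carrier A. f (u \<oplus>\<^bsub>A\<^esub> v) = f u \<oplus>\<^bsub>K\<^esub> f v) \<and>
      (\<forall>c \<in> carrier K. \<forall>v \<in> carrier A. f (c \<odot>\<^bsub>A\<^esub> v) = c \<otimes>\<^bsub>K\<^esub> f v)}"

text \<open>As usual for \<open>module\<close> records that are only modules, \<open>mult\<close> and \<open>one\<close> carry no information.\<close>

definition coregular_left ::
    "('k, 'c) ring_scheme \<Rightarrow> ('k, 'a, 'd) module_scheme \<Rightarrow> ('a, 'a \<Rightarrow> 'k) module" where
  "coregular_left K A =
    \<lparr>carrier = linear_forms K A, monoid.mult = undefined, one = undefined,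
     zero = (\<lambda>v \<in> carrier A. \<zero>\<^bsub>K\<^esub>),
     add = (\<lambda>f g. \<lambda>v \<in> carrier A. f v \<oplus>\<^bsub>K\<^esub> g v),
     smult = (\<lambda>u f. \<lambda>v \<in> carrier A. f (v \<otimes>\<^bsub>A\<^esub> u))\<rparr>"

definition coregular_right ::
    "('k, 'c) ring_scheme \<Rightarrow> ('k, 'a, 'd) module_scheme \<Rightarrow> ('a, 'a \<Rightarrow> 'k) module" where
  "coregular_right K A =
    \<lparr>carrier = linear_forms K A, monoid.mult = undefined, one = undefined,
     zero = (\<lambda>v \<in> carrier A. \<zero>\<^bsub>K\<^esub>),
     add = (\<lambda>f g. \<lambda>v \<in> carrier A. f v \<oplus>\<^bsub>K\<^esub> g v),
     smult = (\<lambda>u f. \<lambda>v \<in> carrier A. f (u \<otimes>\<^bsub>A\<^esub> v))\<rparr>"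

text \<open>The largest subset of the dual that is a locally finite submodule for both the left and the
  right action.\<close>

definition continuous_dual ::
    "('k, 'c) ring_scheme \<Rightarrow> ('k, 'a, 'd) module_scheme \<Rightarrow> ('a \<Rightarrow> 'k) set" where
  "continuous_dual K A =
    (GREATEST W.
      Module.submodule W A (coregular_left K A) \<and>
      Module.submodule W A (coregular_right K A) \<and>
      locally_finite K A ((coregular_left K A)\<lparr>carrier := W\<rparr>) \<and>
      locally_finite K A ((coregular_right K A)\<lparr>carrier := W\<rparr>))"

definition continuous_dual_left ::
    "('k, 'c) ring_scheme \<Rightarrow> ('k, 'a, 'd) module_scheme \<Rightarrow> ('a, 'a \<Rightarrow> 'k) module" where
  "continuous_dual_left K A = (coregular_left K A)\<lparr>carrier := continuous_dual K A\<rparr>"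

definition continuous_dual_right ::
    "('k, 'c) ring_scheme \<Rightarrow> ('k, 'a, 'd) module_scheme \<Rightarrow> ('a, 'a \<Rightarrow> 'k) module" where
  "continuous_dual_right K A = (coregular_right K A)\<lparr>carrier := continuous_dual K A\<rparr>"

end

theory Submission
  imports Defs
begin

text \<open>Let \<open>U\<close> be the enveloping algebra and \<open>F\<close> the image of the field in it. The proof compares the
  continuous dual \<open>U\<degree>\<close> with the full dual \<open>U\<^sup>*\<close>.

  \<^item> \<open>U\<close> is finitely generated as a module over a central subalgebra \<open>F[w\<^sub>1, \<dots>, w\<^sub>n]\<close>. In
    characteristic \<open>p\<close> the inner derivation of \<open>y\<^sup>p\<close> is the \<open>p\<close>-th power of that of \<open>y\<close> (\<open>ad_prime\<close>),
    and the derivations of \<open>y, y\<^sup>p, y\<^bsup>p\<^sup>2\<^esup>, \<dots>\<close> act on the finite-dimensional Lie algebra; hence some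
    monic polynomial in \<open>y\<close> is central (\<open>monic_central\<close>). Words in a finite spanning set of the Lie
    algebra can be reordered modulo shorter words, and a long word contains a power that is central
    up to shorter words (\<open>carrier_eq_wspan\<close>). By a form of Hilbert's basis theorem
    (\<open>noetherian_adjoin\<close>), \<open>U\<close> is left noetherian.

  \<^item> \<open>U\<^sup>*\<close> is injective, because a homomorphism from a left ideal to \<open>U\<^sup>*\<close> is the same as a linear form
    on the ideal, and linear forms extend (\<open>baer_coregular\<close> with Baer's criterion
    \<open>baer_criterion\<close>).

  \<^item> \<open>U\<degree>\<close> consists of the linear forms that are killed by some monic polynomial in each \<open>w\<^sub>i\<close>
    (\<open>continuous_dual_eq\<close>): the powers of \<open>w\<^sub>i\<close> applied to an element of a finite-dimensional module
    are linearly dependent, and conversely the ideal generated by such polynomials has finite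
    codimension (\<open>finite_codimension\<close>).

  \<^item> So \<open>U\<degree>\<close> arises from \<open>U\<^sup>*\<close> by passing \<open>n\<close> times to the torsion submodule with respect to a
    multiplicative set of central elements. Over a left noetherian ring this keeps a module
    injective, by the Artin-Rees property of a central element (\<open>baer_torsion\<close>).

  The hypotheses on \<open>U\<close> that are used here also hold for the opposite algebra, whose left modules are
  the right \<open>U\<close>-modules.\<close>

section \<open>Left modules, stable sets and spans\<close>

lemma (in abelian_group) abelian_group_cong:
  assumes "carrier N = carrier G" "zero N = zero G" "add N = add G"
  shows "abelian_group N"
proof (rule abelian_groupI)
  fix x assume "x \<in> carrier N"
  then show "\<exists>y\<in>carrier N. y \<oplus>\<^bsub>N\<^esub> x = \<zero>\<^bsub>N\<^esub>"
    by (intro bexI[of _ "\<ominus> x"]) (simp_all add: assms l_neg)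
qed (simp_all add: assms a_ac)

context left_module
begin

lemma smult_l_null: assumes "x \<in> carrier M" shows "\<zero> \<odot>\<^bsub>M\<^esub> x = \<zero>\<^bsub>M\<^esub>"
proof -
  have "\<zero> \<odot>\<^bsub>M\<^esub> x \<oplus>\<^bsub>M\<^esub> \<zero> \<odot>\<^bsub>M\<^esub> x = \<zero> \<odot>\<^bsub>M\<^esub> x"
    using smult_l_distr[of \<zero> \<zero> x] assms by simp
  then show ?thesis using assms smult_closed[of \<zero> x] M.add.l_cancel_one by simp
qed

lemma smult_r_null: assumes "a \<in> carrier R" shows "a \<odot>\<^bsub>M\<^esub> \<zero>\<^bsub>M\<^esub> = \<zero>\<^bsub>M\<^esub>"
proof -
  have "a \<odot>\<^bsub>M\<^esub> \<zero>\<^bsub>M\<^esub> \<oplus>\<^bsub>M\<^esub> a \<odot>\<^bsub>M\<^esub> \<zero>\<^bsub>M\<^esub> = a \<odot>\<^bsub>M\<^esub> \<zero>\<^bsub>M\<^esub>"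
    using smult_r_distr[of a "\<zero>\<^bsub>M\<^esub>" "\<zero>\<^bsub>M\<^esub>"] assms by simp
  then show ?thesis using assms smult_closed[of a "\<zero>\<^bsub>M\<^esub>"] M.add.l_cancel_one by simp
qed

lemma smult_l_minus:
  assumes "a \<in> carrier R" "x \<in> carrier M" shows "(\<ominus> a) \<odot>\<^bsub>M\<^esub> x = \<ominus>\<^bsub>M\<^esub> (a \<odot>\<^bsub>M\<^esub> x)"
proof -
  have "(\<ominus> a) \<odot>\<^bsub>M\<^esub> x \<oplus>\<^bsub>M\<^esub> a \<odot>\<^bsub>M\<^esub> x = \<zero>\<^bsub>M\<^esub>"
    using smult_l_distr[of "\<ominus> a" a x] assms by (simp add: R.l_neg smult_l_null)
  then show ?thesis using assms smult_closed M.minus_equality by simp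
qed

lemma smult_neg_one: "x \<in> carrier M \<Longrightarrow> (\<ominus> \<one>) \<odot>\<^bsub>M\<^esub> x = \<ominus>\<^bsub>M\<^esub> x"
  by (simp add: smult_l_minus smult_one)

lemma add_swap: "\<lbrakk>a \<in> carrier M; b \<in> carrier M; c \<in> carrier M; d \<in> carrier M\<rbrakk> \<Longrightarrow>
   (a \<oplus>\<^bsub>M\<^esub> b) \<oplus>\<^bsub>M\<^esub> (c \<oplus>\<^bsub>M\<^esub> d) = (a \<oplus>\<^bsub>M\<^esub> c) \<oplus>\<^bsub>M\<^esub> (b \<oplus>\<^bsub>M\<^esub> d)"
  by (simp add: M.a_ac)

lemma minus_add_cancel: "\<lbrakk>a \<in> carrier M; b \<in> carrier M\<rbrakk> \<Longrightarrow> (a \<ominus>\<^bsub>M\<^esub> b) \<oplus>\<^bsub>M\<^esub> b = a"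
  by (simp add: M.minus_eq M.a_assoc M.l_neg)

lemma add_minus_add: "\<lbrakk>a \<in> carrier M; b \<in> carrier M; c \<in> carrier M\<rbrakk> \<Longrightarrow>
  (a \<oplus>\<^bsub>M\<^esub> b) \<ominus>\<^bsub>M\<^esub> (c \<oplus>\<^bsub>M\<^esub> b) = a \<ominus>\<^bsub>M\<^esub> c"
  by (simp add: M.minus_eq M.minus_add M.a_ac M.r_neg1 M.r_neg2)

end

text \<open>The set \<open>C\<close> of operators is arbitrary, so that one notion covers subspaces (\<open>C = F\<close>), submodules
  over a central subalgebra (\<open>C\<close> a set of generators) and left ideals (\<open>C\<close> the whole ring). Closure
  under negation comes from \<open>-1 \<in> C\<close>.\<close>

definition stable :: "('r, 'm, 'd) module_scheme \<Rightarrow> 'r set \<Rightarrow> 'm set \<Rightarrow> bool" where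
  "stable M C P \<longleftrightarrow> P \<subseteq> carrier M \<and> \<zero>\<^bsub>M\<^esub> \<in> P \<and>
     (\<forall>x\<in>P. \<forall>y\<in>P. x \<oplus>\<^bsub>M\<^esub> y \<in> P) \<and> (\<forall>c\<in>C. \<forall>x\<in>P. c \<odot>\<^bsub>M\<^esub> x \<in> P)"

lemma stableI:
  assumes "P \<subseteq> carrier M" "\<zero>\<^bsub>M\<^esub> \<in> P" "\<And>x y. x \<in> P \<Longrightarrow> y \<in> P \<Longrightarrow> x \<oplus>\<^bsub>M\<^esub> y \<in> P"
    "\<And>c x. c \<in> C \<Longrightarrow> x \<in> P \<Longrightarrow> c \<odot>\<^bsub>M\<^esub> x \<in> P"
  shows "stable M C P"
  using assms unfolding stable_def by blast

lemma stableD: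
  assumes "stable M C P"
  shows "P \<subseteq> carrier M" "\<zero>\<^bsub>M\<^esub> \<in> P" "\<And>x y. x \<in> P \<Longrightarrow> y \<in> P \<Longrightarrow> x \<oplus>\<^bsub>M\<^esub> y \<in> P"
    "\<And>c x. c \<in> C \<Longrightarrow> x \<in> P \<Longrightarrow> c \<odot>\<^bsub>M\<^esub> x \<in> P"
  using assms unfolding stable_def by blast+

lemma stable_mono: "stable M C P \<Longrightarrow> C' \<subseteq> C \<Longrightarrow> stable M C' P"
  unfolding stable_def by blast

lemma stable_Int: "stable M C P \<Longrightarrow> stable M C Q \<Longrightarrow> stable M C (P \<inter> Q)"
  unfolding stable_def by blast

inductive_set stable_span :: "('r, 'm, 'd) module_scheme \<Rightarrow> 'r set \<Rightarrow> 'm set \<Rightarrow> 'm set"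
  for M :: "('r, 'm, 'd) module_scheme" and C :: "'r set" and X :: "'m set" where
  zero: "\<zero>\<^bsub>M\<^esub> \<in> stable_span M C X"
| gen: "x \<in> X \<Longrightarrow> x \<in> stable_span M C X"
| add: "\<lbrakk>x \<in> stable_span M C X; y \<in> stable_span M C X\<rbrakk> \<Longrightarrow> x \<oplus>\<^bsub>M\<^esub> y \<in> stable_span M C X"
| smult: "\<lbrakk>c \<in> C; x \<in> stable_span M C X\<rbrakk> \<Longrightarrow> c \<odot>\<^bsub>M\<^esub> x \<in> stable_span M C X"

lemma stable_span_least: "\<lbrakk>stable M C P; X \<subseteq> P\<rbrakk> \<Longrightarrow> stable_span M C X \<subseteq> P"
proof
  fix x assume "stable M C P" "X \<subseteq> P" "x \<in> stable_span M C X"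
  from this(3,1,2) show "x \<in> P" by induction (auto simp: stable_def)
qed

lemma (in left_module) stable_stable_span:
  assumes "C \<subseteq> carrier R" "X \<subseteq> carrier M" shows "stable M C (stable_span M C X)"
proof (rule stableI)
  show "stable_span M C X \<subseteq> carrier M"
    by (rule stable_span_least) (use assms in \<open>auto intro!: stableI smult_closed\<close>)
qed (auto intro: stable_span.intros)

lemma stable_span_mono:
  assumes "C \<subseteq> C'" "X \<subseteq> X'" shows "stable_span M C X \<subseteq> stable_span M C' X'"
proof
  fix x assume "x \<in> stable_span M C X"
  then show "x \<in> stable_span M C' X'"
    by induction (use assms in \<open>auto intro: stable_span.intros\<close>)
qed

context left_module
begin

lemma stable_minus:
  assumes "stable M C P" "\<ominus> \<one> \<in> C" "x \<in> P" "y \<in> P" shows "x \<ominus>\<^bsub>M\<^esub> y \<in> P"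
proof -
  have "(\<ominus> \<one>) \<odot>\<^bsub>M\<^esub> y \<in> P" "y \<in> carrier M"
    using stableD(4)[OF assms(1,2,4)] stableD(1)[OF assms(1)] assms(4) by auto
  then show ?thesis using stableD(3)[OF assms(1,3)] by (simp add: smult_neg_one M.minus_eq)
qed

end

text \<open>The sums \<open>a\<^sub>0 m\<^sub>0 + \<dots> + a\<^sub>d\<^sub>-\<^sub>1 m\<^sub>d\<^sub>-\<^sub>1\<close> with all \<open>m\<^sub>i\<close> in \<open>P\<close>. With \<open>a\<^sub>i = z\<^sup>i\<close> these are the values of
  polynomials of degree less than \<open>d\<close> with coefficients in \<open>P\<close>.\<close>

fun combs :: "('r, 'm, 'd) module_scheme \<Rightarrow> 'm set \<Rightarrow> (nat \<Rightarrow> 'r) \<Rightarrow> nat \<Rightarrow> 'm set" where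
  "combs M P a 0 = {\<zero>\<^bsub>M\<^esub>}"
| "combs M P a (Suc d) = {x \<oplus>\<^bsub>M\<^esub> a d \<odot>\<^bsub>M\<^esub> m | x m. x \<in> combs M P a d \<and> m \<in> P}"

context left_module
begin

lemma combs_closed:
  assumes "P \<subseteq> carrier M" "\<And>i. a i \<in> carrier R" shows "combs M P a d \<subseteq> carrier M"
  using assms by (induction d) (auto intro!: M.a_closed smult_closed)

lemma combs_stable:
  assumes st: "stable M C P" and C: "C \<subseteq> carrier R" and a: "\<And>i. a i \<in> carrier R"
    and comm: "\<And>c i. c \<in> C \<Longrightarrow> c \<otimes> a i = a i \<otimes> c"
  shows "stable M C (combs M P a d)"
proof (induction d)
  case 0
  show ?case using C by (auto intro!: stableI simp: smult_r_null)
next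
  case (Suc d)
  note P = stableD[OF st] note S = stableD[OF Suc]
  show ?case
  proof (rule stableI)
    show "combs M P a (Suc d) \<subseteq> carrier M" by (rule combs_closed) (use P a in auto)
    have "\<zero>\<^bsub>M\<^esub> = \<zero>\<^bsub>M\<^esub> \<oplus>\<^bsub>M\<^esub> a d \<odot>\<^bsub>M\<^esub> \<zero>\<^bsub>M\<^esub>" using a by (simp add: smult_r_null)
    then show "\<zero>\<^bsub>M\<^esub> \<in> combs M P a (Suc d)" using P(2) S(2) by auto
  next
    fix x y assume "x \<in> combs M P a (Suc d)" "y \<in> combs M P a (Suc d)"
    then obtain x' m y' n where *: "x = x' \<oplus>\<^bsub>M\<^esub> a d \<odot>\<^bsub>M\<^esub> m" "y = y' \<oplus>\<^bsub>M\<^esub> a d \<odot>\<^bsub>M\<^esub> n"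
      "x' \<in> combs M P a d" "y' \<in> combs M P a d" "m \<in> P" "n \<in> P" by auto
    have c: "x' \<in> carrier M" "y' \<in> carrier M" "m \<in> carrier M" "n \<in> carrier M" using * P(1) S(1) by auto
    have "x \<oplus>\<^bsub>M\<^esub> y = (x' \<oplus>\<^bsub>M\<^esub> y') \<oplus>\<^bsub>M\<^esub> a d \<odot>\<^bsub>M\<^esub> (m \<oplus>\<^bsub>M\<^esub> n)"
      using c a *(1,2) by (simp add: smult_r_distr add_swap smult_closed)
    then show "x \<oplus>\<^bsub>M\<^esub> y \<in> combs M P a (Suc d)"
      using P(3)[OF *(5,6)] S(3)[OF *(3,4)] by auto
  next
    fix c x assume cC: "c \<in> C" and "x \<in> combs M P a (Suc d)"
    then obtain x' m where *: "x = x' \<oplus>\<^bsub>M\<^esub> a d \<odot>\<^bsub>M\<^esub> m" "x' \<in> combs M P a d" "m \<in> P" by auto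
    have c: "x' \<in> carrier M" "m \<in> carrier M" "c \<in> carrier R" using * P(1) S(1) C cC by auto
    have "c \<odot>\<^bsub>M\<^esub> x = c \<odot>\<^bsub>M\<^esub> x' \<oplus>\<^bsub>M\<^esub> a d \<odot>\<^bsub>M\<^esub> (c \<odot>\<^bsub>M\<^esub> m)"
      using c a *(1) comm[OF cC, of d]
      by (simp add: smult_r_distr smult_closed smult_assoc[symmetric])
    then show "c \<odot>\<^bsub>M\<^esub> x \<in> combs M P a (Suc d)" using P(4)[OF cC *(3)] S(4)[OF cC *(2)] by auto
  qed
qed

lemma combs_Suc_mono:
  assumes "\<zero>\<^bsub>M\<^esub> \<in> P" "P \<subseteq> carrier M" "\<And>i. a i \<in> carrier R"
  shows "combs M P a d \<subseteq> combs M P a (Suc d)"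
proof
  fix x assume x: "x \<in> combs M P a d"
  then have "x = x \<oplus>\<^bsub>M\<^esub> a d \<odot>\<^bsub>M\<^esub> \<zero>\<^bsub>M\<^esub>"
    using combs_closed[OF assms(2,3)] assms(3) by (simp add: smult_r_null subset_iff)
  then show "x \<in> combs M P a (Suc d)" using x assms(1) by auto
qed

lemma combs_mono:
  assumes "\<zero>\<^bsub>M\<^esub> \<in> P" "P \<subseteq> carrier M" "\<And>i. a i \<in> carrier R" "d \<le> e"
  shows "combs M P a d \<subseteq> combs M P a e"
  using assms(4) by (rule lift_Suc_mono_le[of "combs M P a", rotated]) (rule combs_Suc_mono[OF assms(1-3)])

lemma combs_gen:
  assumes st: "\<zero>\<^bsub>M\<^esub> \<in> P" "P \<subseteq> carrier M" and a: "\<And>i. a i \<in> carrier R" and "i < d" "m \<in> P"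
    and z: "\<zero>\<^bsub>M\<^esub> \<in> combs M P a i"
  shows "a i \<odot>\<^bsub>M\<^esub> m \<in> combs M P a d"
proof -
  have "a i \<odot>\<^bsub>M\<^esub> m = \<zero>\<^bsub>M\<^esub> \<oplus>\<^bsub>M\<^esub> a i \<odot>\<^bsub>M\<^esub> m" using assms by (simp add: smult_closed subset_iff)
  then have "a i \<odot>\<^bsub>M\<^esub> m \<in> combs M P a (Suc i)" using z assms(5) by auto
  then show ?thesis using combs_mono[of P a "Suc i" d, OF st a] assms(4) by auto
qed

abbreviation polynomials where "polynomials P z d \<equiv> combs M P (\<lambda>i. z [^] i) d"

lemma polynomials_stable:
  assumes P: "stable M C P" and C: "C \<subseteq> carrier R" and z: "z \<in> carrier R"
    and comm: "\<And>c. c \<in> C \<Longrightarrow> c \<otimes> z = z \<otimes> c"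
  shows "stable M C (polynomials P z d)"
proof (rule combs_stable[OF P C])
  show "c \<otimes> z [^] i = z [^] i \<otimes> c" if "c \<in> C" for c and i :: nat
    by (rule R.group_commutes_pow[OF comm[OF that, symmetric] z, symmetric]) (use C that in auto)
qed (use z in simp)

lemma combs_shift:
  assumes P: "P \<subseteq> carrier M" "\<zero>\<^bsub>M\<^esub> \<in> P" and z: "z \<in> carrier R" and x: "x \<in> polynomials P z d"
  shows "z \<odot>\<^bsub>M\<^esub> x \<in> polynomials P z (Suc d)"
  using x
proof (induction d arbitrary: x)
  case 0
  have "\<zero>\<^bsub>M\<^esub> = \<zero>\<^bsub>M\<^esub> \<oplus>\<^bsub>M\<^esub> z [^] (0::nat) \<odot>\<^bsub>M\<^esub> \<zero>\<^bsub>M\<^esub>" by (simp add: smult_one)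
  then have "\<zero>\<^bsub>M\<^esub> \<in> polynomials P z (Suc 0)" using P by auto
  then show ?case using 0 z by (simp add: smult_r_null)
next
  case (Suc d)
  then obtain y m where *: "x = y \<oplus>\<^bsub>M\<^esub> z [^] d \<odot>\<^bsub>M\<^esub> m" "y \<in> polynomials P z d" "m \<in> P" by auto
  have c: "y \<in> carrier M" "m \<in> carrier M"
    using * P combs_closed[OF P(1), of "\<lambda>i. z [^] i" d] z by auto
  have "z \<otimes> z [^] d = z [^] d \<otimes> z" using z by (metis R.nat_pow_Suc R.nat_pow_Suc2)
  then have "z \<odot>\<^bsub>M\<^esub> x = z \<odot>\<^bsub>M\<^esub> y \<oplus>\<^bsub>M\<^esub> z [^] (Suc d) \<odot>\<^bsub>M\<^esub> m"
    using c z * by (simp add: smult_r_distr smult_closed smult_assoc[symmetric])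
  then show ?case using Suc.IH[OF *(2)] *(3)
    by (subst combs.simps) blast
qed

end

section \<open>Noetherian modules\<close>

text \<open>The ascending chain condition is stated for sequences, because the diagonal of a doubly indexed
  chain of submodules of leading coefficients occurs in \<open>noetherian_adjoin\<close>.\<close>

definition noetherian :: "('r, 'm, 'd) module_scheme \<Rightarrow> 'r set \<Rightarrow> 'm set \<Rightarrow> bool" where
  "noetherian M C P \<longleftrightarrow>
    (\<forall>Q. (\<forall>k. stable M C (Q k) \<and> Q k \<subseteq> P \<and> Q k \<subseteq> Q (Suc k)) \<longrightarrow> (\<exists>N. \<forall>k\<ge>N. Q k = Q N))"

lemma noetherianD:
  assumes "noetherian M C P" "\<And>k::nat. stable M C (Q k)" "\<And>k. Q k \<subseteq> P" "\<And>k. Q k \<subseteq> Q (Suc k)"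
  obtains N where "\<And>k. k \<ge> N \<Longrightarrow> Q k = Q N"
  using assms unfolding noetherian_def by metis

lemma noetherian_subset: "noetherian M C P \<Longrightarrow> P' \<subseteq> P \<Longrightarrow> noetherian M C P'"
  unfolding noetherian_def by (meson subset_trans)

lemma noetherian_more_scalars: "noetherian M C P \<Longrightarrow> C \<subseteq> C' \<Longrightarrow> noetherian M C' P"
  unfolding noetherian_def by (meson stable_mono)

lemma noetherian_maximal:
  assumes n: "noetherian M C P" and ne: "I \<noteq> {}" and st: "\<And>i. i \<in> I \<Longrightarrow> stable M C (S i) \<and> S i \<subseteq> P"
  obtains i where "i \<in> I" "\<And>j. j \<in> I \<Longrightarrow> S i \<subseteq> S j \<Longrightarrow> S j = S i"
proof (rule ccontr)
  assume "\<not> thesis"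
  then have "\<forall>i\<in>I. \<exists>j\<in>I. S i \<subset> S j" using that by blast
  then obtain f where f: "\<And>i. i \<in> I \<Longrightarrow> f i \<in> I \<and> S i \<subset> S (f i)" by metis
  obtain i0 where i0: "i0 \<in> I" using ne by blast
  define g where "g k = (f ^^ k) i0" for k
  have g: "g k \<in> I" for k by (induction k) (use i0 f in \<open>auto simp: g_def\<close>)
  have lt: "S (g k) \<subset> S (g (Suc k))" for k using f[OF g[of k]] by (simp add: g_def)
  obtain N where "\<And>k. k \<ge> N \<Longrightarrow> S (g k) = S (g N)"
    using noetherianD[OF n, of "\<lambda>k. S (g k)"] st g lt by (metis psubset_imp_subset)
  then show False using lt[of N] by (metis le_SucI order_refl psubset_eq)
qed

text \<open>Inverses are required in a form that holds for the image \<open>{0}\<close> of a field in the zero ring.\<close>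

locale central_subfield = ring R for R (structure) +
  fixes F
  assumes F_subset: "F \<subseteq> carrier R"
    and F_zero: "\<zero> \<in> F" and F_one: "\<one> \<in> F"
    and F_add: "\<lbrakk>c \<in> F; d \<in> F\<rbrakk> \<Longrightarrow> c \<oplus> d \<in> F"
    and F_mult: "\<lbrakk>c \<in> F; d \<in> F\<rbrakk> \<Longrightarrow> c \<otimes> d \<in> F"
    and F_minus: "c \<in> F \<Longrightarrow> \<ominus> c \<in> F"
    and F_central: "\<lbrakk>c \<in> F; u \<in> carrier R\<rbrakk> \<Longrightarrow> c \<otimes> u = u \<otimes> c"
    and F_inverse: "\<lbrakk>c \<in> F; c \<noteq> \<zero>\<rbrakk> \<Longrightarrow> \<exists>d\<in>F. d \<otimes> c = \<one>"
begin
lemma F_carrier: "c \<in> F \<Longrightarrow> c \<in> carrier R" using F_subset by blast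
lemma F_neg_one: "\<ominus> \<one> \<in> F" by (simp add: F_minus F_one)
end

text \<open>Once a member of the chain contains an element with nonzero coefficient at \<open>b\<close>, subtracting its
  multiples moves every later element into \<open>P\<close>, where the chain is already constant.\<close>

lemma (in left_module) noetherian_insert:
  assumes F: "central_subfield R F" and P: "stable M F P" "noetherian M F P" and b: "b \<in> carrier M"
  shows "noetherian M F {x \<oplus>\<^bsub>M\<^esub> c \<odot>\<^bsub>M\<^esub> b | x c. x \<in> P \<and> c \<in> F}" (is "noetherian M F ?P'")
  unfolding noetherian_def
proof (intro allI impI)
  interpret F: central_subfield R F by (rule F)
  fix Q :: "nat \<Rightarrow> 'm set" assume Q: "\<forall>k. stable M F (Q k) \<and> Q k \<subseteq> ?P' \<and> Q k \<subseteq> Q (Suc k)"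
  have mono: "Q k \<subseteq> Q l" if "k \<le> l" for k l
    using that by (rule lift_Suc_mono_le[of Q, rotated]) (use Q in auto)
  have Pc: "P \<subseteq> carrier M" by (rule stableD(1)[OF P(1)])
  have Qs: "stable M F (Q k)" for k using Q by blast
  obtain N1 where N1: "\<And>k. k \<ge> N1 \<Longrightarrow> Q k \<inter> P = Q N1 \<inter> P"
  proof (rule noetherianD[OF P(2), of "\<lambda>k. Q k \<inter> P"])
    show "stable M F (Q k \<inter> P)" for k by (rule stable_Int[OF Qs P(1)])
  qed (use Q in blast)+
  show "\<exists>N. \<forall>k\<ge>N. Q k = Q N"
  proof (cases "\<forall>k. Q k \<subseteq> P")
    case True
    then show ?thesis using N1 by (metis inf.absorb1)
  next
    case False
    then obtain k0 y where y: "y \<in> Q k0" "y \<notin> P" by auto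
    define N where "N = max N1 k0"
    have "Q k \<subseteq> Q N" if k: "k \<ge> N" for k
    proof
      fix x assume x: "x \<in> Q k"
      have yN: "y \<in> Q N" "y \<in> Q k" using y mono[of k0 N] mono[of k0 k] k by (auto simp: N_def)
      obtain p' c' where y': "y = p' \<oplus>\<^bsub>M\<^esub> c' \<odot>\<^bsub>M\<^esub> b" "p' \<in> P" "c' \<in> F" using yN Q by blast
      obtain p c where x': "x = p \<oplus>\<^bsub>M\<^esub> c \<odot>\<^bsub>M\<^esub> b" "p \<in> P" "c \<in> F" using x Q by blast
      have "c' \<noteq> \<zero>" using y y' b Pc by (auto simp: smult_l_null subset_iff)
      then obtain d where d: "d \<in> F" "d \<otimes> c' = \<one>" using F.F_inverse y' by blast
      define e where "e = c \<otimes> d"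
      have e: "e \<in> F" "e \<otimes> c' = c" using x' y' d
        by (auto simp: e_def F.F_mult R.m_assoc F.F_carrier)
      have car: "p \<in> carrier M" "p' \<in> carrier M" "c \<in> carrier R" "c' \<in> carrier R" "e \<in> carrier R"
        using Pc x' y' e F.F_carrier by auto
      have ey: "e \<odot>\<^bsub>M\<^esub> y = e \<odot>\<^bsub>M\<^esub> p' \<oplus>\<^bsub>M\<^esub> c \<odot>\<^bsub>M\<^esub> b"
        using y'(1) car b e by (simp add: smult_r_distr smult_closed smult_assoc[symmetric])
      have "x \<ominus>\<^bsub>M\<^esub> e \<odot>\<^bsub>M\<^esub> y = p \<ominus>\<^bsub>M\<^esub> e \<odot>\<^bsub>M\<^esub> p'"
        unfolding ey x'(1) using car b by (simp add: add_minus_add smult_closed)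
      moreover have "e \<odot>\<^bsub>M\<^esub> p' \<in> P" by (rule stableD(4)[OF P(1) e(1) y'(2)])
      ultimately have "x \<ominus>\<^bsub>M\<^esub> e \<odot>\<^bsub>M\<^esub> y \<in> P"
        using stable_minus[OF P(1) F.F_neg_one] x' by simp
      moreover have ek: "e \<odot>\<^bsub>M\<^esub> y \<in> Q k" "e \<odot>\<^bsub>M\<^esub> y \<in> Q N" 
        using stableD(4)[OF Qs e(1)] yN by blast+
      from this(1) have "x \<ominus>\<^bsub>M\<^esub> e \<odot>\<^bsub>M\<^esub> y \<in> Q k"
        by (rule stable_minus[OF Qs F.F_neg_one x])
      ultimately have "x \<ominus>\<^bsub>M\<^esub> e \<odot>\<^bsub>M\<^esub> y \<in> Q N" using N1[of k] N1[of N] k by (auto simp: N_def)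
      then have "(x \<ominus>\<^bsub>M\<^esub> e \<odot>\<^bsub>M\<^esub> y) \<oplus>\<^bsub>M\<^esub> e \<odot>\<^bsub>M\<^esub> y \<in> Q N" 
        by (rule stableD(3)[OF Qs _ ek(2)])
      moreover have "x \<in> carrier M" "e \<odot>\<^bsub>M\<^esub> y \<in> carrier M" using stableD(1)[OF Qs] x ek by blast+
      ultimately show "x \<in> Q N" by (simp add: minus_add_cancel)
    qed
    then show ?thesis using mono by blast
  qed
qed

lemma (in left_module) noetherian_finite_span:
  assumes F: "central_subfield R F" and X: "finite X" "X \<subseteq> carrier M"
  shows "noetherian M F (stable_span M F X)"
  using X
proof (induction X)
  interpret F: central_subfield R F by (rule F)
  {
    case empty
    have "stable_span M F {} \<subseteq> {\<zero>\<^bsub>M\<^esub>}"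
      by (rule stable_span_least) (use F.F_subset in \<open>auto intro!: stableI simp: smult_r_null\<close>)
    moreover have "noetherian M F {\<zero>\<^bsub>M\<^esub>}" unfolding noetherian_def
      by (metis empty_iff stableD(2) subset_singleton_iff)
    ultimately show ?case using noetherian_subset by blast
  next
    case (insert b X)
    let ?P = "stable_span M F X"
    let ?P' = "{x \<oplus>\<^bsub>M\<^esub> c \<odot>\<^bsub>M\<^esub> b | x c. x \<in> ?P \<and> c \<in> F}"
    have st: "stable M F ?P" by (rule stable_stable_span) (use F.F_subset insert in auto)
    note P = stableD[OF st]
    have b: "b \<in> carrier M" using insert by auto
    have "noetherian M F ?P'" using noetherian_insert[OF F st _ b] insert by auto
    moreover have "stable_span M F (insert b X) \<subseteq> ?P'"
    proof (rule stable_span_least)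
      show "stable M F ?P'"
      proof (rule stableI)
        show "?P' \<subseteq> carrier M" using P(1) b F.F_subset by (auto intro!: M.a_closed smult_closed)
        have "\<zero>\<^bsub>M\<^esub> = \<zero>\<^bsub>M\<^esub> \<oplus>\<^bsub>M\<^esub> \<zero> \<odot>\<^bsub>M\<^esub> b" using b by (simp add: smult_l_null)
        then show "\<zero>\<^bsub>M\<^esub> \<in> ?P'" using P(2) F.F_zero by blast
      next
        fix x y assume "x \<in> ?P'" "y \<in> ?P'"
        then obtain p c q d where *: "x = p \<oplus>\<^bsub>M\<^esub> c \<odot>\<^bsub>M\<^esub> b" "y = q \<oplus>\<^bsub>M\<^esub> d \<odot>\<^bsub>M\<^esub> b"
          "p \<in> ?P" "q \<in> ?P" "c \<in> F" "d \<in> F" by blast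
        have "p \<in> carrier M" "q \<in> carrier M" using * P(1) by blast+
        then have "x \<oplus>\<^bsub>M\<^esub> y = (p \<oplus>\<^bsub>M\<^esub> q) \<oplus>\<^bsub>M\<^esub> (c \<oplus> d) \<odot>\<^bsub>M\<^esub> b"
          using * b F.F_carrier by (simp add: smult_l_distr add_swap smult_closed)
        then show "x \<oplus>\<^bsub>M\<^esub> y \<in> ?P'" using P(3)[OF *(3,4)] F.F_add[OF *(5,6)] by blast
      next
        fix e x assume e: "e \<in> F" and "x \<in> ?P'"
        then obtain p c where *: "x = p \<oplus>\<^bsub>M\<^esub> c \<odot>\<^bsub>M\<^esub> b" "p \<in> ?P" "c \<in> F" by blast
        have "p \<in> carrier M" using * P(1) by blast
        then have "e \<odot>\<^bsub>M\<^esub> x = e \<odot>\<^bsub>M\<^esub> p \<oplus>\<^bsub>M\<^esub> (e \<otimes> c) \<odot>\<^bsub>M\<^esub> b"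
          using * b e F.F_carrier by (simp add: smult_r_distr smult_assoc smult_closed)
        then show "e \<odot>\<^bsub>M\<^esub> x \<in> ?P'" using P(4)[OF e *(2)] F.F_mult[OF e *(3)] by blast
      qed
      have "x \<in> ?P'" if "x \<in> X" for x
      proof -
        have "x = x \<oplus>\<^bsub>M\<^esub> \<zero> \<odot>\<^bsub>M\<^esub> b" using b that insert by (auto simp: smult_l_null)
        then show ?thesis using that stable_span.gen[of x X] F.F_zero by blast
      qed
      moreover have "b = \<zero>\<^bsub>M\<^esub> \<oplus>\<^bsub>M\<^esub> \<one> \<odot>\<^bsub>M\<^esub> b" using b by (simp add: smult_one)
      then have "b \<in> ?P'" using P(2) F.F_one by blast
      ultimately show "insert b X \<subseteq> ?P'" by blast
    qed
    ultimately show ?case using noetherian_subset by blast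
  }
qed


lemma (in left_module) combs_Union_stable:
  assumes P: "stable M C P" and C: "C \<subseteq> carrier R" and z: "z \<in> carrier R"
    and comm: "\<And>c. c \<in> C \<Longrightarrow> c \<otimes> z = z \<otimes> c"
  shows "stable M (insert z C) (\<Union>d. polynomials P z d)" (is "stable M _ ?U")
proof -
  have st: "stable M C (polynomials P z d)" for d
    by (rule polynomials_stable[OF P C z comm])
  note Pd = stableD[OF P]
  have mono: "polynomials P z d \<subseteq> polynomials P z e" if "d \<le> e" for d e
    by (rule combs_mono[OF Pd(2,1) _ that]) (use z in auto)
  show ?thesis
  proof (rule stableI)
    show "?U \<subseteq> carrier M" using stableD(1)[OF st] by blast
    show "\<zero>\<^bsub>M\<^esub> \<in> ?U" using stableD(2)[OF st] by blast
  next
    fix x y assume "x \<in> ?U" "y \<in> ?U"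
    then obtain d e where "x \<in> polynomials P z d" "y \<in> polynomials P z e" by blast
    then have "x \<in> polynomials P z (max d e)" "y \<in> polynomials P z (max d e)"
      using mono[of d "max d e"] mono[of e "max d e"] by auto
    then show "x \<oplus>\<^bsub>M\<^esub> y \<in> ?U" using stableD(3)[OF st] by blast
  next
    fix c x assume c: "c \<in> insert z C" and "x \<in> ?U"
    then obtain d where x: "x \<in> polynomials P z d" by blast
    show "c \<odot>\<^bsub>M\<^esub> x \<in> ?U"
    proof (cases "c = z")
      case True
      then show ?thesis using combs_shift[OF Pd(1,2) z x] by blast
    next
      case False
      then show ?thesis using stableD(4)[OF st _ x] c by blast
    qed
  qed
qed

text \<open>Hilbert's basis theorem for a module: in degree \<open>d\<close> a submodule \<open>Q\<close> of \<open>P[z]\<close> has a submodule of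
  leading coefficients \<open>L Q d\<close> in \<open>P\<close>, increasing in \<open>d\<close> and in \<open>Q\<close>, and \<open>Q\<close> is determined by all of
  them within a larger submodule. Powers of \<open>z\<close> may satisfy relations here, so that a leading
  coefficient is a coefficient of some expression.\<close>

lemma (in left_module) noetherian_adjoin:
  assumes P: "stable M C P" and C: "C \<subseteq> carrier R" and neg: "\<ominus> \<one> \<in> C" and z: "z \<in> carrier R"
    and comm: "\<And>c. c \<in> C \<Longrightarrow> c \<otimes> z = z \<otimes> c" and noeth: "noetherian M C P"
  shows "noetherian M (insert z C) (\<Union>d. polynomials P z d)"
  unfolding noetherian_def
proof (intro allI impI)
  let ?P = "\<lambda>d. polynomials P z d"
  fix Q :: "nat \<Rightarrow> 'm set"
  assume Q: "\<forall>k. stable M (insert z C) (Q k) \<and> Q k \<subseteq> (\<Union>d. ?P d) \<and> Q k \<subseteq> Q (Suc k)"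
  have st: "stable M C (?P d)" for d
    by (rule polynomials_stable[OF P C z comm])
  note Pd = stableD[OF P]
  have Qst: "stable M (insert z C) (Q k)" for k using Q by blast
  have Qst': "stable M C (Q k)" for k by (rule stable_mono[OF Qst]) blast
  have mono: "Q k \<subseteq> Q l" if "k \<le> l" for k l
    using that by (rule lift_Suc_mono_le[of Q, rotated]) (use Q in auto)
  define L where "L k d = {m \<in> P. \<exists>r \<in> ?P d. r \<oplus>\<^bsub>M\<^esub> z [^] d \<odot>\<^bsub>M\<^esub> m \<in> Q k}" for k d
  have L: "stable M C (L k d)" for k d
  proof (rule stableI)
    show "L k d \<subseteq> carrier M" using Pd(1) by (auto simp: L_def)
    have "\<zero>\<^bsub>M\<^esub> \<oplus>\<^bsub>M\<^esub> z [^] d \<odot>\<^bsub>M\<^esub> \<zero>\<^bsub>M\<^esub> \<in> Q k" using z stableD(2)[OF Qst] by (simp add: smult_r_null)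
    then show "\<zero>\<^bsub>M\<^esub> \<in> L k d" using Pd(2) stableD(2)[OF st] by (auto simp: L_def)
  next
    fix x y assume "x \<in> L k d" "y \<in> L k d"
    then obtain r s where *: "x \<in> P" "y \<in> P" "r \<in> ?P d" "s \<in> ?P d"
      "r \<oplus>\<^bsub>M\<^esub> z [^] d \<odot>\<^bsub>M\<^esub> x \<in> Q k" "s \<oplus>\<^bsub>M\<^esub> z [^] d \<odot>\<^bsub>M\<^esub> y \<in> Q k" by (auto simp: L_def)
    have c: "x \<in> carrier M" "y \<in> carrier M" "r \<in> carrier M" "s \<in> carrier M"
      using * Pd(1) stableD(1)[OF st] by blast+
    have "(r \<oplus>\<^bsub>M\<^esub> s) \<oplus>\<^bsub>M\<^esub> z [^] d \<odot>\<^bsub>M\<^esub> (x \<oplus>\<^bsub>M\<^esub> y) \<in> Q k"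
      using stableD(3)[OF Qst *(5,6)] c z by (simp add: smult_r_distr add_swap smult_closed)
    then show "x \<oplus>\<^bsub>M\<^esub> y \<in> L k d" using Pd(3)[OF *(1,2)] stableD(3)[OF st *(3,4)] by (auto simp: L_def)
  next
    fix c x assume cC: "c \<in> C" and "x \<in> L k d"
    then obtain r where *: "x \<in> P" "r \<in> ?P d" "r \<oplus>\<^bsub>M\<^esub> z [^] d \<odot>\<^bsub>M\<^esub> x \<in> Q k" by (auto simp: L_def)
    have c: "x \<in> carrier M" "r \<in> carrier M" "c \<in> carrier R"
      using * Pd(1) stableD(1)[OF st] cC C by blast+
    have cz: "c \<otimes> z [^] d = z [^] d \<otimes> c"
      by (rule R.group_commutes_pow[OF comm[OF cC, symmetric] z c(3), symmetric])
    have "c \<odot>\<^bsub>M\<^esub> (r \<oplus>\<^bsub>M\<^esub> z [^] d \<odot>\<^bsub>M\<^esub> x) \<in> Q k" using stableD(4)[OF Qst' cC *(3)] .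
    then have "c \<odot>\<^bsub>M\<^esub> r \<oplus>\<^bsub>M\<^esub> z [^] d \<odot>\<^bsub>M\<^esub> (c \<odot>\<^bsub>M\<^esub> x) \<in> Q k"
      using c z cz by (simp add: smult_r_distr smult_closed smult_assoc[symmetric])
    then show "c \<odot>\<^bsub>M\<^esub> x \<in> L k d" using Pd(4)[OF cC *(1)] stableD(4)[OF st cC *(2)] by (auto simp: L_def)
  qed
  have LP: "L k d \<subseteq> P" for k d by (auto simp: L_def)
  have Lk: "L k d \<subseteq> L k' d" if "k \<le> k'" for k k' d using mono[OF that] by (auto simp: L_def)
  have Ld: "L k d \<subseteq> L k (Suc d)" for k d
  proof
    fix x assume "x \<in> L k d"
    then obtain r where *: "x \<in> P" "r \<in> ?P d" "r \<oplus>\<^bsub>M\<^esub> z [^] d \<odot>\<^bsub>M\<^esub> x \<in> Q k" by (auto simp: L_def)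
    have c: "x \<in> carrier M" "r \<in> carrier M"
      using * Pd(1) stableD(1)[OF st] by blast+
    have "z \<otimes> z [^] d = z [^] d \<otimes> z" using z by (metis R.nat_pow_Suc R.nat_pow_Suc2)
    then have "z \<odot>\<^bsub>M\<^esub> (r \<oplus>\<^bsub>M\<^esub> z [^] d \<odot>\<^bsub>M\<^esub> x) = z \<odot>\<^bsub>M\<^esub> r \<oplus>\<^bsub>M\<^esub> z [^] Suc d \<odot>\<^bsub>M\<^esub> x"
      using c z by (simp add: smult_r_distr smult_closed smult_assoc[symmetric])
    moreover have "z \<odot>\<^bsub>M\<^esub> (r \<oplus>\<^bsub>M\<^esub> z [^] d \<odot>\<^bsub>M\<^esub> x) \<in> Q k" by (rule stableD(4)[OF Qst _ *(3)]) simp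
    moreover have "z \<odot>\<^bsub>M\<^esub> r \<in> ?P (Suc d)" by (rule combs_shift[OF Pd(1,2) z *(2)])
    ultimately show "x \<in> L k (Suc d)" unfolding L_def using *(1) by auto
  qed
  have Ld': "L k d \<subseteq> L k d'" if "d \<le> d'" for k d d'
    using that by (rule lift_Suc_mono_le[of "L k", rotated]) (rule Ld)
  \<comment> \<open>The diagonal settles all large degrees at once; the finitely many others settle one by one.\<close>
  obtain N where N: "\<And>k. k \<ge> N \<Longrightarrow> L k k = L N N"
  proof (rule noetherianD[OF noeth, of "\<lambda>k. L k k"])
    show "L k k \<subseteq> L (Suc k) (Suc k)" for k by (rule order_trans[OF Lk Ld]) simp
  qed (use L LP in auto)
  have "\<exists>n. \<forall>k\<ge>n. L k d = L n d" for d
    by (rule noetherianD[OF noeth, of "\<lambda>k. L k d"]) (use L LP Lk[of _ "Suc _"] in auto)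
  then obtain n where n: "\<And>d k. k \<ge> n d \<Longrightarrow> L k d = L (n d) d" by metis
  define N' where "N' = Max (insert N (n ` {..N}))"
  have N': "N \<le> N'" "n d \<le> N'" if "d \<le> N" for d
    unfolding N'_def by (rule Max_ge; use that in simp)+
  note N' = N'(1)[OF order_refl] N'(2)
  have Leq: "L k d = L N' d" if k: "k \<ge> N'" for k d
  proof (cases "d \<le> N")
    case True
    then show ?thesis using n[of d k] n[of d N'] N' k by (metis le_trans)
  next
    case False
    have "L N N \<subseteq> L N' d" using Lk[of N N' N] Ld'[of N d N'] N' False by auto
    moreover have "L k d \<subseteq> L (max k d) (max k d)"
      using Lk[of k "max k d" d] Ld'[of d "max k d" "max k d"] by auto
    then have "L k d \<subseteq> L N N" using N[of "max k d"] N'(1) k by auto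
    ultimately show ?thesis using Lk[OF k, of d] by blast
  qed
  have "Q k = Q N'" if k: "k \<ge> N'" for k
  proof -
    have "Q k \<inter> ?P d \<subseteq> Q N'" for d
    proof (induction d)
      case 0
      then show ?case using stableD(2)[OF Qst, of N'] by auto
    next
      case (Suc d)
      show ?case
      proof
        fix x assume x: "x \<in> Q k \<inter> ?P (Suc d)"
        then obtain r m where *: "x = r \<oplus>\<^bsub>M\<^esub> z [^] d \<odot>\<^bsub>M\<^esub> m" "r \<in> ?P d" "m \<in> P" by auto
        then have "m \<in> L k d" using x by (auto simp: L_def)
        then have "m \<in> L N' d" using Leq[OF k] by simp
        then obtain r' where r': "r' \<in> ?P d" "r' \<oplus>\<^bsub>M\<^esub> z [^] d \<odot>\<^bsub>M\<^esub> m \<in> Q N'" by (auto simp: L_def)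
        define y where "y = r' \<oplus>\<^bsub>M\<^esub> z [^] d \<odot>\<^bsub>M\<^esub> m"
        have c: "r \<in> carrier M" "r' \<in> carrier M" "m \<in> carrier M"
          using * r' Pd(1) stableD(1)[OF st] by blast+
        have yc: "x \<in> carrier M" "y \<in> carrier M" using c z by (auto simp: *(1) y_def smult_closed)
        have "x \<ominus>\<^bsub>M\<^esub> y = r \<ominus>\<^bsub>M\<^esub> r'" using c z by (simp add: *(1) y_def add_minus_add smult_closed)
        moreover have "r \<ominus>\<^bsub>M\<^esub> r' \<in> ?P d" by (rule stable_minus[OF st neg *(2) r'(1)])
        moreover have "y \<in> Q k" using r'(2) mono[OF k] by (auto simp: y_def)
        then have "x \<ominus>\<^bsub>M\<^esub> y \<in> Q k" using stable_minus[OF Qst' neg, of x k y] x by auto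
        ultimately have "x \<ominus>\<^bsub>M\<^esub> y \<in> Q N'" using Suc by auto
        then have "(x \<ominus>\<^bsub>M\<^esub> y) \<oplus>\<^bsub>M\<^esub> y \<in> Q N'" using stableD(3)[OF Qst] r'(2) by (auto simp: y_def)
        then show "x \<in> Q N'" using yc by (simp add: minus_add_cancel)
      qed
    qed
    then have "Q k \<subseteq> Q N'" using Q by blast
    then show ?thesis using mono[OF k] by blast
  qed
  then show "\<exists>N. \<forall>k\<ge>N. Q k = Q N" by blast
qed

section \<open>Baer's criterion\<close>

definition regular_module :: "('r, 'c) ring_scheme \<Rightarrow> ('r, 'r) module" where
  "regular_module R = \<lparr>carrier = carrier R, monoid.mult = monoid.mult R, one = one R, zero = zero R,
     add = add R, smult = monoid.mult R\<rparr>"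

lemma regular_module_simps [simp]:
  "carrier (regular_module R) = carrier R" "zero (regular_module R) = zero R"
  "add (regular_module R) = add R" "smult (regular_module R) = monoid.mult R"
  by (simp_all add: regular_module_def)

lemma (in ring) left_module_regular: "left_module R (regular_module R)"
proof -
  interpret N: abelian_group "regular_module R" by (rule abelian_group_cong) simp_all
  show ?thesis by unfold_locales (simp_all add: l_distr r_distr m_assoc)
qed

text \<open>A homomorphism from a submodule of \<open>N\<close> to \<open>E\<close> is represented by its graph, a submodule of
  \<open>N \<times> E\<close> that meets \<open>0 \<times> E\<close> trivially. Such graphs are easy to sum and to unite.\<close>

definition linear_graph ::
    "('r, 'c) ring_scheme \<Rightarrow> ('r, 'n, 'd) module_scheme \<Rightarrow> ('r, 'e, 'f) module_scheme \<Rightarrow> ('n \<times> 'e) set \<Rightarrow> bool" where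
  "linear_graph R N E G \<longleftrightarrow> G \<subseteq> carrier N \<times> carrier E \<and> (\<zero>\<^bsub>N\<^esub>, \<zero>\<^bsub>E\<^esub>) \<in> G \<and>
     (\<forall>x e y f. (x, e) \<in> G \<longrightarrow> (y, f) \<in> G \<longrightarrow> (x \<oplus>\<^bsub>N\<^esub> y, e \<oplus>\<^bsub>E\<^esub> f) \<in> G) \<and>
     (\<forall>a\<in>carrier R. \<forall>x e. (x, e) \<in> G \<longrightarrow> (a \<odot>\<^bsub>N\<^esub> x, a \<odot>\<^bsub>E\<^esub> e) \<in> G) \<and>
     (\<forall>e. (\<zero>\<^bsub>N\<^esub>, e) \<in> G \<longrightarrow> e = \<zero>\<^bsub>E\<^esub>)"

lemma linear_graphI:
  assumes "\<And>x e. (x, e) \<in> G \<Longrightarrow> x \<in> carrier N \<and> e \<in> carrier E" "(\<zero>\<^bsub>N\<^esub>, \<zero>\<^bsub>E\<^esub>) \<in> G"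
    "\<And>x e y f. (x, e) \<in> G \<Longrightarrow> (y, f) \<in> G \<Longrightarrow> (x \<oplus>\<^bsub>N\<^esub> y, e \<oplus>\<^bsub>E\<^esub> f) \<in> G"
    "\<And>a x e. a \<in> carrier R \<Longrightarrow> (x, e) \<in> G \<Longrightarrow> (a \<odot>\<^bsub>N\<^esub> x, a \<odot>\<^bsub>E\<^esub> e) \<in> G"
    "\<And>e. (\<zero>\<^bsub>N\<^esub>, e) \<in> G \<Longrightarrow> e = \<zero>\<^bsub>E\<^esub>"
  shows "linear_graph R N E G"
proof -
  have sub: "G \<subseteq> carrier N \<times> carrier E" using assms(1) by auto
  show ?thesis unfolding linear_graph_def
    by (intro conjI allI impI ballI;
      (rule sub assms(2) | erule (1) assms(3) | erule (1) assms(4) | erule assms(5)))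
qed

lemma linear_graphD:
  assumes "linear_graph R N E G"
  shows "\<And>x e. (x, e) \<in> G \<Longrightarrow> x \<in> carrier N" "\<And>x e. (x, e) \<in> G \<Longrightarrow> e \<in> carrier E"
    "(\<zero>\<^bsub>N\<^esub>, \<zero>\<^bsub>E\<^esub>) \<in> G"
    "\<And>x e y f. (x, e) \<in> G \<Longrightarrow> (y, f) \<in> G \<Longrightarrow> (x \<oplus>\<^bsub>N\<^esub> y, e \<oplus>\<^bsub>E\<^esub> f) \<in> G"
    "\<And>a x e. a \<in> carrier R \<Longrightarrow> (x, e) \<in> G \<Longrightarrow> (a \<odot>\<^bsub>N\<^esub> x, a \<odot>\<^bsub>E\<^esub> e) \<in> G"
    "\<And>e. (\<zero>\<^bsub>N\<^esub>, e) \<in> G \<Longrightarrow> e = \<zero>\<^bsub>E\<^esub>"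
  using assms unfolding linear_graph_def by (fast, fast, blast, blast, blast, blast)

text \<open>Every homomorphism from a left ideal to \<open>E\<close> is the multiplication of some element of \<open>E\<close>.\<close>

definition baer :: "('r, 'c) ring_scheme \<Rightarrow> ('r, 'e, 'f) module_scheme \<Rightarrow> bool" where
  "baer R E \<longleftrightarrow> (\<forall>G. linear_graph R (regular_module R) E G \<longrightarrow>
     (\<exists>e\<in>carrier E. \<forall>u y. (u, y) \<in> G \<longrightarrow> y = u \<odot>\<^bsub>E\<^esub> e))"

locale module_pair = N: left_module R N + E: left_module R E for R (structure) and N and E
begin

lemma graph_minus:
  assumes G: "linear_graph R N E G" and "(x, e) \<in> G" "(y, f) \<in> G"
  shows "(x \<ominus>\<^bsub>N\<^esub> y, e \<ominus>\<^bsub>E\<^esub> f) \<in> G"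
proof -
  note D = linear_graphD[OF G]
  have "((\<ominus> \<one>) \<odot>\<^bsub>N\<^esub> y, (\<ominus> \<one>) \<odot>\<^bsub>E\<^esub> f) \<in> G" by (rule D(5)) (use assms in auto)
  then have "(\<ominus>\<^bsub>N\<^esub> y, \<ominus>\<^bsub>E\<^esub> f) \<in> G" using D(1,2)[OF assms(3)] by (simp add: N.smult_neg_one E.smult_neg_one)
  then show ?thesis using D(4)[OF assms(2)] by (simp add: a_minus_def)
qed

lemma graph_unique:
  assumes G: "linear_graph R N E G" and "(x, e) \<in> G" "(x, f) \<in> G" shows "e = f"
proof -
  note D = linear_graphD[OF G]
  have "(x \<ominus>\<^bsub>N\<^esub> x, e \<ominus>\<^bsub>E\<^esub> f) \<in> G" by (rule graph_minus[OF assms])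
  then have "e \<ominus>\<^bsub>E\<^esub> f = \<zero>\<^bsub>E\<^esub>" using D(1)[OF assms(2)] D(6) by (simp add: N.M.minus_eq N.M.r_neg)
  then show ?thesis using D(2)[OF assms(2)] D(2)[OF assms(3)] by simp
qed

text \<open>The scalars that multiply \<open>y\<close> into the domain form a left ideal; the element that Baer's condition
  yields for it is a consistent value at \<open>y\<close>.\<close>

lemma graph_adjoin:
  assumes B: "baer R E" and G: "linear_graph R N E G" and y: "y \<in> carrier N"
  shows "\<exists>G'. linear_graph R N E G' \<and> G \<subseteq> G' \<and> y \<in> Domain G'"
proof -
  note D = linear_graphD[OF G]
  let ?H = "{(u, e). u \<in> carrier R \<and> (u \<odot>\<^bsub>N\<^esub> y, e) \<in> G}"
  have "linear_graph R (regular_module R) E ?H"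
  proof (rule linear_graphI)
    show "(\<zero>\<^bsub>regular_module R\<^esub>, \<zero>\<^bsub>E\<^esub>) \<in> ?H" using D(3) y by (simp add: N.smult_l_null)
    show "e = \<zero>\<^bsub>E\<^esub>" if "(\<zero>\<^bsub>regular_module R\<^esub>, e) \<in> ?H" for e
      using that D(6)[of e] y by (simp add: N.smult_l_null)
    show "x \<in> carrier (regular_module R) \<and> e \<in> carrier E" if "(x, e) \<in> ?H" for x e
      using that D(2) by auto
    show "(u \<oplus>\<^bsub>regular_module R\<^esub> v, e \<oplus>\<^bsub>E\<^esub> f) \<in> ?H" if "(u, e) \<in> ?H" "(v, f) \<in> ?H" for u e v f
      using that D(4)[of "u \<odot>\<^bsub>N\<^esub> y" e] y by (simp add: N.smult_l_distr)
    show "(a \<odot>\<^bsub>regular_module R\<^esub> u, a \<odot>\<^bsub>E\<^esub> e) \<in> ?H" if "a \<in> carrier R" "(u, e) \<in> ?H" for a u e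
      using that D(5)[of a "u \<odot>\<^bsub>N\<^esub> y" e] y by (simp add: N.smult_assoc)
  qed
  then obtain e0 where e0: "e0 \<in> carrier E" "\<And>u e. (u, e) \<in> ?H \<Longrightarrow> e = u \<odot>\<^bsub>E\<^esub> e0"
    using B unfolding baer_def by meson
  define G' where "G' = {(x \<oplus>\<^bsub>N\<^esub> u \<odot>\<^bsub>N\<^esub> y, e \<oplus>\<^bsub>E\<^esub> u \<odot>\<^bsub>E\<^esub> e0) | x e u. (x, e) \<in> G \<and> u \<in> carrier R}"
  have G'I: "(x \<oplus>\<^bsub>N\<^esub> u \<odot>\<^bsub>N\<^esub> y, e \<oplus>\<^bsub>E\<^esub> u \<odot>\<^bsub>E\<^esub> e0) \<in> G'" if "(x, e) \<in> G" "u \<in> carrier R" for x e u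
    using that unfolding G'_def by blast
  have G'E: "\<exists>x f u. a = x \<oplus>\<^bsub>N\<^esub> u \<odot>\<^bsub>N\<^esub> y \<and> e = f \<oplus>\<^bsub>E\<^esub> u \<odot>\<^bsub>E\<^esub> e0 \<and> (x, f) \<in> G \<and> u \<in> carrier R"
    if "(a, e) \<in> G'" for a e
    using that unfolding G'_def by blast
  have "linear_graph R N E G'"
  proof (rule linear_graphI)
    fix x e assume "(x, e) \<in> G'"
    then show "x \<in> carrier N \<and> e \<in> carrier E" using G'E[of x e] D(1,2) y e0(1)
      by (auto intro!: N.M.a_closed E.M.a_closed N.smult_closed E.smult_closed)
  next
    show "(\<zero>\<^bsub>N\<^esub>, \<zero>\<^bsub>E\<^esub>) \<in> G'" using G'I[OF D(3), of \<zero>] y e0(1) by (simp add: N.smult_l_null E.smult_l_null)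
  next
    fix a e b f assume g: "(a, e) \<in> G'" "(b, f) \<in> G'"
    obtain a' e' u b' f' v where *: "(a', e') \<in> G" "(b', f') \<in> G" "u \<in> carrier R" "v \<in> carrier R"
      "a = a' \<oplus>\<^bsub>N\<^esub> u \<odot>\<^bsub>N\<^esub> y" "e = e' \<oplus>\<^bsub>E\<^esub> u \<odot>\<^bsub>E\<^esub> e0" "b = b' \<oplus>\<^bsub>N\<^esub> v \<odot>\<^bsub>N\<^esub> y" "f = f' \<oplus>\<^bsub>E\<^esub> v \<odot>\<^bsub>E\<^esub> e0"
      using G'E[OF g(1)] G'E[OF g(2)] by metis
    have c: "a' \<in> carrier N" "b' \<in> carrier N" "e' \<in> carrier E" "f' \<in> carrier E" using * D(1,2) by blast+
    have "a \<oplus>\<^bsub>N\<^esub> b = (a' \<oplus>\<^bsub>N\<^esub> b') \<oplus>\<^bsub>N\<^esub> (u \<oplus> v) \<odot>\<^bsub>N\<^esub> y" "e \<oplus>\<^bsub>E\<^esub> f = (e' \<oplus>\<^bsub>E\<^esub> f') \<oplus>\<^bsub>E\<^esub> (u \<oplus> v) \<odot>\<^bsub>E\<^esub> e0"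
      using * c y e0(1) by (simp_all add: N.smult_l_distr E.smult_l_distr N.smult_closed E.smult_closed
          N.add_swap E.add_swap)
    then show "(a \<oplus>\<^bsub>N\<^esub> b, e \<oplus>\<^bsub>E\<^esub> f) \<in> G'" using G'I[OF D(4)[OF *(1,2)], of "u \<oplus> v"] * by simp
  next
    fix a x e assume a: "a \<in> carrier R" and g: "(x, e) \<in> G'"
    obtain x' e' u where *: "(x', e') \<in> G" "u \<in> carrier R"
      "x = x' \<oplus>\<^bsub>N\<^esub> u \<odot>\<^bsub>N\<^esub> y" "e = e' \<oplus>\<^bsub>E\<^esub> u \<odot>\<^bsub>E\<^esub> e0"
      using G'E[OF g] by blast
    have c: "x' \<in> carrier N" "e' \<in> carrier E" using * D(1,2) by blast+
    have "a \<odot>\<^bsub>N\<^esub> x = a \<odot>\<^bsub>N\<^esub> x' \<oplus>\<^bsub>N\<^esub> (a \<otimes> u) \<odot>\<^bsub>N\<^esub> y" "a \<odot>\<^bsub>E\<^esub> e = a \<odot>\<^bsub>E\<^esub> e' \<oplus>\<^bsub>E\<^esub> (a \<otimes> u) \<odot>\<^bsub>E\<^esub> e0"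
      using * c y e0(1) a by (simp_all add: N.smult_r_distr E.smult_r_distr N.smult_closed E.smult_closed
          N.smult_assoc E.smult_assoc)
    then show "(a \<odot>\<^bsub>N\<^esub> x, a \<odot>\<^bsub>E\<^esub> e) \<in> G'" using G'I[OF D(5)[OF a *(1)], of "a \<otimes> u"] * a by simp
  next
    fix e assume g: "(\<zero>\<^bsub>N\<^esub>, e) \<in> G'"
    obtain x' e' u where *: "(x', e') \<in> G" "u \<in> carrier R"
      "\<zero>\<^bsub>N\<^esub> = x' \<oplus>\<^bsub>N\<^esub> u \<odot>\<^bsub>N\<^esub> y" "e = e' \<oplus>\<^bsub>E\<^esub> u \<odot>\<^bsub>E\<^esub> e0"
      using G'E[OF g] by blast
    have c: "x' \<in> carrier N" "e' \<in> carrier E" using * D(1,2) by blast+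
    have "(\<zero>\<^bsub>N\<^esub> \<ominus>\<^bsub>N\<^esub> x', \<zero>\<^bsub>E\<^esub> \<ominus>\<^bsub>E\<^esub> e') \<in> G" by (rule graph_minus[OF G D(3) *(1)])
    moreover have "\<zero>\<^bsub>N\<^esub> \<ominus>\<^bsub>N\<^esub> x' = u \<odot>\<^bsub>N\<^esub> y"
    proof -
      have uy: "u \<odot>\<^bsub>N\<^esub> y \<in> carrier N" using *(2) y by (rule N.smult_closed)
      have "u \<odot>\<^bsub>N\<^esub> y \<oplus>\<^bsub>N\<^esub> x' = \<zero>\<^bsub>N\<^esub>" using N.M.a_comm[OF uy c(1)] *(3)[symmetric] by simp
      then show ?thesis using N.M.minus_equality[OF _ c(1) uy] c(1) uy by (simp add: N.M.minus_eq)
    qed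
    moreover have "\<zero>\<^bsub>E\<^esub> \<ominus>\<^bsub>E\<^esub> e' = \<ominus>\<^bsub>E\<^esub> e'" using c by (simp add: E.M.minus_eq)
    ultimately have "(u, \<ominus>\<^bsub>E\<^esub> e') \<in> ?H" using *(2) by simp
    then have "\<ominus>\<^bsub>E\<^esub> e' = u \<odot>\<^bsub>E\<^esub> e0" by (rule e0(2))
    then show "e = \<zero>\<^bsub>E\<^esub>" using *(4) E.M.r_neg[OF c(2)] by simp
  qed
  moreover have "G \<subseteq> G'"
  proof clarify
    fix x e assume "(x, e) \<in> G"
    then show "(x, e) \<in> G'" using G'I[of x e \<zero>] D(1,2) y e0(1) by (simp add: N.smult_l_null E.smult_l_null)
  qed
  moreover have "(y, e0) \<in> G'" using G'I[OF D(3), of \<one>] y e0(1) by (simp add: N.smult_one E.smult_one)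
  then have "y \<in> Domain G'" by blast
  ultimately show ?thesis by blast
qed

theorem baer_criterion:
  assumes B: "baer R E" and G: "linear_graph R N E G"
  shows "\<exists>h\<in>module_hom R N E. \<forall>x e. (x, e) \<in> G \<longrightarrow> h x = e"
proof -
  let ?S = "{G'. linear_graph R N E G' \<and> G \<subseteq> G'}"
  have "\<exists>T\<in>?S. \<forall>X\<in>?S. T \<subseteq> X \<longrightarrow> X = T"
  proof (rule subset_Zorn_nonempty)
    show "?S \<noteq> {}" using G by blast
  next
    fix \<C> assume ne: "\<C> \<noteq> {}" and ch: "subset.chain ?S \<C>"
    have lin: "linear_graph R N E X" "G \<subseteq> X" if "X \<in> \<C>" for X
      using ch that unfolding subset_chain_def by blast+
    have two: "\<exists>X\<in>\<C>. p \<in> X \<and> q \<in> X" if pq: "p \<in> \<Union>\<C>" "q \<in> \<Union>\<C>" for p q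
    proof -
      obtain X Y where XY: "X \<in> \<C>" "Y \<in> \<C>" "p \<in> X" "q \<in> Y" using pq by blast
      have "X \<subseteq> Y \<or> Y \<subseteq> X" using ch XY(1,2) unfolding subset_chain_def by blast
      then show ?thesis using XY by blast
    qed
    have "linear_graph R N E (\<Union>\<C>)"
    proof (rule linear_graphI)
      show "(\<zero>\<^bsub>N\<^esub>, \<zero>\<^bsub>E\<^esub>) \<in> \<Union>\<C>" using ne linear_graphD(3)[OF lin(1)] by blast
      show "(x \<oplus>\<^bsub>N\<^esub> y, e \<oplus>\<^bsub>E\<^esub> f) \<in> \<Union>\<C>" if "(x, e) \<in> \<Union>\<C>" "(y, f) \<in> \<Union>\<C>" for x e y f
        using two[OF that] linear_graphD(4)[OF lin(1)] by blast
      show "x \<in> carrier N \<and> e \<in> carrier E" if "(x, e) \<in> \<Union>\<C>" for x e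
        using that linear_graphD(1,2)[OF lin(1)] by blast
      show "(a \<odot>\<^bsub>N\<^esub> x, a \<odot>\<^bsub>E\<^esub> e) \<in> \<Union>\<C>" if "a \<in> carrier R" "(x, e) \<in> \<Union>\<C>" for a x e
        using that(2) linear_graphD(5)[OF lin(1) that(1)] by blast
      show "e = \<zero>\<^bsub>E\<^esub>" if "(\<zero>\<^bsub>N\<^esub>, e) \<in> \<Union>\<C>" for e
        using that linear_graphD(6)[OF lin(1)] by blast
    qed
    then show "\<Union>\<C> \<in> ?S" using ne lin(2) by blast
  qed
  then obtain T where TS: "T \<in> ?S" and max': "\<forall>X\<in>?S. T \<subseteq> X \<longrightarrow> X = T" by (elim bexE)
  have T: "linear_graph R N E T" "G \<subseteq> T" using TS by simp_all
  have max: "X = T" if "linear_graph R N E X" "T \<subseteq> X" for X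
    using max' that order_trans[OF T(2) that(2)] by simp
  note D = linear_graphD[OF T(1)]
  have dom: "y \<in> Domain T" if y: "y \<in> carrier N" for y
  proof -
    obtain T' where "linear_graph R N E T'" "T \<subseteq> T'" "y \<in> Domain T'" using graph_adjoin[OF B T(1) y] by (elim exE conjE)
    then show ?thesis using max[of T'] by simp
  qed
  define h where "h x = (THE e. (x, e) \<in> T)" for x
  have h: "h x = e" if "(x, e) \<in> T" for x e
    unfolding h_def using graph_unique[OF T(1)] that by blast
  have hT: "(x, h x) \<in> T" if "x \<in> carrier N" for x
    using dom[OF that] h by blast
  have "h \<in> module_hom R N E"
    unfolding module_hom_def
  proof (intro CollectI conjI allI impI)
    show "h \<in> carrier N \<rightarrow> carrier E" using D(2)[OF hT] by blast
    show "h (x \<oplus>\<^bsub>N\<^esub> y) = h x \<oplus>\<^bsub>E\<^esub> h y" if "x \<in> carrier N \<and> y \<in> carrier N" for x y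
      by (rule h[OF D(4)]) (use that hT in auto)
    show "h (a \<odot>\<^bsub>N\<^esub> x) = a \<odot>\<^bsub>E\<^esub> h x" if "a \<in> carrier R \<and> x \<in> carrier N" for a x
      by (rule h[OF D(5)]) (use that hT in auto)
  qed
  then show ?thesis using h T(2) by blast
qed

end

lemma injective_left_module_if_baer:
  fixes R :: "('r, 'c) ring_scheme" and E :: "('r, 'e, 'f) module_scheme"
  assumes E: "left_module R E" and B: "baer R E"
  shows "injective_left_module TYPE('m) TYPE('n) R E"
  unfolding injective_left_module_def
proof (intro conjI allI impI E)
  fix M :: "('r, 'm) module" and N :: "('r, 'n) module" and i g
  assume as: "left_module R M \<and> left_module R N \<and>
      i \<in> module_hom R M N \<and> inj_on i (carrier M) \<and> g \<in> module_hom R M E"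
  interpret M: left_module R M using as by blast
  interpret P: module_pair R N E using as E by (auto intro: module_pair.intro)
  have i: "i \<in> carrier M \<rightarrow> carrier N" "\<And>x y. x \<in> carrier M \<Longrightarrow> y \<in> carrier M \<Longrightarrow> i (x \<oplus>\<^bsub>M\<^esub> y) = i x \<oplus>\<^bsub>N\<^esub> i y"
    "\<And>a x. a \<in> carrier R \<Longrightarrow> x \<in> carrier M \<Longrightarrow> i (a \<odot>\<^bsub>M\<^esub> x) = a \<odot>\<^bsub>N\<^esub> i x" "inj_on i (carrier M)"
    using as unfolding module_hom_def by auto
  have g: "g \<in> carrier M \<rightarrow> carrier E" "\<And>x y. x \<in> carrier M \<Longrightarrow> y \<in> carrier M \<Longrightarrow> g (x \<oplus>\<^bsub>M\<^esub> y) = g x \<oplus>\<^bsub>E\<^esub> g y"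
    "\<And>a x. a \<in> carrier R \<Longrightarrow> x \<in> carrier M \<Longrightarrow> g (a \<odot>\<^bsub>M\<^esub> x) = a \<odot>\<^bsub>E\<^esub> g x"
    using as unfolding module_hom_def by auto
  have i0: "i \<zero>\<^bsub>M\<^esub> = \<zero>\<^bsub>N\<^esub>"
    using i(1) i(3)[of "\<zero>\<^bsub>R\<^esub>" "\<zero>\<^bsub>M\<^esub>"] by (simp add: M.smult_l_null P.N.smult_l_null funcset_mem)
  have g0: "g \<zero>\<^bsub>M\<^esub> = \<zero>\<^bsub>E\<^esub>"
    using g(1) g(3)[of "\<zero>\<^bsub>R\<^esub>" "\<zero>\<^bsub>M\<^esub>"] by (simp add: M.smult_l_null P.E.smult_l_null funcset_mem)
  let ?G = "(\<lambda>x. (i x, g x)) ` carrier M"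
  have GI: "(a, b) \<in> ?G" if "x \<in> carrier M" "a = i x" "b = g x" for a b x using that by blast
  have "linear_graph R N E ?G"
  proof (rule linear_graphI)
    show "(\<zero>\<^bsub>N\<^esub>, \<zero>\<^bsub>E\<^esub>) \<in> ?G" by (rule GI[of "\<zero>\<^bsub>M\<^esub>"]) (simp_all add: i0 g0)
    show "x \<in> carrier N \<and> e \<in> carrier E" if "(x, e) \<in> ?G" for x e using that i(1) g(1) by auto
    show "(x \<oplus>\<^bsub>N\<^esub> y, e \<oplus>\<^bsub>E\<^esub> f) \<in> ?G" if xy: "(x, e) \<in> ?G" "(y, f) \<in> ?G" for x e y f
    proof -
      obtain a b where "a \<in> carrier M" "b \<in> carrier M" "x = i a" "y = i b" "e = g a" "f = g b"
        using xy by blast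
      then show ?thesis using GI[of "a \<oplus>\<^bsub>M\<^esub> b"] i g by simp
    qed
    show "(a \<odot>\<^bsub>N\<^esub> x, a \<odot>\<^bsub>E\<^esub> e) \<in> ?G" if ax: "a \<in> carrier R" "(x, e) \<in> ?G" for a x e
    proof -
      obtain b where "b \<in> carrier M" "x = i b" "e = g b" using ax(2) by blast
      then show ?thesis using GI[of "a \<odot>\<^bsub>M\<^esub> b"] i g ax(1) M.smult_closed by simp
    qed
    show "e = \<zero>\<^bsub>E\<^esub>" if e: "(\<zero>\<^bsub>N\<^esub>, e) \<in> ?G" for e
    proof -
      obtain b where b: "b \<in> carrier M" "\<zero>\<^bsub>N\<^esub> = i b" "e = g b" using e by blast
      then have "b = \<zero>\<^bsub>M\<^esub>" using inj_onD[OF i(4), of b "\<zero>\<^bsub>M\<^esub>"] i0 by simp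
      then show ?thesis using b g0 by simp
    qed
  qed
  note lg = this
  obtain h where h: "h \<in> module_hom R N E" "\<forall>x e. (x, e) \<in> ?G \<longrightarrow> h x = e"
    using P.baer_criterion[OF B lg] by (elim bexE)
  have "h (i x) = g x" if "x \<in> carrier M" for x
    using h(2) GI[OF that refl refl] by simp
  then show "\<exists>h\<in>module_hom R N E. \<forall>x\<in>carrier M. h (i x) = g x" using h(1) by blast
qed

section \<open>Torsion submodules of injective modules\<close>

definition torsion :: "'r set \<Rightarrow> ('r, 'e, 'f) module_scheme \<Rightarrow> 'e set" where
  "torsion T E = {x \<in> carrier E. \<exists>t\<in>T. t \<odot>\<^bsub>E\<^esub> x = \<zero>\<^bsub>E\<^esub>}"

definition left_noetherian :: "('r, 'c) ring_scheme \<Rightarrow> bool" where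
  "left_noetherian R \<longleftrightarrow> noetherian (regular_module R) (carrier R) (carrier R)"

locale central_multiplicative_set = ring R for R (structure) +
  fixes T
  assumes T_carrier: "t \<in> T \<Longrightarrow> t \<in> carrier R"
    and T_one: "\<one> \<in> T"
    and T_mult: "\<lbrakk>s \<in> T; t \<in> T\<rbrakk> \<Longrightarrow> s \<otimes> t \<in> T"
    and T_central: "\<lbrakk>t \<in> T; u \<in> carrier R\<rbrakk> \<Longrightarrow> t \<otimes> u = u \<otimes> t"
begin

lemma T_pow: "t \<in> T \<Longrightarrow> t [^] (n::nat) \<in> T"
  by (induction n) (auto simp: T_one T_mult)

end

lemma (in left_module) smult_swap:
  "\<lbrakk>a \<in> carrier R; b \<in> carrier R; x \<in> carrier M; a \<otimes> b = b \<otimes> a\<rbrakk> \<Longrightarrow>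
     a \<odot>\<^bsub>M\<^esub> (b \<odot>\<^bsub>M\<^esub> x) = b \<odot>\<^bsub>M\<^esub> (a \<odot>\<^bsub>M\<^esub> x)"
  by (simp add: smult_assoc[symmetric])

lemma (in left_module) submodule_left_module:
  assumes "stable M (carrier R) W" shows "left_module R (M\<lparr>carrier := W\<rparr>)"
proof -
  note W = stableD[OF assms]
  have c: "x \<in> carrier M" if "x \<in> W" for x using that W(1) by blast
  interpret W: abelian_group "M\<lparr>carrier := W\<rparr>"
  proof (rule abelian_groupI)
    fix x assume "x \<in> carrier (M\<lparr>carrier := W\<rparr>)"
    then have x: "x \<in> W" by simp
    have "(\<ominus> \<one>) \<odot>\<^bsub>M\<^esub> x \<in> W" using W(4) x by simp
    then show "\<exists>y\<in>carrier (M\<lparr>carrier := W\<rparr>). y \<oplus>\<^bsub>M\<lparr>carrier := W\<rparr>\<^esub> x = \<zero>\<^bsub>M\<lparr>carrier := W\<rparr>\<^esub>"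
      using c[OF x] by (intro bexI[of _ "(\<ominus> \<one>) \<odot>\<^bsub>M\<^esub> x"]) (simp_all add: smult_neg_one M.l_neg)
  qed (use W c in \<open>simp_all add: M.a_ac\<close>)
  show ?thesis
    by unfold_locales
       (use W c in \<open>simp_all add: smult_l_distr smult_r_distr smult_assoc smult_one\<close>)
qed

lemma (in left_module) torsion_stable:
  assumes T: "central_multiplicative_set R T" shows "stable M (carrier R) (torsion T M)"
proof -
  interpret T: central_multiplicative_set R T by (rule T)
  show ?thesis
  proof (rule stableI)
    show "\<zero>\<^bsub>M\<^esub> \<in> torsion T M" using T.T_one smult_r_null by (auto simp: torsion_def)
  next
    fix x y assume "x \<in> torsion T M" "y \<in> torsion T M"
    then obtain s t where *: "x \<in> carrier M" "y \<in> carrier M" "s \<in> T" "t \<in> T" "s \<odot>\<^bsub>M\<^esub> x = \<zero>\<^bsub>M\<^esub>" "t \<odot>\<^bsub>M\<^esub> y = \<zero>\<^bsub>M\<^esub>"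
      by (auto simp: torsion_def)
    note c = T.T_carrier[OF *(3)] T.T_carrier[OF *(4)]
    have "(s \<otimes> t) \<odot>\<^bsub>M\<^esub> x = t \<odot>\<^bsub>M\<^esub> (s \<odot>\<^bsub>M\<^esub> x)"
      using smult_assoc[OF c *(1)] smult_swap[OF c *(1) T.T_central[OF *(3) c(2)]] by (rule trans)
    moreover have "(s \<otimes> t) \<odot>\<^bsub>M\<^esub> y = s \<odot>\<^bsub>M\<^esub> (t \<odot>\<^bsub>M\<^esub> y)" by (rule smult_assoc[OF c *(2)])
    ultimately have "(s \<otimes> t) \<odot>\<^bsub>M\<^esub> (x \<oplus>\<^bsub>M\<^esub> y) = \<zero>\<^bsub>M\<^esub>"
      using * c by (simp add: smult_r_distr smult_r_null)
    then show "x \<oplus>\<^bsub>M\<^esub> y \<in> torsion T M" using * T.T_mult[OF *(3,4)] by (auto simp: torsion_def)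
  next
    fix a x assume a: "a \<in> carrier R" and "x \<in> torsion T M"
    then obtain t where *: "x \<in> carrier M" "t \<in> T" "t \<odot>\<^bsub>M\<^esub> x = \<zero>\<^bsub>M\<^esub>" by (auto simp: torsion_def)
    note c = T.T_carrier[OF *(2)]
    have "t \<odot>\<^bsub>M\<^esub> (a \<odot>\<^bsub>M\<^esub> x) = a \<odot>\<^bsub>M\<^esub> (t \<odot>\<^bsub>M\<^esub> x)"
      by (rule smult_swap[OF c a *(1) T.T_central[OF *(2) a]])
    then show "a \<odot>\<^bsub>M\<^esub> x \<in> torsion T M" using * a by (auto simp: torsion_def smult_closed smult_r_null)
  qed (auto simp: torsion_def)
qed

text \<open>Let \<open>g\<close> be a homomorphism from a left ideal \<open>J\<close> to the torsion submodule. One \<open>s \<in> T\<close> kills its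
  image. The ideals \<open>{u. s\<^sup>k u \<in> J}\<close> ascend, so they are constant from some \<open>m\<close> on; therefore every
  element of \<open>J\<close> that is divisible by \<open>r = s\<^bsup>m+1\<^esup>\<close> lies in \<open>s J\<close> and is killed by \<open>g\<close>. So \<open>g\<close> extends by
  zero to \<open>J + r R\<close> and from there to \<open>R\<close>, and the extension takes values in the elements killed by
  \<open>r\<close>.\<close>

theorem (in left_module) baer_torsion:
  assumes T: "central_multiplicative_set R T" and noeth: "left_noetherian R" and B: "baer R M"
  shows "baer R (M\<lparr>carrier := torsion T M\<rparr>)" (is "baer R ?E")
  unfolding baer_def
proof (intro allI impI)
  interpret T: central_multiplicative_set R T by (rule T)
  let ?A = "regular_module R"
  interpret A: left_module R ?A by (rule R.left_module_regular)
  interpret P: module_pair R ?A M by unfold_locales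
  fix G assume G': "linear_graph R ?A ?E G"
  have D: "\<And>x e. (x, e) \<in> G \<Longrightarrow> x \<in> carrier R" "\<And>x e. (x, e) \<in> G \<Longrightarrow> e \<in> torsion T M"
    "(\<zero>, \<zero>\<^bsub>M\<^esub>) \<in> G" "\<And>x e y f. (x, e) \<in> G \<Longrightarrow> (y, f) \<in> G \<Longrightarrow> (x \<oplus> y, e \<oplus>\<^bsub>M\<^esub> f) \<in> G"
    "\<And>a x e. a \<in> carrier R \<Longrightarrow> (x, e) \<in> G \<Longrightarrow> (a \<otimes> x, a \<odot>\<^bsub>M\<^esub> e) \<in> G"
    "\<And>e. (\<zero>, e) \<in> G \<Longrightarrow> e = \<zero>\<^bsub>M\<^esub>"
    subgoal using linear_graphD(1)[OF G'] by simp
    subgoal using linear_graphD(2)[OF G'] by simp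
    subgoal using linear_graphD(3)[OF G'] by simp
    subgoal using linear_graphD(4)[OF G'] by simp
    subgoal using linear_graphD(5)[OF G'] by simp
    subgoal using linear_graphD(6)[OF G'] by simp
    done
  have tor: "e \<in> carrier M" "\<exists>t\<in>T. t \<odot>\<^bsub>M\<^esub> e = \<zero>\<^bsub>M\<^esub>" if "(u, e) \<in> G" for u e
    using D(2)[OF that] by (auto simp: torsion_def)
  have G: "linear_graph R ?A M G"
    by (rule linear_graphI; simp add: D(1,3,4,5,6) tor(1))
  \<comment> \<open>Since ideals satisfy the ascending chain condition, one \<open>s\<close> kills the whole image.\<close>
  define S where "S t = {u. \<exists>e. (u, e) \<in> G \<and> t \<odot>\<^bsub>M\<^esub> e = \<zero>\<^bsub>M\<^esub>}" for t
  have S: "stable ?A (carrier R) (S t)" if t: "t \<in> T" for t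
  proof (rule stableI)
    note tc = T.T_carrier[OF t]
    show "S t \<subseteq> carrier ?A" using D(1) by (auto simp: S_def)
    show "\<zero>\<^bsub>?A\<^esub> \<in> S t" using D(3) tc by (auto simp: S_def smult_r_null)
    show "x \<oplus>\<^bsub>?A\<^esub> y \<in> S t" if xy: "x \<in> S t" "y \<in> S t" for x y
    proof -
      obtain e f where "(x, e) \<in> G" "(y, f) \<in> G" "t \<odot>\<^bsub>M\<^esub> e = \<zero>\<^bsub>M\<^esub>" "t \<odot>\<^bsub>M\<^esub> f = \<zero>\<^bsub>M\<^esub>"
        using xy by (auto simp: S_def)
      then have "(x \<oplus> y, e \<oplus>\<^bsub>M\<^esub> f) \<in> G" "t \<odot>\<^bsub>M\<^esub> (e \<oplus>\<^bsub>M\<^esub> f) = \<zero>\<^bsub>M\<^esub>"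
        using D(4) tor(1) tc by (auto simp: smult_r_distr)
      then show ?thesis by (auto simp: S_def)
    qed
    show "a \<odot>\<^bsub>?A\<^esub> x \<in> S t" if a: "a \<in> carrier R" and x: "x \<in> S t" for a x
    proof -
      obtain e where e: "(x, e) \<in> G" "t \<odot>\<^bsub>M\<^esub> e = \<zero>\<^bsub>M\<^esub>" using x by (auto simp: S_def)
      have "t \<odot>\<^bsub>M\<^esub> (a \<odot>\<^bsub>M\<^esub> e) = a \<odot>\<^bsub>M\<^esub> (t \<odot>\<^bsub>M\<^esub> e)"
        by (rule smult_swap[OF tc a tor(1)[OF e(1)] T.T_central[OF t a]])
      then have "(a \<otimes> x, a \<odot>\<^bsub>M\<^esub> e) \<in> G" "t \<odot>\<^bsub>M\<^esub> (a \<odot>\<^bsub>M\<^esub> e) = \<zero>\<^bsub>M\<^esub>"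
        using e D(5)[OF a e(1)] a by (auto simp: smult_r_null)
      then show ?thesis by (auto simp: S_def)
    qed
  qed
  have Sc: "S t \<subseteq> carrier R" for t using D(1) by (auto simp: S_def)
  have n: "noetherian ?A (carrier R) (carrier R)" using noeth unfolding left_noetherian_def .
  obtain s where s: "s \<in> T" and smax: "\<And>t. t \<in> T \<Longrightarrow> S s \<subseteq> S t \<Longrightarrow> S t = S s"
    by (rule noetherian_maximal[OF n, of T S]) (use T.T_one S Sc in auto)
  note sc = T.T_carrier[OF s]
  have kill: "s \<odot>\<^bsub>M\<^esub> e = \<zero>\<^bsub>M\<^esub>" if e: "(u, e) \<in> G" for u e
  proof -
    obtain t where t: "t \<in> T" "t \<odot>\<^bsub>M\<^esub> e = \<zero>\<^bsub>M\<^esub>" using tor(2)[OF e] by blast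
    note tc = T.T_carrier[OF t(1)]
    have "S s \<subseteq> S (t \<otimes> s)"
    proof
      fix x assume "x \<in> S s"
      then obtain f where f: "(x, f) \<in> G" "s \<odot>\<^bsub>M\<^esub> f = \<zero>\<^bsub>M\<^esub>" by (auto simp: S_def)
      have "(t \<otimes> s) \<odot>\<^bsub>M\<^esub> f = \<zero>\<^bsub>M\<^esub>"
        using smult_assoc[OF tc sc tor(1)[OF f(1)]] f(2) tc by (simp add: smult_r_null)
      then show "x \<in> S (t \<otimes> s)" using f(1) by (auto simp: S_def)
    qed
    moreover have "(t \<otimes> s) \<odot>\<^bsub>M\<^esub> e = \<zero>\<^bsub>M\<^esub>"
      using smult_assoc[OF tc sc tor(1)[OF e]] smult_swap[OF tc sc tor(1)[OF e] T.T_central[OF t(1) sc]] t(2) sc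
      by (simp add: smult_r_null)
    then have "u \<in> S (t \<otimes> s)" using e by (auto simp: S_def)
    ultimately have "u \<in> S s" using smax[OF T.T_mult[OF t(1) s]] by simp
    then obtain e' where "(u, e') \<in> G" "s \<odot>\<^bsub>M\<^esub> e' = \<zero>\<^bsub>M\<^esub>" by (auto simp: S_def)
    then show ?thesis using P.graph_unique[OF G e] by simp
  qed
  \<comment> \<open>The \<open>u\<close> for which \<open>s\<^sup>k u\<close> lies in the domain \<open>J\<close> form ideals \<open>Q k\<close> that become constant.\<close>
  define J where "J = Domain G"
  define Q where "Q k = {u \<in> carrier R. s [^] k \<otimes> u \<in> J}" for k :: nat
  have J: "x \<oplus> y \<in> J" if "x \<in> J" "y \<in> J" for x y using that D(4) unfolding J_def Domain_iff by blast
  have J': "a \<otimes> x \<in> J" if "a \<in> carrier R" "x \<in> J" for a x using that D(5) unfolding J_def Domain_iff by blast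
  have sp: "s [^] k \<in> carrier R" for k :: nat using sc by simp
  have Q: "stable ?A (carrier R) (Q k)" for k
  proof (rule stableI)
    show "Q k \<subseteq> carrier ?A" by (auto simp: Q_def)
    have "\<zero> \<in> J" using D(3) by (auto simp: J_def)
    then show "\<zero>\<^bsub>?A\<^esub> \<in> Q k" using sp[of k] by (simp add: Q_def)
    show "x \<oplus>\<^bsub>?A\<^esub> y \<in> Q k" if "x \<in> Q k" "y \<in> Q k" for x y
      using that J sp[of k] by (auto simp: Q_def R.r_distr)
    show "a \<odot>\<^bsub>?A\<^esub> x \<in> Q k" if "a \<in> carrier R" "x \<in> Q k" for a x
    proof -
      have "s [^] k \<otimes> (a \<otimes> x) = a \<otimes> (s [^] k \<otimes> x)"
        using that sp[of k] T.T_central[OF T.T_pow[OF s] that(1), of k]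
        by (simp add: R.m_assoc[symmetric] Q_def)
      then show ?thesis using that J' by (auto simp: Q_def)
    qed
  qed
  have Qmono: "Q k \<subseteq> Q (Suc k)" for k :: nat
  proof
    fix u assume u: "u \<in> Q k"
    have "s [^] Suc k \<otimes> u = s \<otimes> (s [^] k \<otimes> u)"
      using u sc T.T_central[OF T.T_pow[OF s] sc, of k] by (simp add: Q_def R.m_assoc[symmetric])
    then show "u \<in> Q (Suc k)" using u J'[OF sc] by (auto simp: Q_def)
  qed
  obtain m where m: "\<And>k. k \<ge> m \<Longrightarrow> Q k = Q m"
    by (rule noetherianD[OF n, of Q]) (use Q Qmono in \<open>auto simp: Q_def\<close>)
  define r where "r = s [^] Suc m"
  have r: "r \<in> T" "r \<in> carrier R" using T.T_pow[OF s, of "Suc m"] T.T_carrier by (auto simp: r_def)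
  have AR: "e = \<zero>\<^bsub>M\<^esub>" if e: "(r \<otimes> u, e) \<in> G" and u: "u \<in> carrier R" for u e
  proof -
    have "u \<in> Q (Suc m)" using e u by (auto simp: Q_def J_def r_def)
    then have "u \<in> Q m" using m[of "Suc m"] by simp
    then obtain f where f: "(s [^] m \<otimes> u, f) \<in> G" by (auto simp: Q_def J_def)
    have "r \<otimes> u = s \<otimes> (s [^] m \<otimes> u)"
      using u sc T.T_central[OF T.T_pow[OF s] sc, of m] by (simp add: r_def R.m_assoc[symmetric])
    then have "(r \<otimes> u, s \<odot>\<^bsub>M\<^esub> f) \<in> G" using D(5)[OF sc f] by simp
    then have "e = s \<odot>\<^bsub>M\<^esub> f" using P.graph_unique[OF G e] by simp
    then show ?thesis using kill[OF f] by simp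
  qed
  \<comment> \<open>Hence the homomorphism extends by zero to \<open>r R\<close>; this makes the extension to \<open>R\<close> be killed by \<open>r\<close>.\<close>
  define H where "H = {(x \<oplus> r \<otimes> u, e) | x e u. (x, e) \<in> G \<and> u \<in> carrier R}"
  have HI: "(x \<oplus> r \<otimes> u, e) \<in> H" if "(x, e) \<in> G" "u \<in> carrier R" for x e u using that unfolding H_def by blast
  have HE: "\<exists>x u. y = x \<oplus> r \<otimes> u \<and> (x, e) \<in> G \<and> u \<in> carrier R" if "(y, e) \<in> H" for y e
    using that unfolding H_def by blast
  have "linear_graph R ?A M H"
  proof (rule linear_graphI)
    show "x \<in> carrier ?A \<and> e \<in> carrier M" if "(x, e) \<in> H" for x e
      using HE[OF that] D(1) tor(1) r by auto
    show "(\<zero>\<^bsub>?A\<^esub>, \<zero>\<^bsub>M\<^esub>) \<in> H" using HI[OF D(3) R.zero_closed] r by simp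
  next
    fix x e y f assume g: "(x, e) \<in> H" "(y, f) \<in> H"
    obtain x' u y' v where *: "x = x' \<oplus> r \<otimes> u" "y = y' \<oplus> r \<otimes> v" "(x', e) \<in> G" "(y', f) \<in> G"
      "u \<in> carrier R" "v \<in> carrier R" using HE[OF g(1)] HE[OF g(2)] by blast
    have c: "x' \<in> carrier R" "y' \<in> carrier R" using * D(1) by blast+
    have "x \<oplus> y = (x' \<oplus> y') \<oplus> r \<otimes> (u \<oplus> v)"
      using * c r A.add_swap by (simp add: R.r_distr)
    then show "(x \<oplus>\<^bsub>?A\<^esub> y, e \<oplus>\<^bsub>M\<^esub> f) \<in> H" using HI[OF D(4)[OF *(3,4)], of "u \<oplus> v"] * by simp
  next
    fix a x e assume a: "a \<in> carrier R" and g: "(x, e) \<in> H"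
    obtain x' u where *: "x = x' \<oplus> r \<otimes> u" "(x', e) \<in> G" "u \<in> carrier R" using HE[OF g] by blast
    have c: "x' \<in> carrier R" using * D(1) by blast
    have "a \<otimes> x = a \<otimes> x' \<oplus> r \<otimes> (a \<otimes> u)"
      using * c r a T.T_central[OF r(1) a] by (simp add: R.r_distr R.m_assoc[symmetric])
    then show "(a \<odot>\<^bsub>?A\<^esub> x, a \<odot>\<^bsub>M\<^esub> e) \<in> H" using HI[OF D(5)[OF a *(2)], of "a \<otimes> u"] * a by simp
  next
    fix e assume g: "(\<zero>\<^bsub>?A\<^esub>, e) \<in> H"
    obtain x' u where *: "\<zero> = x' \<oplus> r \<otimes> u" "(x', e) \<in> G" "u \<in> carrier R" using HE[OF g] by auto
    have c: "x' \<in> carrier R" using * D(1) by blast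
    have "\<ominus> (r \<otimes> u) = x'" by (rule R.minus_equality[OF *(1)[symmetric]]) (use c r *(3) in auto)
    then have "x' = r \<otimes> (\<ominus> u)" using r(2) *(3) by (simp add: R.r_minus)
    then show "e = \<zero>\<^bsub>M\<^esub>" using AR[of "\<ominus> u" e] *(2,3) by simp
  qed
  then obtain e where e: "e \<in> carrier M" "\<And>u y. (u, y) \<in> H \<Longrightarrow> y = u \<odot>\<^bsub>M\<^esub> e"
    using B unfolding baer_def by meson
  have "(r, \<zero>\<^bsub>M\<^esub>) \<in> H" using HI[OF D(3) R.one_closed] r by simp
  then have "r \<odot>\<^bsub>M\<^esub> e = \<zero>\<^bsub>M\<^esub>" using e(2) by metis
  then have "e \<in> carrier ?E" using e(1) r by (auto simp: torsion_def)
  moreover have "y = u \<odot>\<^bsub>?E\<^esub> e" if "(u, y) \<in> G" for u y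
    using e(2)[of u y] HI[OF that R.zero_closed] D(1)[OF that] r by simp
  ultimately show "\<exists>e\<in>carrier ?E. \<forall>u y. (u, y) \<in> G \<longrightarrow> y = u \<odot>\<^bsub>?E\<^esub> e" by blast
qed

section \<open>Monic polynomials in a central element\<close>

context central_subfield
begin

abbreviation reg where "reg \<equiv> regular_module R"

lemma left_module_reg: "left_module R reg" by (rule left_module_regular)

text \<open>The values at \<open>z\<close> of the polynomials over \<open>F\<close> of degree less than \<open>d\<close>, and those of the monic
  polynomials of degree \<open>d\<close>.\<close>

definition polys :: "'a \<Rightarrow> nat \<Rightarrow> 'a set" where
  "polys z d = combs reg F (\<lambda>i. z [^] i) d"

definition monics :: "'a \<Rightarrow> nat \<Rightarrow> 'a set" where
  "monics z d = {z [^] d \<oplus> r | r. r \<in> polys z d}"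

lemma F_stable: "stable reg F F"
  by (rule stableI) (auto simp: F_zero F_add F_mult F_carrier)

lemma F_combs_stable:
  assumes "\<And>i. a i \<in> carrier R" shows "stable reg F (combs reg F a d)"
proof -
  interpret A: left_module R reg by (rule left_module_reg)
  show ?thesis by (rule A.combs_stable[OF F_stable F_subset assms]) (use F_central assms in auto)
qed

lemma polys_stable: "z \<in> carrier R \<Longrightarrow> stable reg F (polys z d)"
  unfolding polys_def by (rule F_combs_stable) simp

lemma polys_Suc: "polys z (Suc d) = {x \<oplus> z [^] d \<otimes> c | x c. x \<in> polys z d \<and> c \<in> F}"
  by (simp add: polys_def)

lemma polys_0: "polys z 0 = {\<zero>}"
  by (simp add: polys_def)

lemma polys_carrier: "z \<in> carrier R \<Longrightarrow> x \<in> polys z d \<Longrightarrow> x \<in> carrier R"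
  using stableD(1)[OF polys_stable, of z d] by auto

lemma polys_mono:
  assumes z: "z \<in> carrier R" and "d \<le> e" shows "polys z d \<subseteq> polys z e"
proof -
  interpret A: left_module R reg by (rule left_module_reg)
  show ?thesis unfolding polys_def
    by (rule A.combs_mono) (use assms F_zero F_subset in auto)
qed

lemma polys_shift:
  assumes z: "z \<in> carrier R" and "x \<in> polys z d" shows "z \<otimes> x \<in> polys z (Suc d)"
proof -
  interpret A: left_module R reg by (rule left_module_reg)
  show ?thesis using A.combs_shift[of F z x d] assms F_zero F_subset by (auto simp: polys_def)
qed

lemma polys_shift_power:
  assumes z: "z \<in> carrier R" and "x \<in> polys z e" shows "z [^] d \<otimes> x \<in> polys z (d + e)"
proof (induction d)
  case 0
  then show ?case using assms polys_carrier by simp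
next
  case (Suc d)
  have "z [^] Suc d \<otimes> x = z \<otimes> (z [^] d \<otimes> x)"
    using z polys_carrier[OF assms] nat_pow_Suc2[OF z, of d] by (simp add: m_assoc del: nat_pow_Suc)
  then show ?case using polys_shift[OF z Suc] by simp
qed

lemma polys_mult:
  assumes z: "z \<in> carrier R" and x: "x \<in> polys z d" and t: "t \<in> polys z (Suc e)"
  shows "x \<otimes> t \<in> polys z (d + e)"
  using x
proof (induction d arbitrary: x)
  case 0
  then show ?case using stableD(2)[OF polys_stable[OF z, of e]] polys_carrier[OF z t] by (simp add: polys_0)
next
  case (Suc d)
  obtain y c where *: "x = y \<oplus> z [^] d \<otimes> c" "y \<in> polys z d" "c \<in> F" using Suc.prems by (auto simp: polys_Suc)
  note car = polys_carrier[OF z *(2)] F_carrier[OF *(3)] polys_carrier[OF z t]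
  have "x \<otimes> t = y \<otimes> t \<oplus> c \<otimes> (z [^] d \<otimes> t)"
    using car z F_central[OF *(3), of "z [^] d"] by (simp add: *(1) l_distr m_assoc[symmetric])
  moreover have "y \<otimes> t \<in> polys z (Suc d + e)" using Suc.IH[OF *(2)] polys_mono[OF z, of "d + e" "Suc d + e"] by auto
  moreover have "c \<otimes> (z [^] d \<otimes> t) \<in> polys z (Suc d + e)"
    using stableD(4)[OF polys_stable[OF z] *(3) polys_shift_power[OF z t, of d]] by simp
  ultimately show ?case using stableD(3)[OF polys_stable[OF z]] by simp
qed

lemma monics_carrier: "z \<in> carrier R \<Longrightarrow> x \<in> monics z d \<Longrightarrow> x \<in> carrier R"
  by (auto simp: monics_def polys_carrier)

lemma monics_polys:
  assumes z: "z \<in> carrier R" and "x \<in> monics z d" shows "x \<in> polys z (Suc d)"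
proof -
  obtain r where r: "x = z [^] d \<oplus> r" "r \<in> polys z d" using assms(2) by (auto simp: monics_def)
  then have "x = r \<oplus> z [^] d \<otimes> \<one>" using z polys_carrier[OF z r(2)] by (simp add: a_comm)
  then show ?thesis using r(2) F_one by (auto simp: polys_Suc)
qed

lemma monics_add:
  assumes z: "z \<in> carrier R" and "x \<in> monics z d" "r \<in> polys z d" shows "x \<oplus> r \<in> monics z d"
proof -
  obtain s where s: "x = z [^] d \<oplus> s" "s \<in> polys z d" using assms(2) by (auto simp: monics_def)
  have "x \<oplus> r = z [^] d \<oplus> (s \<oplus> r)"
    using z s polys_carrier[OF z] assms(3) by (simp add: a_assoc)
  then show ?thesis using stableD(3)[OF polys_stable[OF z] s(2) assms(3)] by (auto simp: monics_def)
qed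

lemma monics_one: "\<one> \<in> monics z 0" by (auto simp: monics_def polys_0)

lemma monics_mult:
  assumes z: "z \<in> carrier R" and x: "x \<in> monics z d" and t: "t \<in> monics z e"
  shows "x \<otimes> t \<in> monics z (d + e)"
proof -
  obtain r where r: "x = z [^] d \<oplus> r" "r \<in> polys z d" using x by (auto simp: monics_def)
  obtain s where s: "t = z [^] e \<oplus> s" "s \<in> polys z e" using t by (auto simp: monics_def)
  note car = polys_carrier[OF z r(2)] polys_carrier[OF z s(2)] monics_carrier[OF z t]
  have "x \<otimes> t = (z [^] (d + e) \<oplus> z [^] d \<otimes> s) \<oplus> r \<otimes> t"
    using car z by (simp add: r(1) l_distr) (simp add: s(1) r_distr nat_pow_mult)
  moreover have "z [^] (d + e) \<oplus> z [^] d \<otimes> s \<in> monics z (d + e)"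
    using polys_shift_power[OF z s(2), of d] by (auto simp: monics_def)
  moreover have "r \<otimes> t \<in> polys z (d + e)" by (rule polys_mult[OF z r(2) monics_polys[OF z t]])
  ultimately show ?thesis using monics_add[OF z] by simp
qed

lemma monics_power:
  assumes z: "z \<in> carrier R" and x: "x \<in> monics z d" shows "x [^] (n::nat) \<in> monics z (d * n)"
proof (induction n)
  case 0
  then show ?case using monics_one by simp
next
  case (Suc n)
  then show ?case using monics_mult[OF z Suc x] by (simp add: add.commute)
qed

lemma polys_commute:
  assumes z: "z \<in> carrier R" and u: "u \<in> carrier R" "z \<otimes> u = u \<otimes> z" and "x \<in> polys z d"
  shows "x \<otimes> u = u \<otimes> x"
  using assms(4)
proof (induction d arbitrary: x)
  case 0
  then show ?case using u by (simp add: polys_0)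
next
  case (Suc d)
  obtain y c where *: "x = y \<oplus> z [^] d \<otimes> c" "y \<in> polys z d" "c \<in> F" using Suc.prems by (auto simp: polys_Suc)
  have "z [^] d \<otimes> u = u \<otimes> z [^] d" by (rule group_commutes_pow) (use z u in auto)
  then have "(z [^] d \<otimes> c) \<otimes> u = u \<otimes> (z [^] d \<otimes> c)"
    using z u F_carrier[OF *(3)] F_central[OF *(3) u(1)] by (simp add: m_assoc) (metis m_assoc nat_pow_closed)
  then show ?case using Suc.IH[OF *(2)] * z u polys_carrier[OF z *(2)] F_carrier[OF *(3)]
    by (simp add: l_distr r_distr)
qed

lemma monics_commute:
  assumes z: "z \<in> carrier R" and u: "u \<in> carrier R" "z \<otimes> u = u \<otimes> z" and x: "x \<in> monics z d"
  shows "x \<otimes> u = u \<otimes> x"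
  by (rule polys_commute[OF z u monics_polys[OF z x]])

lemma central_multiplicative_set_monics:
  assumes z: "z \<in> carrier R" "\<And>u. u \<in> carrier R \<Longrightarrow> z \<otimes> u = u \<otimes> z"
  shows "central_multiplicative_set R (\<Union>d. monics z d)"
proof unfold_locales
  show "\<one> \<in> (\<Union>d. monics z d)" using monics_one by blast
  show "t \<in> carrier R" if "t \<in> (\<Union>d. monics z d)" for t using that monics_carrier[OF z(1)] by blast
  show "s \<otimes> t \<in> (\<Union>d. monics z d)" if "s \<in> (\<Union>d. monics z d)" "t \<in> (\<Union>d. monics z d)" for s t
    using that monics_mult[OF z(1)] by blast
  show "t \<otimes> u = u \<otimes> t" if "t \<in> (\<Union>d. monics z d)" "u \<in> carrier R" for t u
    using that(1) monics_commute[OF z(1) that(2) z(2)[OF that(2)]] by blast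
qed

text \<open>The spans of the initial segments of \<open>\<phi>(a\<^sub>0), \<phi>(a\<^sub>1), \<dots>\<close> ascend in the noetherian module \<open>P\<close>, so
  some \<open>\<phi>(a\<^sub>k)\<close> depends on its predecessors.\<close>

lemma linear_dependence:
  assumes N: "left_module R N" and P: "stable N F P" "noetherian N F P"
    and add: "\<And>x y. x \<in> carrier R \<Longrightarrow> y \<in> carrier R \<Longrightarrow> \<phi> (x \<oplus> y) = \<phi> x \<oplus>\<^bsub>N\<^esub> \<phi> y"
    and smult: "\<And>c x. c \<in> F \<Longrightarrow> x \<in> carrier R \<Longrightarrow> \<phi> (c \<otimes> x) = c \<odot>\<^bsub>N\<^esub> \<phi> x"
    and a: "\<And>i. a i \<in> carrier R" "\<And>i. \<phi> (a i) \<in> P"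
  shows "\<exists>k. \<exists>r\<in>combs reg F a k. \<phi> (a k \<oplus> r) = \<zero>\<^bsub>N\<^esub>"
proof -
  interpret N: left_module R N by (rule N)
  interpret A: left_module R reg by (rule left_module_reg)
  let ?Q = "\<lambda>k. \<phi> ` combs reg F a k"
  have cst: "stable reg F (combs reg F a k)" for k by (rule F_combs_stable) (rule a(1))
  have car: "x \<in> carrier R" if "x \<in> combs reg F a k" for x k
    using that stableD(1)[OF cst] by auto
  note Pd = stableD[OF P(1)]
  have \<phi>0: "\<phi> \<zero> = \<zero>\<^bsub>N\<^esub>"
    using smult[OF F_zero, of "a 0"] a Pd(1) N.smult_l_null[of "\<phi> (a 0)"] by auto
  have QP: "?Q k \<subseteq> P" for k
  proof (induction k)
    case 0
    then show ?case using \<phi>0 Pd(2) by simp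
  next
    case (Suc k)
    show ?case
    proof clarify
      fix x assume "x \<in> combs reg F a (Suc k)"
      then obtain y c where *: "x = y \<oplus> a k \<otimes> c" "y \<in> combs reg F a k" "c \<in> F" by auto
      have "\<phi> x = \<phi> y \<oplus>\<^bsub>N\<^esub> c \<odot>\<^bsub>N\<^esub> \<phi> (a k)"
        using add[of y "a k \<otimes> c"] car[OF *(2)] a(1) F_carrier[OF *(3)] F_central[OF *(3) a(1)[of k]] smult[OF *(3) a(1)[of k]]
        by (simp add: *(1))
      then show "\<phi> x \<in> P" using Suc *(2) Pd(3) Pd(4)[OF *(3) a(2)[of k]] by auto
    qed
  qed
  have Qst: "stable N F (?Q k)" for k
  proof (rule stableI)
    note S = stableD[OF cst[of k]]
    show "?Q k \<subseteq> carrier N" using QP Pd(1) by blast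
    show "\<zero>\<^bsub>N\<^esub> \<in> ?Q k" using S(2) \<phi>0 by (metis image_eqI regular_module_simps(2))
    show "x \<oplus>\<^bsub>N\<^esub> y \<in> ?Q k" if xy: "x \<in> ?Q k" "y \<in> ?Q k" for x y
    proof -
      obtain x' y' where *: "x' \<in> combs reg F a k" "y' \<in> combs reg F a k" "x = \<phi> x'" "y = \<phi> y'" using xy by blast
      then have "x \<oplus>\<^bsub>N\<^esub> y = \<phi> (x' \<oplus> y')" using add car by simp
      then show ?thesis using S(3)[OF *(1,2)] by simp
    qed
    show "c \<odot>\<^bsub>N\<^esub> x \<in> ?Q k" if c: "c \<in> F" and x: "x \<in> ?Q k" for c x
    proof -
      obtain x' where *: "x' \<in> combs reg F a k" "x = \<phi> x'" using x by blast
      then have "c \<odot>\<^bsub>N\<^esub> x = \<phi> (c \<otimes> x')" using smult[OF c] car by simp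
      then show ?thesis using S(4)[OF c *(1)] by simp
    qed
  qed
  have mono: "?Q k \<subseteq> ?Q (Suc k)" for k
    by (rule image_mono, rule A.combs_Suc_mono) (use F_zero F_subset a in auto)
  obtain k where k: "\<And>l. l \<ge> k \<Longrightarrow> ?Q l = ?Q k"
    by (rule noetherianD[OF P(2), of ?Q]) (use Qst QP mono in blast)+
  have "a k \<otimes> (\<ominus> \<one>) \<in> combs reg F a (Suc k)"
  proof -
    have "a k \<odot>\<^bsub>reg\<^esub> (\<ominus> \<one>) \<in> combs reg F a (Suc k)"
      by (rule A.combs_gen) (use F_zero F_subset a F_neg_one stableD(2)[OF cst[of k]] in auto)
    then show ?thesis by simp
  qed
  then have "\<phi> (a k \<otimes> (\<ominus> \<one>)) \<in> ?Q (Suc k)" by (rule imageI)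
  then have "\<phi> (a k \<otimes> (\<ominus> \<one>)) \<in> ?Q k" by (simp only: k[of "Suc k"] le_SucI order_refl)
  then obtain r where r': "\<phi> (a k \<otimes> (\<ominus> \<one>)) = \<phi> r" "r \<in> combs reg F a k" by (rule imageE)
  note r = r'(2,1)
  have neg: "a k \<otimes> (\<ominus> \<one>) = \<ominus> (a k)" using a(1)[of k] by (simp add: r_minus)
  have "\<phi> (a k \<oplus> r) = \<phi> (a k) \<oplus>\<^bsub>N\<^esub> \<phi> (\<ominus> (a k))" using add[OF a(1) car[OF r(1)]] r(2) neg by simp
  also have "\<dots> = \<phi> (a k \<oplus> \<ominus> (a k))" using add[of "a k" "\<ominus> (a k)"] a(1) by simp
  also have "\<dots> = \<zero>\<^bsub>N\<^esub>" using a(1) \<phi>0 by (simp add: r_neg)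
  finally show ?thesis using r(1) by blast
qed

section \<open>Algebras that are finitely generated over a central subalgebra\<close>

text \<open>A finitely generated \<open>F\<close>-space is noetherian; adjoining the elements of \<open>Z\<close> one after the other
  preserves this.\<close>

lemma central_chain:
  assumes Z: "finite Z" "Z \<subseteq> carrier R" "\<And>z u. z \<in> Z \<Longrightarrow> u \<in> carrier R \<Longrightarrow> z \<otimes> u = u \<otimes> z"
    and B: "finite B" "B \<subseteq> carrier R"
  shows "\<exists>M. stable reg (F \<union> Z) M \<and> B \<subseteq> M \<and> noetherian reg (F \<union> Z) M"
  using Z
proof (induction Z)
  interpret A: left_module R reg by (rule left_module_reg)
  {
    case empty
    show ?case
    proof (intro exI conjI)
      show "stable reg (F \<union> {}) (stable_span reg F B)"
        using A.stable_stable_span[OF F_subset, of B] B by simp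
      show "B \<subseteq> stable_span reg F B" by (rule subsetI) (rule stable_span.gen)
      show "noetherian reg (F \<union> {}) (stable_span reg F B)"
        using A.noetherian_finite_span[OF central_subfield_axioms, of B] B by simp
    qed
  next
    case (insert z Z)
    have "\<exists>M. stable reg (F \<union> Z) M \<and> B \<subseteq> M \<and> noetherian reg (F \<union> Z) M"
      by (rule insert.IH) (use insert.prems in auto)
    then obtain M where M: "stable reg (F \<union> Z) M" "B \<subseteq> M" "noetherian reg (F \<union> Z) M" by blast
    let ?M = "\<Union>d. combs reg M (\<lambda>i. z [^] i) d"
    have C: "F \<union> Z \<subseteq> carrier R" and z: "z \<in> carrier R" using insert.prems F_subset by auto
    have comm: "c \<otimes> z = z \<otimes> c" if "c \<in> F \<union> Z" for c
      using that insert.prems(2)[of z c] C by auto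
    have neg: "\<ominus> \<one> \<in> F \<union> Z" using F_neg_one by blast
    have eq: "F \<union> insert z Z = insert z (F \<union> Z)" by blast
    show ?case
    proof (intro exI conjI)
      show "stable reg (F \<union> insert z Z) ?M"
        unfolding eq by (rule A.combs_Union_stable[OF M(1) C z comm])
      show "noetherian reg (F \<union> insert z Z) ?M"
        unfolding eq by (rule A.noetherian_adjoin[OF M(1) C neg z comm M(3)])
      have "b \<in> combs reg M (\<lambda>i. z [^] i) (Suc 0)" if "b \<in> M" for b
      proof -
        have "b = \<zero> \<oplus> z [^] (0::nat) \<otimes> b" using that stableD(1)[OF M(1)] by auto
        then show ?thesis using that by auto
      qed
      then show "B \<subseteq> ?M" using M(2) by blast
    qed
  }
qed

lemma left_noetherian_if_finite_over_center:
  assumes Z: "finite Z" "Z \<subseteq> carrier R" "\<And>z u. z \<in> Z \<Longrightarrow> u \<in> carrier R \<Longrightarrow> z \<otimes> u = u \<otimes> z"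
    and B: "finite B" "B \<subseteq> carrier R" and gen: "stable_span reg (F \<union> Z) B = carrier R"
  shows "left_noetherian R"
proof -
  obtain M where M: "stable reg (F \<union> Z) M" "B \<subseteq> M" "noetherian reg (F \<union> Z) M"
    using central_chain[OF Z B] by blast
  have "carrier R \<subseteq> M" using stable_span_least[OF M(1,2)] gen by simp
  then have "noetherian reg (F \<union> Z) (carrier R)" using noetherian_subset[OF M(3)] by blast
  then show ?thesis unfolding left_noetherian_def
    by (rule noetherian_more_scalars) (use Z F_subset in auto)
qed

text \<open>Modulo \<open>I\<close>, division by the monic polynomial that belongs to \<open>z\<close> bounds the exponents of \<open>z\<close>. Doing
  this for one \<open>z\<close> after the other leaves finitely many products of powers with elements of \<open>B\<close>.\<close>

lemma finite_codimension:
  assumes Z: "finite Z" "Z \<subseteq> carrier R" "\<And>z u. z \<in> Z \<Longrightarrow> u \<in> carrier R \<Longrightarrow> z \<otimes> u = u \<otimes> z"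
    and B: "finite B" "B \<subseteq> carrier R"
    and I: "stable reg (carrier R) I"
    and t: "\<And>z. z \<in> Z \<Longrightarrow> \<exists>d. \<exists>t\<in>monics z d. \<forall>u\<in>carrier R. t \<otimes> u \<in> I"
  shows "\<exists>B'. finite B' \<and> B' \<subseteq> carrier R \<and>
    stable_span reg (F \<union> Z) B \<subseteq> {x \<oplus> y | x y. x \<in> stable_span reg F B' \<and> y \<in> I}"
  using Z t B
proof (induction Z arbitrary: B)
  interpret A: left_module R reg by (rule left_module_reg)
  note Id = stableD[OF I]
  have SI: "x \<oplus> y \<in> {x \<oplus> y | x y. x \<in> P \<and> y \<in> I}" if "x \<in> P" "y \<in> I" for x y P
    using that by blast
  have sum_stable: "stable reg C {x \<oplus> y | x y. x \<in> P \<and> y \<in> I}" (is "stable _ _ ?S")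
    if P: "stable reg C P" and C: "C \<subseteq> carrier R" for C P
  proof (rule stableI)
    note Pd = stableD[OF P]
    show "?S \<subseteq> carrier reg" using Pd(1) Id(1) by auto
    show "\<zero>\<^bsub>reg\<^esub> \<in> ?S" using SI[OF Pd(2) Id(2)] by simp
    show "a \<oplus>\<^bsub>reg\<^esub> b \<in> ?S" if ab: "a \<in> ?S" "b \<in> ?S" for a b
    proof -
      obtain x y x' y' where *: "a = x \<oplus> y" "b = x' \<oplus> y'" "x \<in> P" "x' \<in> P" "y \<in> I" "y' \<in> I" using ab by blast
      have "a \<oplus> b = (x \<oplus> x') \<oplus> (y \<oplus> y')"
        using A.add_swap[of x y x' y'] * Pd(1) Id(1) by auto
      then show ?thesis using Pd(3)[OF *(3,4)] Id(3)[OF *(5,6)] by auto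
    qed
    show "c \<odot>\<^bsub>reg\<^esub> a \<in> ?S" if c: "c \<in> C" and a: "a \<in> ?S" for c a
    proof -
      obtain x y where *: "a = x \<oplus> y" "x \<in> P" "y \<in> I" using a by blast
      have cc: "c \<in> carrier R" "x \<in> carrier R" "y \<in> carrier R" using c C * Pd(1) Id(1) by auto
      have "c \<otimes> a = c \<otimes> x \<oplus> c \<otimes> y" using cc by (simp add: *(1) r_distr)
      then show ?thesis using Pd(4)[OF c *(2)] Id(4)[OF cc(1) *(3)] by auto
    qed
  qed
  have sumI1: "x \<in> {x \<oplus> y | x y. x \<in> P \<and> y \<in> I}" if "x \<in> P" "x \<in> carrier R" for x P
    using SI[OF that(1) Id(2)] that(2) by simp
  {
    case empty
    have "stable_span reg F B \<subseteq> {x \<oplus> y | x y. x \<in> stable_span reg F B \<and> y \<in> I}"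
      using sumI1 stableD(1)[OF A.stable_stable_span[OF F_subset, of B]] empty by auto
    then show ?case using empty by auto
  next
    case (insert z Z)
    have z: "z \<in> carrier R" "\<And>u. u \<in> carrier R \<Longrightarrow> z \<otimes> u = u \<otimes> z" using insert.prems(1) insert.prems(2)[OF insertI1] by auto
    obtain d t where t: "t \<in> monics z d" "\<And>u. u \<in> carrier R \<Longrightarrow> t \<otimes> u \<in> I"
      using insert.prems(3)[OF insertI1] by blast
    obtain r where r: "t = z [^] d \<oplus> r" "r \<in> polys z d" using t(1) by (auto simp: monics_def)
    define B1 where "B1 = (\<lambda>(k, b). z [^] k \<otimes> b) ` ({..<d} \<times> B)"
    have B1: "finite B1" "B1 \<subseteq> carrier R" using insert.prems(4,5) z(1) by (auto simp: B1_def)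
    have B1I: "z [^] k \<otimes> b \<in> B1" if "k < d" "b \<in> B" for k b using that by (auto simp: B1_def)
    have C: "F \<union> Z \<subseteq> carrier R" using insert.prems(1) F_subset by auto
    let ?P = "stable_span reg (F \<union> Z) B1"
    let ?S = "{x \<oplus> y | x y. x \<in> ?P \<and> y \<in> I}"
    have P: "stable reg (F \<union> Z) ?P" by (rule A.stable_stable_span[OF C]) (use B1 in simp)
    note Pd = stableD[OF P]
    have Pc: "x \<in> carrier R" if "x \<in> ?P" for x using that Pd(1) by auto
    have S: "stable reg (F \<union> Z) ?S" by (rule sum_stable[OF P C])
    have PS: "?P \<subseteq> ?S" using sumI1 Pc by blast
    have IS: "y \<in> ?S" if "y \<in> I" for y
    proof -
      have "y = \<zero> \<oplus> y" using that Id(1) by auto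
      then show ?thesis using that Pd(2) by auto
    qed
    have poly: "q \<otimes> b \<in> ?P" if "q \<in> polys z k" "k \<le> d" "b \<in> B" for q k b
      using that(1,2)
    proof (induction k arbitrary: q)
      case 0
      then show ?case using that insert.prems(5) Pd(2) by (auto simp: polys_0)
    next
      case (Suc k)
      obtain y c where *: "q = y \<oplus> z [^] k \<otimes> c" "y \<in> polys z k" "c \<in> F" using Suc.prems by (auto simp: polys_Suc)
      have cc: "y \<in> carrier R" "c \<in> carrier R" "b \<in> carrier R" "z [^] k \<in> carrier R"
        using polys_carrier[OF z(1) *(2)] F_carrier[OF *(3)] that(3) insert.prems(5) z(1) by auto
      have "q \<otimes> b = y \<otimes> b \<oplus> c \<otimes> (z [^] k \<otimes> b)"
        using cc F_central[OF *(3) cc(4)] by (simp add: *(1) l_distr m_assoc[symmetric])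
      moreover have "y \<otimes> b \<in> ?P" using Suc.IH[OF *(2)] Suc.prems by simp
      moreover have "z [^] k \<otimes> b \<in> ?P" using B1I[of k b] Suc.prems that(3) stable_span.gen by fastforce
      ultimately show ?case using Pd(3) Pd(4)[of c] *(3) by auto
    qed
    have high: "z [^] d \<otimes> b \<in> ?S" if b: "b \<in> B" for b
    proof -
      have cc: "b \<in> carrier R" "r \<in> carrier R" "t \<in> carrier R" "z [^] d \<in> carrier R"
        using b insert.prems(5) polys_carrier[OF z(1) r(2)] monics_carrier[OF z(1) t(1)] z(1) by auto
      have "z [^] d = \<ominus> r \<oplus> t" using cc by (simp add: r(1) a_ac r_neg2 r_neg1)
      then have "z [^] d \<otimes> b = \<ominus> r \<otimes> b \<oplus> t \<otimes> b" using cc by (simp add: l_distr)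
      moreover have "\<ominus> r \<in> polys z d"
      proof -
        have "\<ominus> \<one> \<otimes> r \<in> polys z d" using stableD(4)[OF polys_stable[OF z(1)] F_neg_one r(2)] by simp
        then show ?thesis using cc by (simp add: l_minus)
      qed
      then have "\<ominus> r \<otimes> b \<in> ?P" using poly[of "\<ominus> r" d b] b by simp
      ultimately show ?thesis using t(2)[OF cc(1)] by blast
    qed
    have step: "z \<otimes> x \<in> ?S" if "x \<in> ?P" for x
      using that
    proof induction
      case zero
      then show ?case using z(1) stableD(2)[OF S] by simp
    next
      case (gen x)
      then obtain k b where kb: "k < d" "b \<in> B" "x = z [^] k \<otimes> b" by (auto simp: B1_def)
      have zx: "z \<otimes> x = z [^] Suc k \<otimes> b"
        using kb z(1) insert.prems(5) nat_pow_Suc2[OF z(1), of k] by (auto simp: m_assoc simp del: nat_pow_Suc)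
      show ?case
      proof (cases "Suc k = d")
        case True
        then show ?thesis using high[OF kb(2)] zx by simp
      next
        case False
        then have "z [^] Suc k \<otimes> b \<in> ?P" using kb by (intro stable_span.gen B1I) auto
        then show ?thesis using PS zx by auto
      qed
    next
      case (add x y)
      then show ?case using Pc z(1) stableD(3)[OF S, of "z \<otimes> x" "z \<otimes> y"] by (simp add: r_distr)
    next
      case (smult c x)
      have cc: "c \<in> carrier R" using smult C by auto
      have "z \<otimes> (c \<otimes> x) = c \<otimes> (z \<otimes> x)"
        using m_assoc[OF z(1) cc Pc[OF smult(2)]] m_assoc[OF cc z(1) Pc[OF smult(2)]] z(2)[OF cc] by simp
      then show ?case using stableD(4)[OF S smult(1) smult.IH] by simp
    qed
    have "stable reg (F \<union> insert z Z) ?S"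
    proof (rule stableI)
      show "c \<odot>\<^bsub>reg\<^esub> x \<in> ?S" if c: "c \<in> F \<union> insert z Z" and x: "x \<in> ?S" for c x
      proof (cases "c = z")
        case True
        obtain p y where *: "x = p \<oplus> y" "p \<in> ?P" "y \<in> I" using x by blast
        have "z \<otimes> x = z \<otimes> p \<oplus> z \<otimes> y" using * Pc Id(1) z(1) by (auto simp: r_distr)
        then show ?thesis using stableD(3)[OF S step[OF *(2)] IS[OF Id(4)[OF z(1) *(3)]]] True by simp
      next
        case False
        then show ?thesis using stableD(4)[OF S _ x] c by auto
      qed
    qed (use stableD[OF S] in auto)
    moreover have "B \<subseteq> ?S"
    proof
      fix b assume b: "b \<in> B"
      have bc: "b = z [^] (0::nat) \<otimes> b" using b insert.prems(5) by auto
      show "b \<in> ?S"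
      proof (cases "d = 0")
        case True
        then show ?thesis using high[OF b] bc by simp
      next
        case False
        then have "z [^] (0::nat) \<otimes> b \<in> ?P" using b by (intro stable_span.gen B1I) auto
        then show ?thesis using PS bc by auto
      qed
    qed
    ultimately have sub: "stable_span reg (F \<union> insert z Z) B \<subseteq> ?S" by (rule stable_span_least)
    have "\<exists>B'. finite B' \<and> B' \<subseteq> carrier R \<and>
        ?P \<subseteq> {x \<oplus> y | x y. x \<in> stable_span reg F B' \<and> y \<in> I}"
      by (rule insert.IH[OF _ insert.prems(2)]) (use insert.prems(1,3) B1 in auto)
    then obtain B' where B': "finite B'" "B' \<subseteq> carrier R"
      "?P \<subseteq> {x \<oplus> y | x y. x \<in> stable_span reg F B' \<and> y \<in> I}" (is "_ \<subseteq> ?S'") by blast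
    have SS: "?S \<subseteq> ?S'"
    proof
      fix a assume "a \<in> ?S"
      then obtain x y where *: "a = x \<oplus> y" "x \<in> ?P" "y \<in> I" by blast
      obtain x' y' where **: "x = x' \<oplus> y'" "x' \<in> stable_span reg F B'" "y' \<in> I" using B'(3) *(2) by blast
      have "x' \<in> carrier R" "y' \<in> carrier R" "y \<in> carrier R"
        using stableD(1)[OF A.stable_stable_span[OF F_subset, of B']] B' Id(1) * ** by auto
      then have a: "a = x' \<oplus> (y' \<oplus> y)" unfolding *(1) **(1) by (rule a_assoc)
      show "a \<in> ?S'" unfolding a using SI[OF **(2) Id(3)[OF **(3) *(3)]] by simp
    qed
    show ?case by (intro exI[of _ B'] conjI B'(1,2) order_trans[OF sub SS])
  }
qed

end

section \<open>Local finiteness\<close>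

lemma (in module) left_module: "left_module R M"
  by (intro left_module.intro left_module_axioms.intro)
     (simp_all add: smult_l_distr smult_r_distr smult_assoc1 ring_axioms M.abelian_group_axioms)

lemma (in left_module) submodule_iff_stable: "Module.submodule H R M \<longleftrightarrow> stable M (carrier R) H"
proof
  assume "Module.submodule H R M"
  then interpret H: Module.submodule H R M .
  show "stable M (carrier R) H"
    using H.subset H.one_closed H.m_closed H.smult_closed by (auto intro: stableI)
next
  assume H: "stable M (carrier R) H"
  note Hd = stableD[OF H]
  show "Module.submodule H R M"
  proof (intro Module.submodule.intro subgroup.intro Module.submodule_axioms.intro)
    fix x assume x: "x \<in> H"
    have "(\<ominus> \<one>) \<odot>\<^bsub>M\<^esub> x \<in> H" using Hd(4)[OF _ x] by simp
    then have "\<ominus>\<^bsub>M\<^esub> x \<in> H" using x Hd(1) by (simp add: smult_neg_one subset_iff)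
    then show "inv\<^bsub>add_monoid M\<^esub> x \<in> H" by (simp add: a_inv_def)
  qed (use Hd in auto)
qed

lemma (in left_module) generated_submodule_eq:
  assumes "S \<subseteq> carrier M" shows "generated_submodule R M S = stable_span M (carrier R) S"
proof -
  have "stable M (carrier R) (stable_span M (carrier R) S)"
    by (rule stable_stable_span) (use assms in auto)
  moreover have "S \<subseteq> stable_span M (carrier R) S" by (rule subsetI) (rule stable_span.gen)
  ultimately show ?thesis
    unfolding generated_submodule_def submodule_iff_stable
    using stable_span_least[of M "carrier R" _ S] by blast
qed

text \<open>This replaces linear combinations, given by finite sums, by an inductively defined span.\<close>

lemma (in vectorspace) fin_dim_iff_stable_span:
  "fin_dim \<longleftrightarrow> (\<exists>X. finite X \<and> X \<subseteq> carrier V \<and> stable_span V (carrier K) X = carrier V)"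
proof -
  interpret L: left_module K V by (rule left_module)
  have sub: "LinearCombinations.submodule K W V \<longleftrightarrow> stable V (carrier K) W" for W
    unfolding LinearCombinations.submodule_def stable_def using module_axioms by blast
  have "span X = stable_span V (carrier K) X" if X: "X \<subseteq> carrier V" for X
  proof
    show "span X \<subseteq> stable_span V (carrier K) X"
      by (rule span_is_subset) (auto intro: stable_span.gen simp: sub L.stable_stable_span[OF _ X])
    show "stable_span V (carrier K) X \<subseteq> span X"
      by (rule stable_span_least) (use span_is_submodule[OF X] in_own_span[OF X] sub in auto)
  qed
  then show ?thesis unfolding fin_dim_def by auto
qed

lemma stable_span_subset_if_actions:
  assumes "zero N = zero M" "add N = add M" "\<And>c. c \<in> C \<Longrightarrow> \<exists>c'\<in>C'. smult N c = smult M c'"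
  shows "stable_span N C X \<subseteq> stable_span M C' X"
proof
  fix x assume "x \<in> stable_span N C X"
  then show "x \<in> stable_span M C' X"
  proof induction
    case (smult c x)
    then obtain c' where "c' \<in> C'" "smult N c = smult M c'" using assms(3) by blast
    then show ?case using stable_span.smult[of c' C' x M X] smult.IH by simp
  qed (auto simp: assms(1,2) intro: stable_span.intros)
qed

lemma stable_span_carrier_update: "stable_span (M\<lparr>carrier := G\<rparr>) C X = stable_span M C X"
  by (rule equalityI; rule stable_span_subset_if_actions) auto

text \<open>An algebra record has its scalar multiplication as a separate field; these axioms tie it to a
  central embedding \<open>\<eta>\<close> of the field, through which every \<open>A\<close>-module is a \<open>K\<close>-space.\<close>

locale central_algebra = K: field K + A: ring A
  for K :: "('k, 'c) ring_scheme" and A :: "('k, 'a, 'd) module_scheme" +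
  assumes scalar_closed: "c \<in> carrier K \<Longrightarrow> c \<odot>\<^bsub>A\<^esub> \<one>\<^bsub>A\<^esub> \<in> carrier A"
    and smult_eq: "\<lbrakk>c \<in> carrier K; u \<in> carrier A\<rbrakk> \<Longrightarrow> c \<odot>\<^bsub>A\<^esub> u = (c \<odot>\<^bsub>A\<^esub> \<one>\<^bsub>A\<^esub>) \<otimes>\<^bsub>A\<^esub> u"
    and scalar_add: "\<lbrakk>c \<in> carrier K; d \<in> carrier K\<rbrakk> \<Longrightarrow>
      (c \<oplus>\<^bsub>K\<^esub> d) \<odot>\<^bsub>A\<^esub> \<one>\<^bsub>A\<^esub> = c \<odot>\<^bsub>A\<^esub> \<one>\<^bsub>A\<^esub> \<oplus>\<^bsub>A\<^esub> d \<odot>\<^bsub>A\<^esub> \<one>\<^bsub>A\<^esub>"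
    and scalar_mult: "\<lbrakk>c \<in> carrier K; d \<in> carrier K\<rbrakk> \<Longrightarrow>
      (c \<otimes>\<^bsub>K\<^esub> d) \<odot>\<^bsub>A\<^esub> \<one>\<^bsub>A\<^esub> = (c \<odot>\<^bsub>A\<^esub> \<one>\<^bsub>A\<^esub>) \<otimes>\<^bsub>A\<^esub> (d \<odot>\<^bsub>A\<^esub> \<one>\<^bsub>A\<^esub>)"
    and scalar_one: "\<one>\<^bsub>K\<^esub> \<odot>\<^bsub>A\<^esub> \<one>\<^bsub>A\<^esub> = \<one>\<^bsub>A\<^esub>"
    and scalar_central: "\<lbrakk>c \<in> carrier K; u \<in> carrier A\<rbrakk> \<Longrightarrow>
      (c \<odot>\<^bsub>A\<^esub> \<one>\<^bsub>A\<^esub>) \<otimes>\<^bsub>A\<^esub> u = u \<otimes>\<^bsub>A\<^esub> (c \<odot>\<^bsub>A\<^esub> \<one>\<^bsub>A\<^esub>)"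
begin

definition \<eta> :: "'k \<Rightarrow> 'a" where "\<eta> c = c \<odot>\<^bsub>A\<^esub> \<one>\<^bsub>A\<^esub>"

lemma \<eta>_closed: "c \<in> carrier K \<Longrightarrow> \<eta> c \<in> carrier A"
  and smult_\<eta>: "\<lbrakk>c \<in> carrier K; u \<in> carrier A\<rbrakk> \<Longrightarrow> c \<odot>\<^bsub>A\<^esub> u = \<eta> c \<otimes>\<^bsub>A\<^esub> u"
  and \<eta>_add: "\<lbrakk>c \<in> carrier K; d \<in> carrier K\<rbrakk> \<Longrightarrow> \<eta> (c \<oplus>\<^bsub>K\<^esub> d) = \<eta> c \<oplus>\<^bsub>A\<^esub> \<eta> d"
  and \<eta>_mult: "\<lbrakk>c \<in> carrier K; d \<in> carrier K\<rbrakk> \<Longrightarrow> \<eta> (c \<otimes>\<^bsub>K\<^esub> d) = \<eta> c \<otimes>\<^bsub>A\<^esub> \<eta> d"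
  and \<eta>_one: "\<eta> \<one>\<^bsub>K\<^esub> = \<one>\<^bsub>A\<^esub>"
  and \<eta>_central: "\<lbrakk>c \<in> carrier K; u \<in> carrier A\<rbrakk> \<Longrightarrow> \<eta> c \<otimes>\<^bsub>A\<^esub> u = u \<otimes>\<^bsub>A\<^esub> \<eta> c"
  unfolding \<eta>_def by (fact scalar_closed smult_eq scalar_add scalar_mult scalar_one scalar_central)+

lemma \<eta>_zero: "\<eta> \<zero>\<^bsub>K\<^esub> = \<zero>\<^bsub>A\<^esub>"
  using \<eta>_add[of "\<zero>\<^bsub>K\<^esub>" "\<zero>\<^bsub>K\<^esub>"] \<eta>_closed[of "\<zero>\<^bsub>K\<^esub>"] A.add.l_cancel_one by simp

lemma \<eta>_minus: assumes "c \<in> carrier K" shows "\<eta> (\<ominus>\<^bsub>K\<^esub> c) = \<ominus>\<^bsub>A\<^esub> \<eta> c"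
proof -
  have "\<eta> (\<ominus>\<^bsub>K\<^esub> c) \<oplus>\<^bsub>A\<^esub> \<eta> c = \<zero>\<^bsub>A\<^esub>"
    using \<eta>_add[of "\<ominus>\<^bsub>K\<^esub> c" c] assms \<eta>_zero by (simp add: K.l_neg)
  then show ?thesis using A.minus_equality \<eta>_closed assms by simp
qed

definition F :: "'a set" where "F = \<eta> ` carrier K"

lemma F_I: "c \<in> carrier K \<Longrightarrow> \<eta> c \<in> F" by (simp add: F_def)

sublocale central_subfield A F
proof unfold_locales
  show "F \<subseteq> carrier A" using \<eta>_closed by (auto simp: F_def)
  show "\<zero>\<^bsub>A\<^esub> \<in> F" using F_I[of "\<zero>\<^bsub>K\<^esub>"] \<eta>_zero by simp
  show "\<one>\<^bsub>A\<^esub> \<in> F" using F_I[of "\<one>\<^bsub>K\<^esub>"] \<eta>_one by simp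
  show "c \<oplus>\<^bsub>A\<^esub> d \<in> F" if "c \<in> F" "d \<in> F" for c d
    using that F_I \<eta>_add[symmetric] by (auto simp: F_def)
  show "c \<otimes>\<^bsub>A\<^esub> d \<in> F" if "c \<in> F" "d \<in> F" for c d
    using that F_I \<eta>_mult[symmetric] by (auto simp: F_def)
  show "\<ominus>\<^bsub>A\<^esub> c \<in> F" if "c \<in> F" for c
    using that F_I \<eta>_minus[symmetric] by (auto simp: F_def)
  show "c \<otimes>\<^bsub>A\<^esub> u = u \<otimes>\<^bsub>A\<^esub> c" if "c \<in> F" "u \<in> carrier A" for c u
    using that \<eta>_central by (auto simp: F_def)
  show "\<exists>d\<in>F. d \<otimes>\<^bsub>A\<^esub> c = \<one>\<^bsub>A\<^esub>" if c: "c \<in> F" "c \<noteq> \<zero>\<^bsub>A\<^esub>" for c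
  proof -
    obtain k where k: "k \<in> carrier K" "c = \<eta> k" using c by (auto simp: F_def)
    then have "k \<noteq> \<zero>\<^bsub>K\<^esub>" using c(2) \<eta>_zero by auto
    then have u: "k \<in> Units K" using k(1) K.field_Units by auto
    then have "\<eta> (inv\<^bsub>K\<^esub> k) \<otimes>\<^bsub>A\<^esub> c = \<one>\<^bsub>A\<^esub>"
      using \<eta>_mult[of "inv\<^bsub>K\<^esub> k" k] k \<eta>_one by simp
    then show ?thesis using F_I[of "inv\<^bsub>K\<^esub> k"] u by auto
  qed
qed

lemma left_module_K_A: "left_module K A"
proof unfold_locales
  fix a x assume "a \<in> carrier K" "x \<in> carrier A"
  then show "a \<odot>\<^bsub>A\<^esub> x \<in> carrier A" by (simp add: smult_\<eta> \<eta>_closed)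
next
  fix a b x assume "a \<in> carrier K" "b \<in> carrier K" "x \<in> carrier A"
  then show "(a \<oplus>\<^bsub>K\<^esub> b) \<odot>\<^bsub>A\<^esub> x = a \<odot>\<^bsub>A\<^esub> x \<oplus>\<^bsub>A\<^esub> b \<odot>\<^bsub>A\<^esub> x"
    "(a \<otimes>\<^bsub>K\<^esub> b) \<odot>\<^bsub>A\<^esub> x = a \<odot>\<^bsub>A\<^esub> (b \<odot>\<^bsub>A\<^esub> x)"
    by (simp_all add: smult_\<eta> \<eta>_closed \<eta>_add \<eta>_mult A.l_distr A.m_assoc)
next
  fix a x y assume "a \<in> carrier K" "x \<in> carrier A" "y \<in> carrier A"
  then show "a \<odot>\<^bsub>A\<^esub> (x \<oplus>\<^bsub>A\<^esub> y) = a \<odot>\<^bsub>A\<^esub> x \<oplus>\<^bsub>A\<^esub> a \<odot>\<^bsub>A\<^esub> y"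
    by (simp add: smult_\<eta> \<eta>_closed A.r_distr)
qed (simp add: smult_\<eta> \<eta>_one)

lemma restrict_scalars_vectorspace:
  assumes N: "left_module A N" shows "vectorspace K (restrict_scalars A N)"
proof -
  interpret N: left_module A N by (rule N)
  have 1: "abelian_group (restrict_scalars A N)"
    by (rule N.M.abelian_group_cong) (simp_all add: restrict_scalars_def)
  have "Module.module K (restrict_scalars A N)"
    by (rule moduleI[OF K.is_cring 1])
      (simp_all add: restrict_scalars_def \<eta>_def[symmetric] \<eta>_closed \<eta>_add \<eta>_mult \<eta>_one
        N.smult_closed N.smult_l_distr N.smult_r_distr N.smult_assoc N.smult_one)
  then show ?thesis by (simp add: vectorspace_def K.field_axioms)
qed

lemma stable_span_restrict_scalars:
  "stable_span (restrict_scalars A N) (carrier K) X = stable_span N F X"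
  by (rule equalityI; rule stable_span_subset_if_actions)
     (auto simp: restrict_scalars_def F_def \<eta>_def fun_eq_iff)

lemma locally_finite_iff:
  assumes N: "left_module A N"
  shows "locally_finite K A N \<longleftrightarrow> (\<forall>S. finite S \<and> S \<subseteq> carrier N \<longrightarrow>
    (\<exists>X. finite X \<and> X \<subseteq> stable_span N (carrier A) S \<and> stable_span N F X = stable_span N (carrier A) S))"
proof -
  interpret N: left_module A N by (rule N)
  have "vectorspace.fin_dim K (restrict_scalars A (N\<lparr>carrier := generated_submodule A N S\<rparr>)) \<longleftrightarrow>
    (\<exists>X. finite X \<and> X \<subseteq> stable_span N (carrier A) S \<and> stable_span N F X = stable_span N (carrier A) S)"
    if S: "S \<subseteq> carrier N" for S
  proof -
    have "stable N (carrier A) (stable_span N (carrier A) S)"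
      by (rule N.stable_stable_span) (use S in auto)
    then have "left_module A (N\<lparr>carrier := stable_span N (carrier A) S\<rparr>)" by (rule N.submodule_left_module)
    then have "vectorspace K (restrict_scalars A (N\<lparr>carrier := stable_span N (carrier A) S\<rparr>))"
      by (rule restrict_scalars_vectorspace)
    then show ?thesis
      unfolding N.generated_submodule_eq[OF S]
      by (simp add: vectorspace.fin_dim_iff_stable_span stable_span_restrict_scalars stable_span_carrier_update)
         (simp add: restrict_scalars_def)
  qed
  then show ?thesis unfolding locally_finite_def by auto
qed

end

section \<open>The coregular module\<close>

lemma linear_formsI:
  assumes "f \<in> carrier A \<rightarrow>\<^sub>E carrier K"
    "\<And>u v. \<lbrakk>u \<in> carrier A; v \<in> carrier A\<rbrakk> \<Longrightarrow> f (u \<oplus>\<^bsub>A\<^esub> v) = f u \<oplus>\<^bsub>K\<^esub> f v"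
    "\<And>c v. \<lbrakk>c \<in> carrier K; v \<in> carrier A\<rbrakk> \<Longrightarrow> f (c \<odot>\<^bsub>A\<^esub> v) = c \<otimes>\<^bsub>K\<^esub> f v"
  shows "f \<in> linear_forms K A"
  using assms unfolding linear_forms_def by blast

lemma linear_formsD:
  assumes "f \<in> linear_forms K A"
  shows "f \<in> carrier A \<rightarrow>\<^sub>E carrier K" "\<And>v. v \<in> carrier A \<Longrightarrow> f v \<in> carrier K"
    "\<And>u v. \<lbrakk>u \<in> carrier A; v \<in> carrier A\<rbrakk> \<Longrightarrow> f (u \<oplus>\<^bsub>A\<^esub> v) = f u \<oplus>\<^bsub>K\<^esub> f v"
    "\<And>c v. \<lbrakk>c \<in> carrier K; v \<in> carrier A\<rbrakk> \<Longrightarrow> f (c \<odot>\<^bsub>A\<^esub> v) = c \<otimes>\<^bsub>K\<^esub> f v"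
  using assms unfolding linear_forms_def by blast+

lemma coregular_left_simps:
  "carrier (coregular_left K A) = linear_forms K A"
  "zero (coregular_left K A) = (\<lambda>v \<in> carrier A. \<zero>\<^bsub>K\<^esub>)"
  "add (coregular_left K A) = (\<lambda>f g. \<lambda>v \<in> carrier A. f v \<oplus>\<^bsub>K\<^esub> g v)"
  "smult (coregular_left K A) = (\<lambda>u f. \<lambda>v \<in> carrier A. f (v \<otimes>\<^bsub>A\<^esub> u))"
  by (simp_all add: coregular_left_def)

text \<open>The only left ideals are \<open>0\<close> and the whole field.\<close>

lemma (in field) baer_regular: "baer R (regular_module R)"
  unfolding baer_def
proof (intro allI impI)
  let ?K = "regular_module R"
  fix G assume G: "linear_graph R ?K ?K G"
  note D = linear_graphD[OF G]
  interpret L: left_module R ?K by (rule left_module_regular)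
  interpret P: module_pair R ?K ?K by unfold_locales
  show "\<exists>e\<in>carrier ?K. \<forall>u y. (u, y) \<in> G \<longrightarrow> y = u \<odot>\<^bsub>?K\<^esub> e"
  proof (cases "\<exists>a b. (a, b) \<in> G \<and> a \<noteq> \<zero>")
    case False
    have "y = u \<odot>\<^bsub>?K\<^esub> \<zero>" if "(u, y) \<in> G" for u y
      using that False D(6)[of y] by fastforce
    then show ?thesis by (intro bexI[of _ \<zero>]) auto
  next
    case True
    then obtain a b where ab: "(a, b) \<in> G" "a \<noteq> \<zero>" by blast
    have c: "a \<in> carrier R" "b \<in> carrier R" using D(1,2)[OF ab(1)] by simp_all
    have ua: "a \<in> Units R" using ab c field_Units by auto
    have "y = u \<otimes> (inv a \<otimes> b)" if uy: "(u, y) \<in> G" for u y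
    proof -
      have cu: "u \<in> carrier R" "y \<in> carrier R" using D(1,2)[OF uy] by simp_all
      have "((u \<otimes> inv a) \<otimes> a, (u \<otimes> inv a) \<otimes> b) \<in> G"
        using D(5)[OF _ ab(1), of "u \<otimes> inv a"] cu ua by simp
      then have "(u, u \<otimes> (inv a \<otimes> b)) \<in> G" using cu c ua by (simp add: m_assoc)
      then show ?thesis using P.graph_unique[OF G uy] by simp
    qed
    then show ?thesis using c ua by (intro bexI[of _ "inv a \<otimes> b"]) auto
  qed
qed

context central_algebra
begin

abbreviation E where "E \<equiv> coregular_left K A"

lemma left_module_coregular: "left_module A E"
proof -
  note S = coregular_left_simps[of K A]
  have zero: "(\<lambda>v\<in>carrier A. \<zero>\<^bsub>K\<^esub>) \<in> linear_forms K A"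
    by (rule linear_formsI) (auto simp: smult_\<eta> \<eta>_closed)
  have add: "(\<lambda>v\<in>carrier A. f v \<oplus>\<^bsub>K\<^esub> g v) \<in> linear_forms K A"
    if f: "f \<in> linear_forms K A" and g: "g \<in> linear_forms K A" for f g
    by (rule linear_formsI)
       (use linear_formsD(2-4)[OF f] linear_formsD(2-4)[OF g] in
         \<open>auto simp: smult_\<eta> \<eta>_closed K.r_distr K.a_ac\<close>)
  have smult: "(\<lambda>v\<in>carrier A. f (v \<otimes>\<^bsub>A\<^esub> u)) \<in> linear_forms K A"
    if f: "f \<in> linear_forms K A" and u: "u \<in> carrier A" for f u
  proof (rule linear_formsI)
    show "(\<lambda>v\<in>carrier A. f (v \<otimes>\<^bsub>A\<^esub> u)) (c \<odot>\<^bsub>A\<^esub> v) = c \<otimes>\<^bsub>K\<^esub> (\<lambda>v\<in>carrier A. f (v \<otimes>\<^bsub>A\<^esub> u)) v"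
      if "c \<in> carrier K" "v \<in> carrier A" for c v
    proof -
      have "(c \<odot>\<^bsub>A\<^esub> v) \<otimes>\<^bsub>A\<^esub> u = c \<odot>\<^bsub>A\<^esub> (v \<otimes>\<^bsub>A\<^esub> u)"
        using that u by (simp add: smult_\<eta> \<eta>_closed A.m_assoc)
      then show ?thesis using linear_formsD(4)[OF f that(1), of "v \<otimes>\<^bsub>A\<^esub> u"] that u
        by (simp add: smult_\<eta> \<eta>_closed)
    qed
  qed (use linear_formsD(2,3)[OF f] u in \<open>auto simp: A.l_distr\<close>)
  have ag: "abelian_group E"
  proof (rule abelian_groupI)
    fix f assume f: "f \<in> carrier E"
    let ?g = "\<lambda>v\<in>carrier A. \<ominus>\<^bsub>K\<^esub> f v"
    have "?g \<in> linear_forms K A"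
      by (rule linear_formsI)
         (use f linear_formsD(2-4)[of f K A] in \<open>auto simp: S smult_\<eta> \<eta>_closed K.minus_add K.r_minus\<close>)
    moreover have "?g \<oplus>\<^bsub>E\<^esub> f = \<zero>\<^bsub>E\<^esub>"
      using f linear_formsD(2)[of f K A] by (auto simp: S K.l_neg intro!: restrict_ext)
    ultimately show "\<exists>g\<in>carrier E. g \<oplus>\<^bsub>E\<^esub> f = \<zero>\<^bsub>E\<^esub>" by (auto simp: S(1))
  next
    fix f assume f: "f \<in> carrier E"
    show "\<zero>\<^bsub>E\<^esub> \<oplus>\<^bsub>E\<^esub> f = f"
      using f linear_formsD(1,2)[of f K A] by (auto simp: S intro!: ext simp: restrict_def PiE_def extensional_def)
  qed (use linear_formsD(2)[of _ K A] in \<open>auto simp: S zero add K.a_ac intro!: restrict_ext\<close>)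
  have one: "\<one>\<^bsub>A\<^esub> \<odot>\<^bsub>E\<^esub> f = f" if f: "f \<in> carrier E" for f
    using f linear_formsD(1)[of f K A] by (auto simp: S intro!: ext simp: restrict_def PiE_def extensional_def)
  show ?thesis
    by (intro left_module.intro left_module_axioms.intro A.ring_axioms ag)
       (use linear_formsD(2,3)[of _ K A] one in \<open>auto simp: S smult A.r_distr A.m_assoc intro!: restrict_ext\<close>)
qed

text \<open>A homomorphism to the dual corresponds to the linear form \<open>x \<mapsto> f(x)(1)\<close>, and linear forms extend
  because \<open>K\<close> is injective over itself.\<close>

lemma baer_coregular: "baer A E"
  unfolding baer_def
proof (intro allI impI)
  fix G assume G: "linear_graph A reg E G"
  note S = coregular_left_simps[of K A]
  interpret E: left_module A E by (rule left_module_coregular)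
  interpret KA: left_module K A by (rule left_module_K_A)
  interpret KK: left_module K "regular_module K" by (rule K.left_module_regular)
  interpret P: module_pair K A "regular_module K" by unfold_locales
  note D = linear_graphD[OF G]
  have c: "u \<in> carrier A" "f \<in> linear_forms K A" if "(u, f) \<in> G" for u f
    using D(1,2)[OF that] by (simp_all add: S)
  let ?H = "(\<lambda>(u, f). (u, f \<one>\<^bsub>A\<^esub>)) ` G"
  have HI: "(u, f \<one>\<^bsub>A\<^esub>) \<in> ?H" if "(u, f) \<in> G" for u f using that by force
  have HE: "\<exists>f. (u, f) \<in> G \<and> y = f \<one>\<^bsub>A\<^esub>" if "(u, y) \<in> ?H" for u y using that by auto
  have "linear_graph K A (regular_module K) ?H"
  proof (rule linear_graphI)
    show "x \<in> carrier A \<and> e \<in> carrier (regular_module K)" if "(x, e) \<in> ?H" for x e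
      using HE[OF that] c linear_formsD(2) by fastforce
    show "(\<zero>\<^bsub>A\<^esub>, \<zero>\<^bsub>regular_module K\<^esub>) \<in> ?H" using HI[OF D(3)] by (simp add: S)
  next
    fix x e y f assume H: "(x, e) \<in> ?H" "(y, f) \<in> ?H"
    obtain e' f' where *: "(x, e') \<in> G" "e = e' \<one>\<^bsub>A\<^esub>" "(y, f') \<in> G" "f = f' \<one>\<^bsub>A\<^esub>"
      using HE[OF H(1)] HE[OF H(2)] by blast
    show "(x \<oplus>\<^bsub>A\<^esub> y, e \<oplus>\<^bsub>regular_module K\<^esub> f) \<in> ?H" using HI[OF D(4)[OF *(1,3)]] * by (simp add: S)
  next
    fix a x e assume a: "a \<in> carrier K" and H: "(x, e) \<in> ?H"
    obtain e' where *: "(x, e') \<in> G" "e = e' \<one>\<^bsub>A\<^esub>" using HE[OF H] by blast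
    have "(\<eta> a \<odot>\<^bsub>reg\<^esub> x, \<eta> a \<odot>\<^bsub>E\<^esub> e') \<in> G" by (rule D(5)[OF \<eta>_closed[OF a] *(1)])
    from HI[OF this] have "(\<eta> a \<otimes>\<^bsub>A\<^esub> x, e' (\<eta> a)) \<in> ?H" using \<eta>_closed[OF a] by (simp add: S)
    moreover have "e' (\<eta> a) = a \<otimes>\<^bsub>K\<^esub> e" using linear_formsD(4)[OF c(2)[OF *(1)] a, of "\<one>\<^bsub>A\<^esub>"] *(2)
      by (simp add: \<eta>_def)
    ultimately show "(a \<odot>\<^bsub>A\<^esub> x, a \<odot>\<^bsub>regular_module K\<^esub> e) \<in> ?H"
      using smult_\<eta>[OF a c(1)[OF *(1)]] by simp
  next
    fix e assume H: "(\<zero>\<^bsub>A\<^esub>, e) \<in> ?H"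
    obtain f where *: "(\<zero>\<^bsub>A\<^esub>, f) \<in> G" "e = f \<one>\<^bsub>A\<^esub>" using HE[OF H] by blast
    have "f = \<zero>\<^bsub>E\<^esub>" using D(6)[of f] *(1) by simp
    then show "e = \<zero>\<^bsub>regular_module K\<^esub>" using *(2) by (simp add: S)
  qed
  from P.baer_criterion[OF K.baer_regular this] obtain h
    where h: "h \<in> module_hom K A (regular_module K)" and hH: "\<And>x e. (x, e) \<in> ?H \<Longrightarrow> h x = e" by auto
  let ?e = "restrict h (carrier A)"
  have e: "?e \<in> carrier E"
    unfolding S(1)
    by (rule linear_formsI) (use h KA.smult_closed in \<open>auto simp: LinearCombinations.module_hom_def\<close>)
  have "y = u \<odot>\<^bsub>E\<^esub> ?e" if uy: "(u, y) \<in> G" for u y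
  proof
    fix v
    show "y v = (u \<odot>\<^bsub>E\<^esub> ?e) v"
    proof (cases "v \<in> carrier A")
      case True
      have "(v \<odot>\<^bsub>reg\<^esub> u, v \<odot>\<^bsub>E\<^esub> y) \<in> G" by (rule D(5)[OF True uy])
      from hH[OF HI[OF this]] have "h (v \<otimes>\<^bsub>A\<^esub> u) = y v" using True by (simp add: S)
      then show ?thesis using True c(1)[OF uy] by (simp add: S)
    next
      case False
      then show ?thesis using linear_formsD(1)[OF c(2)[OF uy]] by (auto simp: S PiE_def extensional_def)
    qed
  qed
  then show "\<exists>e\<in>carrier E. \<forall>u y. (u, y) \<in> G \<longrightarrow> y = u \<odot>\<^bsub>E\<^esub> e" using e by blast
qed

end

section \<open>The continuous dual\<close>

locale finite_central_algebra = central_algebra K A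
  for K :: "('k, 'c) ring_scheme" and A :: "('k, 'a, 'd) module_scheme" +
  fixes Z B :: "'a set"
  assumes Z_finite: "finite Z" and Z_carrier: "Z \<subseteq> carrier A"
    and Z_central: "\<lbrakk>z \<in> Z; u \<in> carrier A\<rbrakk> \<Longrightarrow> z \<otimes>\<^bsub>A\<^esub> u = u \<otimes>\<^bsub>A\<^esub> z"
    and B_finite: "finite B" and B_carrier: "B \<subseteq> carrier A"
    and A_span: "stable_span reg (F \<union> Z) B = carrier A"
begin

text \<open>In other words, the elements \<open>f, z f, z\<^sup>2 f, \<dots>\<close> span a finite-dimensional space.\<close>

definition algebraic :: "('a, 'n, 'e) module_scheme \<Rightarrow> 'a \<Rightarrow> 'n \<Rightarrow> bool" where
  "algebraic N z f \<longleftrightarrow> (\<exists>d. \<exists>t\<in>monics z d. t \<odot>\<^bsub>N\<^esub> f = \<zero>\<^bsub>N\<^esub>)"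

lemma monics_set: "z \<in> Z \<Longrightarrow> central_multiplicative_set A (\<Union>d. monics z d)"
  by (rule central_multiplicative_set_monics) (use Z_carrier Z_central in auto)

lemma torsion_monics: "torsion (\<Union>d. monics z d) N = {f \<in> carrier N. algebraic N z f}"
  by (auto simp: torsion_def algebraic_def)

lemma left_noetherian: "left_noetherian A"
  by (rule left_noetherian_if_finite_over_center[OF Z_finite Z_carrier Z_central B_finite B_carrier A_span])

lemma algebraic_common:
  assumes N: "left_module A N" and S: "finite S" "S \<subseteq> carrier N" and z: "z \<in> Z"
    and alg: "\<And>f. f \<in> S \<Longrightarrow> algebraic N z f"
  shows "\<exists>d. \<exists>t\<in>monics z d. \<forall>f\<in>S. t \<odot>\<^bsub>N\<^esub> f = \<zero>\<^bsub>N\<^esub>"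
  using S alg
proof (induction S)
  case empty
  then show ?case using monics_one by blast
next
  case (insert f S)
  interpret N: left_module A N by (rule N)
  interpret T: central_multiplicative_set A "\<Union>d. monics z d" by (rule monics_set[OF z])
  obtain d t where t: "t \<in> monics z d" "\<And>g. g \<in> S \<Longrightarrow> t \<odot>\<^bsub>N\<^esub> g = \<zero>\<^bsub>N\<^esub>" using insert by auto
  obtain e s where s: "s \<in> monics z e" "s \<odot>\<^bsub>N\<^esub> f = \<zero>\<^bsub>N\<^esub>" using insert.prems(2)[of f] by (auto simp: algebraic_def)
  have zc: "z \<in> carrier A" using z Z_carrier by auto
  note c = monics_carrier[OF zc t(1)] monics_carrier[OF zc s(1)]
  have "(t \<otimes>\<^bsub>A\<^esub> s) \<odot>\<^bsub>N\<^esub> g = \<zero>\<^bsub>N\<^esub>" if g: "g \<in> insert f S" for g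
  proof -
    have gc: "g \<in> carrier N" using g insert.prems(1) by auto
    have 1: "(t \<otimes>\<^bsub>A\<^esub> s) \<odot>\<^bsub>N\<^esub> g = t \<odot>\<^bsub>N\<^esub> (s \<odot>\<^bsub>N\<^esub> g)" by (rule N.smult_assoc[OF c gc])
    have 2: "t \<odot>\<^bsub>N\<^esub> (s \<odot>\<^bsub>N\<^esub> g) = s \<odot>\<^bsub>N\<^esub> (t \<odot>\<^bsub>N\<^esub> g)"
      by (rule N.smult_swap[OF c gc]) (use T.T_central[of t s] t(1) c in auto)
    show ?thesis
    proof (cases "g = f")
      case True
      then show ?thesis using 1 s(2) c by (simp add: N.smult_r_null)
    next
      case False
      then show ?thesis using 1 2 t(2)[of g] g c by (simp add: N.smult_r_null)
    qed
  qed
  then show ?case using monics_mult[OF zc t(1) s(1)] by blast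
qed

text \<open>If every \<open>z \<in> Z\<close> acts algebraically on the generators, their common annihilator has finite
  codimension by \<open>finite_codimension\<close>. Conversely the powers of \<open>z\<close> applied to an element of a
  finite-dimensional module are linearly dependent.\<close>

theorem locally_finite_iff_algebraic:
  assumes N: "left_module A N"
  shows "locally_finite K A N \<longleftrightarrow> (\<forall>f\<in>carrier N. \<forall>z\<in>Z. algebraic N z f)"
proof (intro iffI ballI)
  interpret N: left_module A N by (rule N)
  fix f z assume lf: "locally_finite K A N" and f: "f \<in> carrier N" and z: "z \<in> Z"
  have zc: "z \<in> carrier A" using z Z_carrier by auto
  let ?P = "stable_span N (carrier A) {f}"
  obtain X where X: "finite X" "X \<subseteq> ?P" "stable_span N F X = ?P"
    using lf f unfolding locally_finite_iff[OF N] by (metis empty_subsetI finite.emptyI finite.insertI insert_subset)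
  have P: "stable N (carrier A) ?P" by (rule N.stable_stable_span) (use f in auto)
  have PF: "stable N F ?P" by (rule stable_mono[OF P F_subset])
  have "X \<subseteq> carrier N" using X(2) stableD(1)[OF P] by auto
  from N.noetherian_finite_span[OF central_subfield_axioms X(1) this]
  have noeth: "noetherian N F ?P" using X(3) by simp
  have "\<exists>k. \<exists>r\<in>combs reg F (\<lambda>i. z [^]\<^bsub>A\<^esub> i) k. (z [^]\<^bsub>A\<^esub> k \<oplus>\<^bsub>A\<^esub> r) \<odot>\<^bsub>N\<^esub> f = \<zero>\<^bsub>N\<^esub>"
  proof (rule linear_dependence[OF N PF noeth, where \<phi> = "\<lambda>u. u \<odot>\<^bsub>N\<^esub> f"])
    show "z [^]\<^bsub>A\<^esub> i \<odot>\<^bsub>N\<^esub> f \<in> ?P" for i :: nat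
      by (rule stable_span.smult[OF _ stable_span.gen]) (use zc in auto)
  qed (use f zc F_carrier in \<open>auto simp: N.smult_l_distr N.smult_assoc\<close>)
  then show "algebraic N z f" unfolding algebraic_def monics_def polys_def by blast
next
  interpret N: left_module A N by (rule N)
  assume alg: "\<forall>f\<in>carrier N. \<forall>z\<in>Z. algebraic N z f"
  interpret AA: left_module A reg by (rule left_module_reg)
  show "locally_finite K A N"
    unfolding locally_finite_iff[OF N]
  proof (intro allI impI)
    fix S assume S: "finite S \<and> S \<subseteq> carrier N"
    define I where "I = {u \<in> carrier A. \<forall>s\<in>S. u \<odot>\<^bsub>N\<^esub> s = \<zero>\<^bsub>N\<^esub>}"
    have Sc: "s \<in> carrier N" if "s \<in> S" for s using S that by auto
    have I: "stable reg (carrier A) I"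
      by (rule stableI)
         (use Sc in \<open>auto simp: I_def N.smult_l_null N.smult_l_distr N.smult_assoc N.smult_r_null\<close>)
    have t: "\<exists>d. \<exists>t\<in>monics z d. \<forall>u\<in>carrier A. t \<otimes>\<^bsub>A\<^esub> u \<in> I" if z: "z \<in> Z" for z
    proof -
      obtain d t where t: "t \<in> monics z d" "\<And>f. f \<in> S \<Longrightarrow> t \<odot>\<^bsub>N\<^esub> f = \<zero>\<^bsub>N\<^esub>"
        using algebraic_common[OF N _ _ z, of S] S alg Sc z by blast
      have zc: "z \<in> carrier A" using z Z_carrier by auto
      note tc = monics_carrier[OF zc t(1)]
      have "t \<otimes>\<^bsub>A\<^esub> u \<in> I" if u: "u \<in> carrier A" for u
      proof -
        have "(t \<otimes>\<^bsub>A\<^esub> u) \<odot>\<^bsub>N\<^esub> s = \<zero>\<^bsub>N\<^esub>" if s: "s \<in> S" for s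
          using N.smult_assoc[OF u tc Sc[OF s]] monics_commute[OF zc u Z_central[OF z u] t(1)] t(2)[OF s] u
          by (simp add: N.smult_r_null)
        then show ?thesis using tc u by (auto simp: I_def)
      qed
      then show ?thesis using t(1) by blast
    qed
    obtain B' where B': "finite B'" "B' \<subseteq> carrier A"
      "carrier A \<subseteq> {x \<oplus>\<^bsub>A\<^esub> y | x y. x \<in> stable_span reg F B' \<and> y \<in> I}"
      using finite_codimension[OF Z_finite Z_carrier Z_central B_finite B_carrier I t] A_span by auto
    define X where "X = (\<lambda>(b, s). b \<odot>\<^bsub>N\<^esub> s) ` (B' \<times> S)"
    let ?G = "stable_span N (carrier A) S"
    let ?Y = "stable_span N F X"
    have Xc: "X \<subseteq> carrier N" using B'(2) Sc N.smult_closed by (auto simp: X_def)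
    have XI: "b \<odot>\<^bsub>N\<^esub> s \<in> X" if "b \<in> B'" "s \<in> S" for b s using that by (auto simp: X_def)
    have Y: "stable N F ?Y" by (rule N.stable_stable_span[OF F_subset Xc])
    note Yd = stableD[OF Y]
    have span: "stable reg F (stable_span reg F B')"
      by (rule AA.stable_stable_span[OF F_subset]) (use B'(2) in simp)
    have part: "x \<odot>\<^bsub>N\<^esub> s \<in> ?Y" if "x \<in> stable_span reg F B'" and s: "s \<in> S" for x s
      using that(1)
    proof induction
      case zero
      then show ?case using Sc[OF s] Yd(2) by (simp add: N.smult_l_null)
    next
      case (gen b)
      show ?case by (rule stable_span.gen[OF XI[OF gen s]])
    next
      case (add x y)
      have "x \<in> carrier A" "y \<in> carrier A" using add(1,2) stableD(1)[OF span] by auto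
      then show ?case using Sc[OF s] Yd(3)[OF add.IH] by (simp add: N.smult_l_distr)
    next
      case (smult c x)
      have "c \<in> carrier A" "x \<in> carrier A" using smult(1,2) F_carrier stableD(1)[OF span] by auto
      then show ?case using Sc[OF s] Yd(4)[OF smult(1) smult.IH] by (simp add: N.smult_assoc)
    qed
    have all: "u \<odot>\<^bsub>N\<^esub> s \<in> ?Y" if u: "u \<in> carrier A" and s: "s \<in> S" for u s
    proof -
      obtain x y where *: "u = x \<oplus>\<^bsub>A\<^esub> y" "x \<in> stable_span reg F B'" "y \<in> I" using B'(3) u by blast
      have "x \<in> carrier A" "y \<in> carrier A" using * stableD(1)[OF span] by (auto simp: I_def)
      moreover have "y \<odot>\<^bsub>N\<^esub> s = \<zero>\<^bsub>N\<^esub>" using * s by (auto simp: I_def)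
      ultimately have "u \<odot>\<^bsub>N\<^esub> s = x \<odot>\<^bsub>N\<^esub> s" using Sc[OF s] *(1) by (simp add: N.smult_l_distr N.smult_closed)
      then show ?thesis using part[OF *(2) s] by simp
    qed
    have "stable N (carrier A) ?Y"
    proof (rule stableI)
      fix u y assume u: "u \<in> carrier A" and "y \<in> ?Y"
      from this(2) show "u \<odot>\<^bsub>N\<^esub> y \<in> ?Y"
      proof induction
        case zero
        then show ?case using u Yd(2) by (simp add: N.smult_r_null)
      next
        case (gen x)
        then obtain b s where *: "b \<in> B'" "s \<in> S" "x = b \<odot>\<^bsub>N\<^esub> s" by (auto simp: X_def)
        have b: "b \<in> carrier A" using *(1) B'(2) by auto
        have "u \<odot>\<^bsub>N\<^esub> x = (u \<otimes>\<^bsub>A\<^esub> b) \<odot>\<^bsub>N\<^esub> s" using N.smult_assoc[OF u b Sc[OF *(2)]] *(3) by simp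
        then show ?case using all[OF A.m_closed[OF u b] *(2)] by simp
      next
        case (add x y)
        have "x \<in> carrier N" "y \<in> carrier N" using add(1,2) Yd(1) by auto
        then show ?case using u Yd(3)[OF add.IH] by (simp add: N.smult_r_distr)
      next
        case (smult c x)
        have "x \<in> carrier N" using smult(2) Yd(1) by auto
        then have "u \<odot>\<^bsub>N\<^esub> (c \<odot>\<^bsub>N\<^esub> x) = c \<odot>\<^bsub>N\<^esub> (u \<odot>\<^bsub>N\<^esub> x)"
          by (rule N.smult_swap[OF u F_carrier[OF smult(1)] _ F_central[OF smult(1) u, symmetric]])
        then show ?case using Yd(4)[OF smult(1) smult.IH] by simp
      qed
    qed (use Yd in auto)
    moreover have "S \<subseteq> ?Y"
    proof
      fix s assume s: "s \<in> S"
      show "s \<in> ?Y" using all[OF A.one_closed s] Sc[OF s] by (simp add: N.smult_one)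
    qed
    ultimately have GY: "?G \<subseteq> ?Y" by (rule stable_span_least)
    have G: "stable N (carrier A) ?G" by (rule N.stable_stable_span) (use S in auto)
    have XG: "X \<subseteq> ?G"
    proof
      fix x assume "x \<in> X"
      then obtain b s where *: "b \<in> B'" "s \<in> S" "x = b \<odot>\<^bsub>N\<^esub> s" by (auto simp: X_def)
      show "x \<in> ?G" unfolding *(3)
        by (rule stable_span.smult[OF _ stable_span.gen[OF *(2)]]) (use * B'(2) in auto)
    qed
    have "?Y \<subseteq> ?G" by (rule stable_span_least[OF stable_mono[OF G F_subset] XG])
    then have "?Y = ?G" using GY by (rule subset_antisym)
    moreover have "finite X" using B'(1) S by (simp add: X_def)
    ultimately show "\<exists>X. finite X \<and> X \<subseteq> ?G \<and> stable_span N F X = ?G" using XG by blast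
  qed
qed

text \<open>This will turn out to be the continuous dual.\<close>

definition algebraic_forms :: "('a \<Rightarrow> 'k) set" where
  "algebraic_forms = {f \<in> linear_forms K A. \<forall>z\<in>Z. algebraic E z f}"

text \<open>One central element at a time, by \<open>baer_torsion\<close>.\<close>

lemma stable_baer_algebraic_forms:
  "stable E (carrier A) algebraic_forms \<and> baer A (E\<lparr>carrier := algebraic_forms\<rparr>)"
proof -
  interpret E: left_module A E by (rule left_module_coregular)
  have "stable E (carrier A) {f \<in> carrier E. \<forall>z\<in>Y. algebraic E z f} \<and>
    baer A (E\<lparr>carrier := {f \<in> carrier E. \<forall>z\<in>Y. algebraic E z f}\<rparr>)" if "Y \<subseteq> Z" for Y
    using finite_subset[OF that Z_finite] that
  proof (induction Y)
    case empty
    have "stable E (carrier A) (carrier E)" by (rule stableI) (auto intro: E.smult_closed)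
    then show ?case using baer_coregular by simp
  next
    case (insert z Y)
    let ?W = "{f \<in> carrier E. \<forall>z\<in>Y. algebraic E z f}"
    let ?N = "E\<lparr>carrier := ?W\<rparr>"
    have W: "stable E (carrier A) ?W" and B: "baer A ?N" using insert by auto
    interpret N: left_module A ?N by (rule E.submodule_left_module[OF W])
    have T: "central_multiplicative_set A (\<Union>d. monics z d)" using monics_set insert by auto
    have eq: "torsion (\<Union>d. monics z d) ?N = {f \<in> carrier E. \<forall>z\<in>insert z Y. algebraic E z f}"
      by (auto simp: torsion_monics) (auto simp: algebraic_def)
    have "stable ?N (carrier A) (torsion (\<Union>d. monics z d) ?N)" by (rule N.torsion_stable[OF T])
    then have "stable E (carrier A) (torsion (\<Union>d. monics z d) ?N)"
      by (auto simp: stable_def torsion_def)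
    moreover have "baer A (?N\<lparr>carrier := torsion (\<Union>d. monics z d) ?N\<rparr>)"
      by (rule N.baer_torsion[OF T left_noetherian B])
    ultimately show ?case unfolding eq by simp
  qed
  from this[of Z] show ?thesis by (simp add: algebraic_forms_def coregular_left_simps(1))
qed

lemma locally_finite_iff_algebraic_forms:
  assumes W: "Module.submodule W A E"
  shows "locally_finite K A (E\<lparr>carrier := W\<rparr>) \<longleftrightarrow> W \<subseteq> algebraic_forms"
proof -
  interpret E: left_module A E by (rule left_module_coregular)
  have W': "stable E (carrier A) W" using W E.submodule_iff_stable by blast
  have "locally_finite K A (E\<lparr>carrier := W\<rparr>) \<longleftrightarrow>
     (\<forall>f\<in>W. \<forall>z\<in>Z. algebraic E z f)"
    using locally_finite_iff_algebraic[OF E.submodule_left_module[OF W']] by (simp add: algebraic_def)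
  then show ?thesis using stableD(1)[OF W'] by (auto simp: algebraic_forms_def coregular_left_simps(1))
qed

end

section \<open>The opposite algebra\<close>

definition opposite :: "('k, 'a, 'd) module_scheme \<Rightarrow> ('k, 'a, 'd) module_scheme" where
  "opposite A = A\<lparr>monoid.mult := \<lambda>x y. y \<otimes>\<^bsub>A\<^esub> x\<rparr>"

lemma opposite_simps [simp]:
  "carrier (opposite A) = carrier A" "zero (opposite A) = zero A" "one (opposite A) = one A"
  "add (opposite A) = add A" "smult (opposite A) = smult A"
  "monoid.mult (opposite A) = (\<lambda>x y. y \<otimes>\<^bsub>A\<^esub> x)"
  by (simp_all add: opposite_def)

lemma ring_opposite: assumes "ring A" shows "ring (opposite A)"
proof -
  interpret ring A by (rule assms)
  have "abelian_group (opposite A)" by (rule abelian_group_cong) simp_all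
  moreover have "monoid (opposite A)" by (rule monoidI) (simp_all add: m_assoc)
  ultimately show ?thesis by (rule ringI) (simp_all add: l_distr r_distr)
qed

lemma right_module_iff_opposite:
  assumes A: "ring A" shows "right_module A M \<longleftrightarrow> left_module (opposite A) M"
  using A ring_opposite[OF A]
  by (auto simp: left_module_def right_module_def left_module_axioms_def right_module_axioms_def)

lemma injective_right_module_if_opposite:
  fixes A :: "('k, 'a, 'd) module_scheme" and Q :: "('a, 'q, 'e) module_scheme"
  assumes A: "ring A" and Q: "injective_left_module TYPE('m) TYPE('n) (opposite A) Q"
  shows "injective_right_module TYPE('m) TYPE('n) A Q"
  using Q
  by (simp add: injective_left_module_def injective_right_module_def right_module_iff_opposite[OF A]
      LinearCombinations.module_hom_def)

lemma coregular_right_opposite: "coregular_right K A = coregular_left K (opposite A)"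
  by (simp add: coregular_left_def coregular_right_def linear_forms_def)

lemma submodule_opposite: "Module.submodule H (opposite A) M \<longleftrightarrow> Module.submodule H A M"
  by (simp add: Module.submodule_def Module.submodule_axioms_def)

lemma locally_finite_opposite: "locally_finite K (opposite A) M \<longleftrightarrow> locally_finite K A M"
  by (simp add: locally_finite_def generated_submodule_def submodule_opposite restrict_scalars_def)

lemma coregular_left_opposite: "coregular_left K A = coregular_right K (opposite A)"
  by (simp add: coregular_left_def coregular_right_def linear_forms_def)

lemma continuous_dual_opposite: "continuous_dual K (opposite A) = continuous_dual K A"
  unfolding continuous_dual_def
  by (simp add: submodule_opposite locally_finite_opposite coregular_right_opposite[symmetric]
      coregular_left_opposite[symmetric] conj_commute conj_left_commute)

lemma continuous_dual_right_opposite: "continuous_dual_right K A = continuous_dual_left K (opposite A)"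
  by (simp add: continuous_dual_left_def continuous_dual_right_def coregular_right_opposite continuous_dual_opposite)

context finite_central_algebra
begin

lemma central_algebra_opposite: "central_algebra K (opposite A)"
proof -
  interpret O: ring "opposite A" by (rule ring_opposite[OF A.ring_axioms])
  show ?thesis
  proof (intro central_algebra.intro central_algebra_axioms.intro K.field_axioms O.ring_axioms,
      unfold opposite_simps)
    fix c u assume c: "c \<in> carrier K" and u: "u \<in> carrier A"
    show "c \<odot>\<^bsub>A\<^esub> u = u \<otimes>\<^bsub>A\<^esub> (c \<odot>\<^bsub>A\<^esub> \<one>\<^bsub>A\<^esub>)"
      using smult_eq[OF c u] scalar_central[OF c u] by (rule trans)
    show "u \<otimes>\<^bsub>A\<^esub> (c \<odot>\<^bsub>A\<^esub> \<one>\<^bsub>A\<^esub>) = (c \<odot>\<^bsub>A\<^esub> \<one>\<^bsub>A\<^esub>) \<otimes>\<^bsub>A\<^esub> u"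
      by (rule scalar_central[OF c u, symmetric])
  next
    fix c d assume c: "c \<in> carrier K" and d: "d \<in> carrier K"
    show "(c \<otimes>\<^bsub>K\<^esub> d) \<odot>\<^bsub>A\<^esub> \<one>\<^bsub>A\<^esub> = (d \<odot>\<^bsub>A\<^esub> \<one>\<^bsub>A\<^esub>) \<otimes>\<^bsub>A\<^esub> (c \<odot>\<^bsub>A\<^esub> \<one>\<^bsub>A\<^esub>)"
      using scalar_mult[OF c d] scalar_central[OF c scalar_closed[OF d]] by (rule trans)
  qed (fact scalar_closed scalar_add scalar_one)+
qed

text \<open>Central elements multiply in the same way from both sides, so the same \<open>Z\<close> and \<open>B\<close> serve for the
  opposite algebra.\<close>

lemma opposite_finite_central_algebra: "finite_central_algebra K (opposite A) Z B"
proof -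
  interpret O: central_algebra K "opposite A" by (rule central_algebra_opposite)
  have F: "O.F = F" by (simp add: O.F_def F_def O.\<eta>_def \<eta>_def)
  interpret OM: left_module "opposite A" "regular_module (opposite A)" by (rule O.left_module_reg)
  have C: "F \<union> Z \<subseteq> carrier A" using F_subset Z_carrier by auto
  let ?P = "stable_span (regular_module (opposite A)) (F \<union> Z) B"
  have P: "stable (regular_module (opposite A)) (F \<union> Z) ?P"
    by (rule OM.stable_stable_span) (use C B_carrier in auto)
  note Pd = stableD[OF P]
  have "stable reg (F \<union> Z) ?P"
  proof (rule stableI)
    fix c x assume c: "c \<in> F \<union> Z" and x: "x \<in> ?P"
    have "x \<in> carrier A" using x Pd(1) by auto
    then have "c \<otimes>\<^bsub>A\<^esub> x = x \<otimes>\<^bsub>A\<^esub> c" using c F_central Z_central by auto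
    then show "c \<odot>\<^bsub>reg\<^esub> x \<in> ?P" using Pd(4)[OF c x] by simp
  qed (use Pd in auto)
  moreover have "B \<subseteq> ?P" by (rule subsetI) (rule stable_span.gen)
  ultimately have "carrier A \<subseteq> ?P" using stable_span_least[of reg "F \<union> Z" ?P B] A_span by simp
  then have "?P = carrier A" using Pd(1) by auto
  then have span: "stable_span (regular_module (opposite A)) (O.F \<union> Z) B = carrier (opposite A)"
    by (simp add: F)
  show ?thesis
  proof (intro finite_central_algebra.intro finite_central_algebra_axioms.intro O.central_algebra_axioms span)
    show "z \<otimes>\<^bsub>opposite A\<^esub> u = u \<otimes>\<^bsub>opposite A\<^esub> z" if "z \<in> Z" "u \<in> carrier (opposite A)" for z u
      using Z_central[OF that(1), of u] that(2) by simp
  qed (simp_all add: Z_finite Z_carrier B_finite B_carrier)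
qed

text \<open>A central element acts on linear forms in the same way from the left and from the right.\<close>

lemma algebraic_forms_opposite: "finite_central_algebra.algebraic_forms K (opposite A) Z = algebraic_forms"
proof -
  interpret O: finite_central_algebra K "opposite A" Z B by (rule opposite_finite_central_algebra)
  have F: "O.F = F" by (simp add: O.F_def F_def O.\<eta>_def \<eta>_def)
  have pow: "z [^]\<^bsub>opposite A\<^esub> n = z [^]\<^bsub>A\<^esub> n" if "z \<in> carrier A" for z and n :: nat
  proof (induction n)
    case 0
    then show ?case by (simp add: nat_pow_def)
  next
    case (Suc n)
    then show ?case using O.A.nat_pow_Suc[of z n] A.nat_pow_Suc2[OF that, of n] by simp
  qed
  have poly: "O.polys z d = polys z d" if z: "z \<in> carrier A" for z d
  proof (induction d)
    case 0
    then show ?case by (simp add: O.polys_0 polys_0)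
  next
    case (Suc d)
    have "c \<otimes>\<^bsub>A\<^esub> z [^]\<^bsub>A\<^esub> d = z [^]\<^bsub>A\<^esub> d \<otimes>\<^bsub>A\<^esub> c" if "c \<in> F" for c
      using F_central[OF that] z by simp
    then have eq: "x \<oplus>\<^bsub>opposite A\<^esub> z [^]\<^bsub>opposite A\<^esub> d \<otimes>\<^bsub>opposite A\<^esub> c = x \<oplus>\<^bsub>A\<^esub> z [^]\<^bsub>A\<^esub> d \<otimes>\<^bsub>A\<^esub> c"
      if "c \<in> F" for x c
      using that by (simp add: pow[OF z])
    have OP: "O.polys z (Suc d) = {x \<oplus>\<^bsub>opposite A\<^esub> z [^]\<^bsub>opposite A\<^esub> d \<otimes>\<^bsub>opposite A\<^esub> c | x c.
        x \<in> polys z d \<and> c \<in> F}"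
      unfolding O.polys_Suc unfolding Suc unfolding F by (rule refl)
    show ?case
    proof (intro equalityI subsetI)
      fix y assume "y \<in> O.polys z (Suc d)"
      then obtain x c where *: "y = x \<oplus>\<^bsub>opposite A\<^esub> z [^]\<^bsub>opposite A\<^esub> d \<otimes>\<^bsub>opposite A\<^esub> c"
        "x \<in> polys z d" "c \<in> F"
        unfolding OP by blast
      show "y \<in> polys z (Suc d)" unfolding polys_Suc *(1) eq[OF *(3)] using *(2,3) by blast
    next
      fix y assume "y \<in> polys z (Suc d)"
      then obtain x c where *: "y = x \<oplus>\<^bsub>A\<^esub> z [^]\<^bsub>A\<^esub> d \<otimes>\<^bsub>A\<^esub> c" "x \<in> polys z d" "c \<in> F"
        unfolding polys_Suc by blast
      show "y \<in> O.polys z (Suc d)" unfolding OP *(1) eq[OF *(3), symmetric] using *(2,3) by blast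
    qed
  qed
  have mon: "O.monics z d = monics z d" if "z \<in> carrier A" for z d
    using that by (simp add: O.monics_def monics_def poly pow)
  have "O.algebraic O.E z f = algebraic E z f" if z: "z \<in> Z" for z f
  proof -
    have zc: "z \<in> carrier A" using z Z_carrier by auto
    have "t \<odot>\<^bsub>O.E\<^esub> f = t \<odot>\<^bsub>E\<^esub> f" if t: "t \<in> monics z d" for t d
      using monics_commute[OF zc _ Z_central[OF z] t]
      by (auto simp: coregular_left_simps intro!: restrict_ext)
    moreover have "\<zero>\<^bsub>O.E\<^esub> = \<zero>\<^bsub>E\<^esub>" by (simp add: coregular_left_simps)
    ultimately show ?thesis by (auto simp: O.algebraic_def algebraic_def mon[OF zc])
  qed
  moreover have "linear_forms K (opposite A) = linear_forms K A" by (simp add: linear_forms_def)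
  ultimately show ?thesis by (auto simp: O.algebraic_forms_def algebraic_forms_def)
qed

text \<open>A submodule of the dual is locally finite exactly if it consists of algebraic forms, and the
  algebraic forms are the same for both actions; so they are the greatest set in question.\<close>

theorem continuous_dual_eq: "continuous_dual K A = algebraic_forms"
proof -
  interpret O: finite_central_algebra K "opposite A" Z B by (rule opposite_finite_central_algebra)
  interpret E: left_module A E by (rule left_module_coregular)
  interpret OE: left_module "opposite A" O.E by (rule O.left_module_coregular)
  have l: "Module.submodule algebraic_forms A E"
    using stable_baer_algebraic_forms E.submodule_iff_stable by blast
  have r: "Module.submodule algebraic_forms (opposite A) O.E"
    using O.stable_baer_algebraic_forms OE.submodule_iff_stable algebraic_forms_opposite by metis
  have lf: "locally_finite K A (E\<lparr>carrier := algebraic_forms\<rparr>)"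
    using locally_finite_iff_algebraic_forms[OF l] by simp
  have rf: "locally_finite K (opposite A) (O.E\<lparr>carrier := algebraic_forms\<rparr>)"
    using O.locally_finite_iff_algebraic_forms[OF r] algebraic_forms_opposite by simp
  show ?thesis
    unfolding continuous_dual_def
  proof (rule Greatest_equality)
    show "Module.submodule algebraic_forms A E \<and> Module.submodule algebraic_forms A (coregular_right K A) \<and>
        locally_finite K A (E\<lparr>carrier := algebraic_forms\<rparr>) \<and>
        locally_finite K A ((coregular_right K A)\<lparr>carrier := algebraic_forms\<rparr>)"
      using l r lf rf by (simp add: coregular_right_opposite submodule_opposite locally_finite_opposite)
  next
    fix W
    assume "Module.submodule W A E \<and> Module.submodule W A (coregular_right K A) \<and>
        locally_finite K A (E\<lparr>carrier := W\<rparr>) \<and> locally_finite K A ((coregular_right K A)\<lparr>carrier := W\<rparr>)"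
    then show "W \<le> algebraic_forms" using locally_finite_iff_algebraic_forms by blast
  qed
qed

theorem injective_left: "injective_left_module TYPE('m) TYPE('n) A (continuous_dual_left K A)"
proof (rule injective_left_module_if_baer)
  interpret E: left_module A E by (rule left_module_coregular)
  show "left_module A (continuous_dual_left K A)"
    unfolding continuous_dual_left_def continuous_dual_eq
    by (rule E.submodule_left_module) (use stable_baer_algebraic_forms in blast)
  show "baer A (continuous_dual_left K A)"
    unfolding continuous_dual_left_def continuous_dual_eq using stable_baer_algebraic_forms by blast
qed

end

theorem (in finite_central_algebra) injective_right:
  "injective_right_module TYPE('m) TYPE('n) A (continuous_dual_right K A)"
proof -
  interpret O: finite_central_algebra K "opposite A" Z B by (rule opposite_finite_central_algebra)
  show ?thesis
    by (rule injective_right_module_if_opposite[OF A.ring_axioms])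
       (use O.injective_left in \<open>simp add: continuous_dual_right_opposite\<close>)
qed

section \<open>Commutators in prime characteristic\<close>

context ring
begin

definition ad :: "'a \<Rightarrow> 'a \<Rightarrow> 'a" where "ad w u = w \<otimes> u \<ominus> u \<otimes> w"

lemma ad_closed [simp]: "\<lbrakk>w \<in> carrier R; u \<in> carrier R\<rbrakk> \<Longrightarrow> ad w u \<in> carrier R"
  by (simp add: ad_def)

lemma ad_pow_closed [simp]: "\<lbrakk>w \<in> carrier R; u \<in> carrier R\<rbrakk> \<Longrightarrow> (ad w ^^ k) u \<in> carrier R"
  by (induction k) simp_all

lemma ad_eq_zero_iff:
  assumes "w \<in> carrier R" "u \<in> carrier R" shows "ad w u = \<zero> \<longleftrightarrow> w \<otimes> u = u \<otimes> w"
  using assms by (simp add: ad_def)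

lemma mult_eq_ad: "\<lbrakk>w \<in> carrier R; u \<in> carrier R\<rbrakk> \<Longrightarrow> w \<otimes> u = ad w u \<oplus> u \<otimes> w"
  by (simp add: ad_def minus_eq a_assoc l_neg)

text \<open>Left multiplication by \<open>w\<close> is the sum of \<open>ad w\<close> and the right multiplication by \<open>w\<close>, which
  commute; this is the binomial theorem for that sum.\<close>

lemma power_mult_eq_ad:
  assumes w: "w \<in> carrier R" and u: "u \<in> carrier R"
  shows "w [^] n \<otimes> u = (\<Oplus>k\<in>{..n}. [(n choose k)] \<cdot>\<^bsub>R\<^esub> ((ad w ^^ k) u \<otimes> w [^] (n - k)))"
proof (induction n)
  case 0
  then show ?case using w u by simp
next
  case (Suc n)
  define a where "a k = (ad w ^^ k) u \<otimes> w [^] (Suc n - k)" for k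
  have a: "a k \<in> carrier R" for k using w u by (simp add: a_def)
  have step: "w \<otimes> ([(n choose k)] \<cdot>\<^bsub>R\<^esub> ((ad w ^^ k) u \<otimes> w [^] (n - k))) =
      [(n choose k)] \<cdot>\<^bsub>R\<^esub> a (Suc k) \<oplus> [(n choose k)] \<cdot>\<^bsub>R\<^esub> a k" if k: "k \<le> n" for k
  proof -
    let ?x = "(ad w ^^ k) u"
    have x: "?x \<in> carrier R" using w u by simp
    have "w \<otimes> (?x \<otimes> w [^] (n - k)) = (ad w ?x \<oplus> ?x \<otimes> w) \<otimes> w [^] (n - k)"
      using w x mult_eq_ad[OF w x] by (simp add: m_assoc[symmetric])
    also have "\<dots> = ad w ?x \<otimes> w [^] (n - k) \<oplus> ?x \<otimes> (w \<otimes> w [^] (n - k))"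
      using w x by (simp add: l_distr m_assoc)
    also have "w \<otimes> w [^] (n - k) = w [^] (Suc n - k)"
      using nat_pow_Suc2[OF w, of "n - k"] k by (simp add: Suc_diff_le)
    also have "ad w ?x \<otimes> w [^] (n - k) \<oplus> ?x \<otimes> w [^] (Suc n - k) = a (Suc k) \<oplus> a k"
      by (simp add: a_def)
    finally show ?thesis using w x a by (simp add: add_pow_rdistr add.nat_pow_distrib)
  qed
  have "w [^] Suc n \<otimes> u = w \<otimes> (w [^] n \<otimes> u)"
    using w u nat_pow_Suc2[OF w, of n] by (simp add: m_assoc del: nat_pow_Suc)
  also have "\<dots> = (\<Oplus>k\<in>{..n}. w \<otimes> ([(n choose k)] \<cdot>\<^bsub>R\<^esub> ((ad w ^^ k) u \<otimes> w [^] (n - k))))"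
    unfolding Suc by (rule finsum_rdistr) (use w u in auto)
  also have "\<dots> = (\<Oplus>k\<in>{..n}. [(n choose k)] \<cdot>\<^bsub>R\<^esub> a (Suc k) \<oplus> [(n choose k)] \<cdot>\<^bsub>R\<^esub> a k)"
    by (rule finsum_cong') (use a step in auto)
  also have "\<dots> = (\<Oplus>k\<in>{..n}. [(n choose k)] \<cdot>\<^bsub>R\<^esub> a (Suc k)) \<oplus> (\<Oplus>k\<in>{..n}. [(n choose k)] \<cdot>\<^bsub>R\<^esub> a k)"
    by (rule finsum_addf) (use a in auto)
  also have "(\<Oplus>k\<in>{..n}. [(n choose k)] \<cdot>\<^bsub>R\<^esub> a k) = (\<Oplus>k\<in>{..Suc n}. [(n choose k)] \<cdot>\<^bsub>R\<^esub> a k)"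
    using a by (simp add: finsum_Suc Pi_def binomial_eq_0)
  also have "\<dots> = (\<Oplus>k\<in>{..n}. [(n choose Suc k)] \<cdot>\<^bsub>R\<^esub> a (Suc k)) \<oplus> a 0"
    using a by (subst finsum_Suc2) (auto simp: Pi_def)
  also have "(\<Oplus>k\<in>{..n}. [(n choose k)] \<cdot>\<^bsub>R\<^esub> a (Suc k)) \<oplus> ((\<Oplus>k\<in>{..n}. [(n choose Suc k)] \<cdot>\<^bsub>R\<^esub> a (Suc k)) \<oplus> a 0) =
      ((\<Oplus>k\<in>{..n}. [(n choose k)] \<cdot>\<^bsub>R\<^esub> a (Suc k)) \<oplus> (\<Oplus>k\<in>{..n}. [(n choose Suc k)] \<cdot>\<^bsub>R\<^esub> a (Suc k))) \<oplus> a 0"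
    using a by (simp add: a_assoc Pi_def)
  also have "(\<Oplus>k\<in>{..n}. [(n choose k)] \<cdot>\<^bsub>R\<^esub> a (Suc k)) \<oplus> (\<Oplus>k\<in>{..n}. [(n choose Suc k)] \<cdot>\<^bsub>R\<^esub> a (Suc k)) =
      (\<Oplus>k\<in>{..n}. [(n choose k)] \<cdot>\<^bsub>R\<^esub> a (Suc k) \<oplus> [(n choose Suc k)] \<cdot>\<^bsub>R\<^esub> a (Suc k))"
    by (rule finsum_addf[symmetric]) (use a in auto)
  also have "\<dots> = (\<Oplus>k\<in>{..n}. [(Suc n choose Suc k)] \<cdot>\<^bsub>R\<^esub> a (Suc k))"
    by (rule finsum_cong') (use a in \<open>auto simp: add.nat_pow_mult\<close>)
  also have "\<dots> \<oplus> a 0 = (\<Oplus>k\<in>{..Suc n}. [(Suc n choose k)] \<cdot>\<^bsub>R\<^esub> a k)"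
    using a by (subst finsum_Suc2) (auto simp: Pi_def)
  finally show ?case by (simp only: a_def)
qed

text \<open>In characteristic \<open>p\<close> only the two outer terms of the binomial expansion remain.\<close>

lemma ad_prime:
  assumes w: "w \<in> carrier R" and u: "u \<in> carrier R" and p: "Factorial_Ring.prime p"
    and char: "[p] \<cdot>\<^bsub>R\<^esub> \<one> = \<zero>"
  shows "ad (w [^] p) u = (ad w ^^ p) u"
proof -
  let ?t = "\<lambda>k. [(p choose k)] \<cdot>\<^bsub>R\<^esub> ((ad w ^^ k) u \<otimes> w [^] (p - k))"
  have c: "?t k \<in> carrier R" for k using w u by simp
  have px: "[p] \<cdot>\<^bsub>R\<^esub> x = \<zero>" if "x \<in> carrier R" for x
    using add_pow_ldistr[of \<one> x p] that char by simp
  have mid: "?t k = \<zero>" if k: "0 < k" "k < p" for k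
  proof -
    have "p dvd (p choose k)" using p k by (intro dvd_choose_prime) auto
    then obtain m where "p choose k = p * m" by blast
    then show ?thesis using w u by (simp add: add.nat_pow_pow[symmetric] px)
  qed
  obtain q where q: "p = Suc q" using prime_gt_0_nat[OF p] by (cases p) auto
  have q0: "q > 0" using prime_gt_1_nat[OF p] q by simp
  have "w [^] p \<otimes> u = (\<Oplus>k\<in>{..p}. ?t k)" by (rule power_mult_eq_ad[OF w u])
  also have "\<dots> = ?t p \<oplus> (\<Oplus>k\<in>{..q}. ?t k)" unfolding q using c q by (subst finsum_Suc) auto
  also have "(\<Oplus>k\<in>{..q}. ?t k) = (\<Oplus>k\<in>{..<q}. ?t (Suc k)) \<oplus> ?t 0"
  proof -
    obtain r where r: "q = Suc r" using q0 by (cases q) auto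
    show ?thesis unfolding r lessThan_Suc_atMost by (rule finsum_Suc2) (use c in auto)
  qed
  also have "(\<Oplus>k\<in>{..<q}. ?t (Suc k)) = (\<Oplus>k\<in>{..<q}. \<zero>)"
  proof (rule finsum_cong'[OF refl])
    show "?t (Suc k) = \<zero>" if "k \<in> {..<q}" for k by (rule mid) (use that q in auto)
  qed simp
  finally have "w [^] p \<otimes> u = (ad w ^^ p) u \<oplus> u \<otimes> w [^] p"
    using w u by simp
  then show ?thesis unfolding ad_def[of "w [^] p"] using w u
    by (simp add: minus_eq a_assoc r_neg)
qed

end

section \<open>Enveloping algebras are finite over their center in prime characteristic\<close>

text \<open>The situation of an enveloping algebra in characteristic \<open>p\<close>: \<open>V\<close> is the image of the Lie algebra,
  spanned by the finite set \<open>Y\<close>, and \<open>R\<close> is generated by \<open>V\<close> as a ring over \<open>F\<close>.\<close>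

locale lie_generated = central_subfield R F for R (structure) and F +
  fixes V Y :: "'a set" and p :: nat
  assumes V_stable: "stable reg F V"
    and Y_finite: "finite Y" and Y_V: "Y \<subseteq> V" and V_span: "V \<subseteq> stable_span reg F Y"
    and bracket: "\<lbrakk>x \<in> V; y \<in> V\<rbrakk> \<Longrightarrow> ad x y \<in> V"
    and generated: "\<lbrakk>stable reg F P; \<one> \<in> P; \<And>v x. \<lbrakk>v \<in> V; x \<in> P\<rbrakk> \<Longrightarrow> v \<otimes> x \<in> P\<rbrakk> \<Longrightarrow> carrier R \<subseteq> P"
    and prime: "Factorial_Ring.prime p" and char: "[p] \<cdot>\<^bsub>R\<^esub> \<one> = \<zero>"
begin

lemma V_carrier: "x \<in> V \<Longrightarrow> x \<in> carrier R" using stableD(1)[OF V_stable] by auto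

lemma Y_carrier: "y \<in> Y \<Longrightarrow> y \<in> carrier R" using Y_V V_carrier by auto

lemma combs_subset:
  assumes P: "stable reg F P" and a: "\<And>i. i < k \<Longrightarrow> a i \<in> P"
  shows "combs reg F a k \<subseteq> P"
  using a
proof (induction k)
  case 0
  then show ?case using stableD(2)[OF P] by simp
next
  case (Suc k)
  show ?case
  proof
    fix x assume "x \<in> combs reg F a (Suc k)"
    then obtain y c where *: "x = y \<oplus> a k \<otimes> c" "y \<in> combs reg F a k" "c \<in> F" by auto
    have ak: "a k \<in> P" using Suc.prems by simp
    have "a k \<otimes> c = c \<otimes> a k" using F_central[OF *(3), of "a k"] ak stableD(1)[OF P] by auto
    moreover have "c \<otimes> a k \<in> P" using stableD(4)[OF P *(3) ak] by simp
    moreover have "y \<in> P" using Suc *(2) by auto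
    ultimately show "x \<in> P" using stableD(3)[OF P, of y "a k \<otimes> c"] *(1) by simp
  qed
qed

lemma ad_add_left: "\<lbrakk>u \<in> carrier R; v \<in> carrier R; x \<in> carrier R\<rbrakk> \<Longrightarrow> ad (u \<oplus> v) x = ad u x \<oplus> ad v x"
  unfolding ad_def by algebra

lemma ad_smult_left:
  assumes "c \<in> F" "u \<in> carrier R" "x \<in> carrier R" shows "ad (c \<otimes> u) x = c \<otimes> ad u x"
proof -
  have "x \<otimes> (c \<otimes> u) = c \<otimes> (x \<otimes> u)"
    using assms F_carrier F_central[OF assms(1,3)] m_assoc[of x c u] m_assoc[of c x u] by simp
  then show ?thesis using assms F_carrier
    by (simp add: ad_def minus_eq m_assoc r_distr r_minus)
qed

lemma normalizer_stable: "stable reg F {u \<in> carrier R. \<forall>x\<in>V. ad u x \<in> V}"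
proof (rule stableI)
  have "ad \<zero> x = \<zero>" if "x \<in> V" for x using V_carrier[OF that] by (simp add: ad_def)
  then show "\<zero>\<^bsub>reg\<^esub> \<in> {u \<in> carrier R. \<forall>x\<in>V. ad u x \<in> V}" using stableD(2)[OF V_stable] by simp
qed (use V_carrier ad_add_left ad_smult_left stableD(3,4)[OF V_stable] F_carrier in auto)

lemma centralizer_stable:
  assumes s: "s \<in> carrier R" shows "stable reg F {u \<in> carrier R. u \<otimes> s = s \<otimes> u}"
proof (rule stableI)
  fix c x assume c: "c \<in> F" and x: "x \<in> {u \<in> carrier R. u \<otimes> s = s \<otimes> u}"
  have "(c \<otimes> x) \<otimes> s = s \<otimes> (c \<otimes> x)"
    using x s F_carrier[OF c] F_central[OF c s] m_assoc[of s c x] m_assoc[of c s x] m_assoc[of c x s] by simp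
  then show "c \<odot>\<^bsub>reg\<^esub> x \<in> {u \<in> carrier R. u \<otimes> s = s \<otimes> u}" using x F_carrier[OF c] by simp
qed (use s in \<open>auto simp: l_distr r_distr\<close>)

lemma ad_prime_power:
  assumes w: "w \<in> carrier R" and V: "\<And>x. x \<in> V \<Longrightarrow> ad w x \<in> V" and x: "x \<in> V"
  shows "ad (w [^] (p ^ i)) x \<in> V"
  using x
proof (induction i arbitrary: x)
  case 0
  then show ?case using w V by simp
next
  case (Suc i)
  let ?w = "w [^] (p ^ i)"
  have "(ad ?w ^^ n) x \<in> V" for n using Suc by (induction n) auto
  moreover have "w [^] (p ^ Suc i) = ?w [^] p" using w by (simp add: nat_pow_pow mult.commute)
  ultimately show ?case using ad_prime[of ?w x p] w V_carrier[OF Suc.prems] prime char by simp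
qed

text \<open>Since \<open>ad\<close> of a \<open>p\<close>-th power is the \<open>p\<close>-th power of \<open>ad\<close>, the elements \<open>[w, y], [w\<^sup>p, y], \<dots>\<close>
  stay in the finite-dimensional \<open>V\<close>; a linear relation between them gives a \<open>p\<close>-polynomial in \<open>w\<close>
  that commutes with one more element \<open>y\<close>.\<close>

lemma monic_commuting:
  assumes x: "x \<in> V" and S: "finite S" "S \<subseteq> V"
  shows "\<exists>d>0. \<exists>w\<in>monics x d. (\<forall>v\<in>V. ad w v \<in> V) \<and> (\<forall>s\<in>S. w \<otimes> s = s \<otimes> w)"
  using S
proof (induction S)
  case empty
  have "x \<in> monics x 1"
    using V_carrier[OF x] stableD(2)[OF polys_stable[of x 1]] by (auto simp: monics_def intro!: exI[of _ \<zero>])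
  then show ?case using bracket[OF x] by (intro exI[of _ 1]) auto
next
  case (insert y S)
  have xc: "x \<in> carrier R" by (rule V_carrier[OF x])
  obtain d w where w: "d > 0" "w \<in> monics x d" "\<And>v. v \<in> V \<Longrightarrow> ad w v \<in> V" "\<And>s. s \<in> S \<Longrightarrow> w \<otimes> s = s \<otimes> w"
    using insert.IH insert.prems by auto
  have wc: "w \<in> carrier R" by (rule monics_carrier[OF xc w(2)])
  have yV: "y \<in> V" and yc: "y \<in> carrier R" using insert.prems V_carrier by auto
  interpret A: left_module R reg by (rule left_module_reg)
  \<comment> \<open>Only the powers with exponent \<open>p\<^sup>i\<close>: for these \<open>[a i, y]\<close> stays in \<open>V\<close>.\<close>
  define a where "a i = w [^] (p ^ i)" for i
  have ac: "a i \<in> carrier R" for i using wc by (simp add: a_def)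
  have noeth: "noetherian reg F V"
    by (rule noetherian_subset[OF A.noetherian_finite_span[OF central_subfield_axioms Y_finite] V_span])
       (use Y_carrier in auto)
  have "\<exists>k. \<exists>r\<in>combs reg F a k. ad (a k \<oplus> r) y = \<zero>\<^bsub>reg\<^esub>"
  proof (rule linear_dependence[OF left_module_reg V_stable noeth, where \<phi> = "\<lambda>u. ad u y"])
    show "ad (a i) y \<in> V" for i unfolding a_def by (rule ad_prime_power[OF wc w(3) yV])
  qed (use ac yc ad_add_left ad_smult_left in auto)
  then obtain k r where r: "r \<in> combs reg F a k" "ad (a k \<oplus> r) y = \<zero>" by auto
  let ?w = "a k \<oplus> r"
  \<comment> \<open>The degrees \<open>d p\<^sup>i\<close> increase strictly since \<open>d > 0\<close>, so the result is again monic in \<open>x\<close>.\<close>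
  have "r \<in> polys x (d * p ^ k)"
  proof -
    have "a i \<in> polys x (d * p ^ k)" if i: "i < k" for i
    proof -
      have "a i \<in> polys x (Suc (d * p ^ i))"
        unfolding a_def by (rule monics_polys[OF xc monics_power[OF xc w(2)]])
      moreover have "d * p ^ i < d * p ^ k"
        using w(1) i prime_gt_1_nat[OF prime] by simp
      ultimately show ?thesis using polys_mono[OF xc Suc_leI] by blast
    qed
    then show ?thesis using combs_subset[OF polys_stable[OF xc], of k a] r(1) by auto
  qed
  then have mon: "?w \<in> monics x (d * p ^ k)"
    using monics_add[OF xc monics_power[OF xc w(2), of "p ^ k"]] by (simp add: a_def)
  have norm: "?w \<in> {u \<in> carrier R. \<forall>x\<in>V. ad u x \<in> V}"
  proof -
    have aN: "a i \<in> {u \<in> carrier R. \<forall>x\<in>V. ad u x \<in> V}" for i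
      using ad_prime_power[OF wc w(3), of _ i] ac[of i] by (simp add: a_def)
    then have "r \<in> {u \<in> carrier R. \<forall>x\<in>V. ad u x \<in> V}"
      using combs_subset[of _ k a, OF normalizer_stable aN] r(1) by blast
    then show ?thesis using stableD(3)[OF normalizer_stable aN] by simp
  qed
  have cent: "?w \<otimes> s = s \<otimes> ?w" if s: "s \<in> S" for s
  proof -
    have sc: "s \<in> carrier R" using s insert.prems V_carrier by auto
    note st = centralizer_stable[OF sc]
    have aN: "a i \<in> {u \<in> carrier R. u \<otimes> s = s \<otimes> u}" for i
      using group_commutes_pow[OF w(4)[OF s] wc sc] ac[of i] by (simp add: a_def)
    then have "r \<in> {u \<in> carrier R. u \<otimes> s = s \<otimes> u}"
      using combs_subset[of _ k a, OF st aN] r(1) by blast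
    then have "?w \<in> {u \<in> carrier R. u \<otimes> s = s \<otimes> u}" using stableD(3)[OF st aN] by simp
    then show ?thesis by blast
  qed
  have wc': "?w \<in> carrier R" using norm by blast
  have "?w \<otimes> y = y \<otimes> ?w" using r(2) ad_eq_zero_iff[OF wc' yc] by blast
  then have "\<forall>s\<in>insert y S. ?w \<otimes> s = s \<otimes> ?w" using cent by blast
  moreover have "d * p ^ k > 0" using w(1) prime_gt_0_nat[OF prime] by simp
  ultimately show ?case using mon norm by blast
qed

text \<open>Commuting with the spanning set \<open>Y\<close> is enough, since the centralizer of \<open>w\<close> is a subalgebra.\<close>

lemma monic_central:
  assumes x: "x \<in> V"
  shows "\<exists>d>0. \<exists>w\<in>monics x d. \<forall>u\<in>carrier R. w \<otimes> u = u \<otimes> w"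
proof -
  obtain d w where w: "d > 0" "w \<in> monics x d" "\<And>s. s \<in> Y \<Longrightarrow> w \<otimes> s = s \<otimes> w"
    using monic_commuting[OF x Y_finite Y_V] by blast
  have wc: "w \<in> carrier R" by (rule monics_carrier[OF V_carrier[OF x] w(2)])
  let ?P = "{u \<in> carrier R. u \<otimes> w = w \<otimes> u}"
  note st = centralizer_stable[OF wc]
  have "Y \<subseteq> ?P" using w(3)[symmetric] Y_carrier by blast
  then have VP: "V \<subseteq> ?P" using V_span stable_span_least[OF st] by blast
  have "carrier R \<subseteq> ?P"
  proof (rule generated[OF st])
    show "\<one> \<in> ?P" using wc by simp
    fix v x assume v: "v \<in> V" and x: "x \<in> ?P"
    have vP: "v \<in> carrier R" "v \<otimes> w = w \<otimes> v" using VP v by auto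
    have xP: "x \<in> carrier R" "x \<otimes> w = w \<otimes> x" using x by auto
    have "(v \<otimes> x) \<otimes> w = w \<otimes> (v \<otimes> x)"
      using vP xP wc m_assoc[of v x w] m_assoc[of v w x] m_assoc[of w v x] by simp
    then show "v \<otimes> x \<in> ?P" using vP(1) xP(1) by simp
  qed
  then have "\<forall>u\<in>carrier R. w \<otimes> u = u \<otimes> w" by auto
  then show ?thesis using w by blast
qed

definition word :: "'a list \<Rightarrow> 'a" where "word ws = foldr (\<otimes>) ws \<one>"

lemma word_simps [simp]: "word [] = \<one>" "word (x # ws) = x \<otimes> word ws"
  by (simp_all add: word_def)

lemma word_closed: "ws \<in> lists Y \<Longrightarrow> word ws \<in> carrier R"
  by (induction ws) (auto simp: Y_carrier)

text \<open>The strict bound makes \<open>words 0\<close> empty and lets \<open>wspan (length ws)\<close> below stand for everything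
  shorter than \<open>ws\<close>.\<close>

definition words :: "nat \<Rightarrow> 'a set" where "words m = {word ws | ws. ws \<in> lists Y \<and> length ws < m}"

lemma words_carrier: "words m \<subseteq> carrier R"
  unfolding words_def using word_closed by blast

context
  fixes Z assumes Z: "Z \<subseteq> carrier R" "\<And>z u. z \<in> Z \<Longrightarrow> u \<in> carrier R \<Longrightarrow> z \<otimes> u = u \<otimes> z"
begin

definition wspan :: "nat \<Rightarrow> 'a set" where "wspan m = stable_span reg (F \<union> Z) (words m)"

lemma wspan_stable: "stable reg (F \<union> Z) (wspan m)"
proof -
  interpret A: left_module R reg by (rule left_module_reg)
  show ?thesis unfolding wspan_def
    by (rule A.stable_stable_span) (use F_subset Z(1) words_carrier in simp_all)
qed

lemma wspan_stable_F: "stable reg F (wspan m)"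
  by (rule stable_mono[OF wspan_stable]) simp

lemma wspan_carrier: "x \<in> wspan m \<Longrightarrow> x \<in> carrier R"
  using stableD(1)[OF wspan_stable] by auto

lemma wspan_add: "\<lbrakk>x \<in> wspan m; y \<in> wspan m\<rbrakk> \<Longrightarrow> x \<oplus> y \<in> wspan m"
  using stableD(3)[OF wspan_stable] by simp

lemma wspan_zero: "\<zero> \<in> wspan m"
  using stableD(2)[OF wspan_stable] by simp

lemma wspan_word: "\<lbrakk>ws \<in> lists Y; length ws < m\<rbrakk> \<Longrightarrow> word ws \<in> wspan m"
  unfolding wspan_def by (rule stable_span.gen) (auto simp: words_def)

lemma wspan_mult:
  assumes v: "v \<in> V" and x: "x \<in> wspan m" shows "v \<otimes> x \<in> wspan (Suc m)"
proof -
  have Y: "y \<otimes> x \<in> wspan (Suc m)" if y: "y \<in> Y" for y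
    using x unfolding wspan_def[of m]
  proof induction
    case zero
    then show ?case using wspan_zero Y_carrier[OF y] by simp
  next
    case (gen x)
    then obtain ws where "x = word ws" "ws \<in> lists Y" "length ws < m" by (auto simp: words_def)
    then show ?case using wspan_word[of "y # ws" "Suc m"] y by simp
  next
    case (add x x')
    have "x \<in> carrier R" "x' \<in> carrier R" using add(1,2) wspan_carrier[of _ m] by (auto simp: wspan_def)
    then show ?case using wspan_add[OF add.IH] Y_carrier[OF y] by (simp add: r_distr)
  next
    case (smult c x)
    have c: "c \<in> carrier R" using smult(1) F_carrier Z(1) by auto
    have xc: "x \<in> carrier R" using smult(2) wspan_carrier[of _ m] by (auto simp: wspan_def)
    have "c \<otimes> y = y \<otimes> c" using smult(1) F_central[of c y] Z(2)[of c y] Y_carrier[OF y] by auto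
    then have "y \<otimes> (c \<otimes> x) = c \<otimes> (y \<otimes> x)"
      using m_assoc[of y c x] m_assoc[of c y x] Y_carrier[OF y] c xc by simp
    then show ?case using stableD(4)[OF wspan_stable smult(1) smult.IH] by simp
  qed
  have xc: "x \<in> carrier R" by (rule wspan_carrier[OF x])
  note st = stableD[OF wspan_stable_F[of "Suc m"]]
  have "stable reg F {v \<in> carrier R. v \<otimes> x \<in> wspan (Suc m)}"
  proof (rule stableI)
    show "c \<odot>\<^bsub>reg\<^esub> y \<in> {v \<in> carrier R. v \<otimes> x \<in> wspan (Suc m)}"
      if c: "c \<in> F" and y: "y \<in> {v \<in> carrier R. v \<otimes> x \<in> wspan (Suc m)}" for c y
      using st(4)[OF c, of "y \<otimes> x"] y F_carrier[OF c] xc by (simp add: m_assoc)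
  qed (use st xc in \<open>auto simp: l_distr\<close>)
  moreover have "Y \<subseteq> {v \<in> carrier R. v \<otimes> x \<in> wspan (Suc m)}" using Y Y_carrier by blast
  ultimately show ?thesis using stable_span_least V_span v by blast
qed

text \<open>Modulo shorter words, a letter can be moved to the front, because the commutators of letters are
  linear combinations of letters.\<close>

lemma move_to_front:
  assumes y: "y \<in> Y" and us: "us \<in> lists Y" and vs: "vs \<in> lists Y"
  shows "\<exists>r\<in>wspan (length us + length vs + 1). word (us @ y # vs) = y \<otimes> word (us @ vs) \<oplus> r"
  using us
proof (induction us)
  case Nil
  have "word vs \<in> carrier R" "y \<in> carrier R" using word_closed[OF vs] Y_carrier[OF y] by auto
  then show ?case using wspan_zero by (intro bexI[of _ \<zero>]) auto
next
  case (Cons x us)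
  obtain r where r: "r \<in> wspan (length us + length vs + 1)" "word (us @ y # vs) = y \<otimes> word (us @ vs) \<oplus> r"
    using Cons by auto
  let ?t = "word (us @ vs)"
  have c: "x \<in> carrier R" "y \<in> carrier R" "?t \<in> carrier R" "r \<in> carrier R"
    using Y_carrier Cons.hyps y wspan_carrier[OF r(1)] word_closed[of "us @ vs"] Cons vs by auto
  have xV: "ad x y \<in> V" "x \<in> V" using bracket Y_V Cons.hyps y by auto
  let ?r = "ad x y \<otimes> ?t \<oplus> x \<otimes> r"
  have "word ((x # us) @ y # vs) = (x \<otimes> y) \<otimes> ?t \<oplus> x \<otimes> r"
    using c by (simp add: r(2) r_distr m_assoc)
  also have "x \<otimes> y = ad x y \<oplus> y \<otimes> x" by (rule mult_eq_ad[OF c(1,2)])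
  also have "(ad x y \<oplus> y \<otimes> x) \<otimes> ?t \<oplus> x \<otimes> r = y \<otimes> (x \<otimes> ?t) \<oplus> ?r"
    using c ad_closed[OF c(1,2)] by (simp add: l_distr m_assoc a_ac)
  finally have "word ((x # us) @ y # vs) = y \<otimes> word ((x # us) @ vs) \<oplus> ?r" by simp
  moreover have "?t \<in> wspan (length us + length vs + 1)" using wspan_word[of "us @ vs"] Cons vs by auto
  then have "?r \<in> wspan (length (x # us) + length vs + 1)"
    using wspan_add[OF wspan_mult[OF xV(1)] wspan_mult[OF xV(2) r(1)]] by simp
  ultimately show ?case by blast
qed

lemma collect_power:
  assumes y: "y \<in> Y" and "ws \<in> lists Y" "d \<le> count_list ws y"
  shows "\<exists>rest\<in>lists Y. \<exists>r\<in>wspan (length ws). length rest + d = length ws \<and>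
    word ws = y [^] d \<otimes> word rest \<oplus> r"
  using assms(2,3)
proof (induction d arbitrary: ws)
  case 0
  show ?case using 0 word_closed[of ws] wspan_zero by (intro bexI[of _ ws] bexI[of _ \<zero>]) auto
next
  case (Suc d)
  have yc: "y \<in> carrier R" by (rule Y_carrier[OF y])
  have "y \<in> set ws" using Suc.prems(2) count_notin[of y ws] by (cases "y \<in> set ws") auto
  then obtain us vs where ws: "ws = us @ y # vs" by (meson split_list)
  have l: "us \<in> lists Y" "vs \<in> lists Y" "us @ vs \<in> lists Y" using Suc.prems(1) ws by auto
  obtain r where r: "r \<in> wspan (length ws)" "word ws = y \<otimes> word (us @ vs) \<oplus> r"
    using move_to_front[OF y l(1,2)] ws by auto
  have "d \<le> count_list (us @ vs) y" using Suc.prems(2) ws by simp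
  then obtain rest s where s: "rest \<in> lists Y" "s \<in> wspan (length (us @ vs))"
      "length rest + d = length (us @ vs)" "word (us @ vs) = y [^] d \<otimes> word rest \<oplus> s"
    using Suc.IH[OF l(3)] by blast
  have c: "s \<in> carrier R" "r \<in> carrier R" "word rest \<in> carrier R"
    using wspan_carrier s r word_closed by auto
  have "word ws = (y \<otimes> y [^] d) \<otimes> word rest \<oplus> (y \<otimes> s \<oplus> r)"
    using c yc by (simp add: r(2) s(4) r_distr m_assoc a_assoc)
  then have "word ws = y [^] Suc d \<otimes> word rest \<oplus> (y \<otimes> s \<oplus> r)"
    using nat_pow_Suc2[OF yc, of d] by simp
  moreover have "y \<otimes> s \<in> wspan (length ws)" using wspan_mult[of y s] Y_V y s(2) ws by auto
  then have "y \<otimes> s \<oplus> r \<in> wspan (length ws)" using r(1) wspan_add by blast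
  ultimately show ?case using s ws by (intro bexI[of _ rest] bexI[of _ "y \<otimes> s \<oplus> r"]) auto
qed

lemma polys_wspan:
  assumes y: "y \<in> Y" and rest: "rest \<in> lists Y" and "q \<in> polys y d"
  shows "q \<otimes> word rest \<in> wspan (length rest + d)"
proof -
  have yc: "y \<in> carrier R" by (rule Y_carrier[OF y])
  have rc: "word rest \<in> carrier R" by (rule word_closed[OF rest])
  note st = stableD[OF wspan_stable_F[of "length rest + d"]]
  have "stable reg F {u \<in> carrier R. u \<otimes> word rest \<in> wspan (length rest + d)}" (is "stable _ _ ?P")
  proof (rule stableI)
    show "c \<odot>\<^bsub>reg\<^esub> x \<in> ?P" if c: "c \<in> F" and x: "x \<in> ?P" for c x
      using st(4)[OF c, of "x \<otimes> word rest"] x F_carrier[OF c] rc by (simp add: m_assoc)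
  qed (use st rc in \<open>auto simp: l_distr\<close>)
  moreover have "y [^] i \<in> ?P" if "i < d" for i :: nat
  proof -
    have "y [^] i \<otimes> word rest = word (replicate i y @ rest)"
    proof (induction i)
      case 0
      then show ?case using rc by simp
    next
      case (Suc i)
      have "y [^] Suc i \<otimes> word rest = y \<otimes> (y [^] i \<otimes> word rest)"
        using nat_pow_Suc2[OF yc, of i] yc rc by (simp add: m_assoc del: nat_pow_Suc)
      then show ?case using Suc by simp
    qed
    moreover have "replicate i y @ rest \<in> lists Y" using rest y by (auto simp: in_lists_conv_set)
    then have "word (replicate i y @ rest) \<in> wspan (length rest + d)"
      using that by (intro wspan_word) auto
    ultimately show ?thesis using yc by simp
  qed
  ultimately have "polys y d \<subseteq> ?P" unfolding polys_def by (rule combs_subset)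
  then show ?thesis using assms(3) by blast
qed

text \<open>A long word contains some letter \<open>y\<close> at least \<open>d y\<close> times. Modulo shorter words it then contains
  the power of \<open>y\<close> with exponent \<open>d y\<close>, which is the central element \<open>w y\<close> up to lower powers.\<close>

lemma carrier_eq_wspan:
  assumes w: "\<And>y. y \<in> Y \<Longrightarrow> d y > 0 \<and> w y \<in> monics y (d y) \<and> w y \<in> Z"
  shows "wspan (Suc (\<Sum>y\<in>Y. d y)) = carrier R" (is "wspan ?D = _")
proof
  have long: "word ws \<in> wspan (length ws)" if ws: "ws \<in> lists Y" and len: "length ws \<ge> ?D" for ws
  proof -
    have "\<exists>y\<in>Y. d y \<le> count_list ws y"
    proof (rule ccontr)
      assume "\<not> ?thesis"
      then have "count_list ws y \<le> d y" if "y \<in> Y" for y using that by force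
      then have "(\<Sum>y\<in>Y. count_list ws y) \<le> (\<Sum>y\<in>Y. d y)" by (rule sum_mono)
      moreover have "(\<Sum>y\<in>Y. count_list ws y) = length ws"
        using ws Y_finite by (intro sum_count_set) auto
      ultimately show False using len by simp
    qed
    then obtain y where y: "y \<in> Y" "d y \<le> count_list ws y" by blast
    obtain rest r where r: "rest \<in> lists Y" "r \<in> wspan (length ws)" "length rest + d y = length ws"
      "word ws = y [^] d y \<otimes> word rest \<oplus> r"
      using collect_power[OF y(1) ws y(2)] by blast
    obtain q where q: "w y = y [^] d y \<oplus> q" "q \<in> polys y (d y)" using w[OF y(1)] by (auto simp: monics_def)
    have yc: "y \<in> carrier R" by (rule Y_carrier[OF y(1)])
    have c: "q \<in> carrier R" "word rest \<in> carrier R" "w y \<in> carrier R" "y [^] d y \<in> carrier R"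
      using polys_carrier[OF yc q(2)] word_closed[OF r(1)] w[OF y(1)] Z(1) yc by auto
    have "y [^] d y = w y \<oplus> \<ominus> q" using c by (simp add: q(1) a_assoc r_neg)
    then have "y [^] d y \<otimes> word rest = w y \<otimes> word rest \<oplus> (\<ominus> q) \<otimes> word rest" using c by (simp add: l_distr)
    moreover have "word rest \<in> wspan (length ws)" using wspan_word[OF r(1)] r(3) w[OF y(1)] by simp
    then have "w y \<otimes> word rest \<in> wspan (length ws)"
      using stableD(4)[OF wspan_stable, of "w y"] w[OF y(1)] by simp
    moreover have "\<ominus> q \<in> polys y (d y)"
    proof -
      have "\<ominus> \<one> \<otimes> q \<in> polys y (d y)" using stableD(4)[OF polys_stable[OF yc] F_neg_one q(2)] by simp
      then show ?thesis using c by (simp add: l_minus)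
    qed
    then have "(\<ominus> q) \<otimes> word rest \<in> wspan (length ws)" using polys_wspan[OF y(1) r(1)] r(3) by metis
    ultimately show ?thesis unfolding r(4) using r(2) wspan_add by simp
  qed
  have "wspan (Suc m) \<subseteq> wspan m" if m: "m \<ge> ?D" for m
    unfolding wspan_def[of "Suc m"]
  proof (rule stable_span_least[OF wspan_stable])
    show "words (Suc m) \<subseteq> wspan m"
    proof
      fix x assume "x \<in> words (Suc m)"
      then obtain ws where ws: "x = word ws" "ws \<in> lists Y" "length ws < Suc m" by (auto simp: words_def)
      show "x \<in> wspan m"
      proof (cases "length ws = m")
        case True
        then show ?thesis using long[OF ws(2)] ws(1) m by simp
      next
        case False
        then show ?thesis using wspan_word[OF ws(2), of m] ws by simp
      qed
    qed
  qed
  then have D: "wspan (Suc ?D) \<subseteq> wspan ?D" by blast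
  show "carrier R \<subseteq> wspan ?D"
  proof (rule generated[OF wspan_stable_F])
    show "\<one> \<in> wspan ?D" using wspan_word[of "[]" ?D] by simp
    show "v \<otimes> x \<in> wspan ?D" if "v \<in> V" "x \<in> wspan ?D" for v x
      using wspan_mult[OF that] D by blast
  qed
  show "wspan ?D \<subseteq> carrier R" using wspan_carrier by blast
qed

end

lemma words_finite: "finite (words m)"
proof -
  have "finite {ws. set ws \<subseteq> Y \<and> length ws \<le> m}" by (rule finite_lists_length_le[OF Y_finite])
  moreover have "words m \<subseteq> word ` {ws. set ws \<subseteq> Y \<and> length ws \<le> m}" by (force simp: words_def)
  ultimately show ?thesis using finite_surj by blast
qed

theorem finite_over_center:
  "\<exists>Z B. finite Z \<and> Z \<subseteq> carrier R \<and> (\<forall>z\<in>Z. \<forall>u\<in>carrier R. z \<otimes> u = u \<otimes> z) \<and>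
     finite B \<and> B \<subseteq> carrier R \<and> stable_span reg (F \<union> Z) B = carrier R"
proof -
  have "\<forall>y\<in>Y. \<exists>dw. fst dw > 0 \<and> snd dw \<in> monics y (fst dw) \<and> (\<forall>u\<in>carrier R. snd dw \<otimes> u = u \<otimes> snd dw)"
    using monic_central Y_V by fastforce
  then obtain dw where dw': "\<forall>y\<in>Y. fst (dw y) > 0 \<and> snd (dw y) \<in> monics y (fst (dw y)) \<and>
      (\<forall>u\<in>carrier R. snd (dw y) \<otimes> u = u \<otimes> snd (dw y))"
    by (rule bchoice[THEN exE])
  note dw = dw'[rule_format]
  let ?Z = "(\<lambda>y. snd (dw y)) ` Y"
  have Z: "?Z \<subseteq> carrier R" using dw' monics_carrier Y_carrier by blast
  have Zc: "z \<otimes> u = u \<otimes> z" if "z \<in> ?Z" "u \<in> carrier R" for z u using that dw' by blast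
  define m where "m = Suc (\<Sum>y\<in>Y. fst (dw y))"
  have "stable_span reg (F \<union> ?Z) (words m) = carrier R"
    using carrier_eq_wspan[OF Z Zc, of "\<lambda>y. fst (dw y)" "\<lambda>y. snd (dw y)"] dw'
    by (simp add: wspan_def[OF Z Zc] m_def)
  moreover have "words m \<subseteq> carrier R" by (rule words_carrier)
  ultimately show ?thesis
    by (intro exI[of _ ?Z] exI[of _ "words m"] conjI ballI finite_imageI Y_finite words_finite Z Zc)
qed

end

section \<open>The free algebra\<close>

context cring
begin

definition conv :: "('x list \<Rightarrow> 'a) \<Rightarrow> ('x list \<Rightarrow> 'a) \<Rightarrow> 'x list \<Rightarrow> 'a" where
  "conv f g w = (\<Oplus>i\<in>{..length w}. f (take i w) \<otimes> g (drop i w))"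

lemma conv_Nil: "\<lbrakk>range f \<subseteq> carrier R; range g \<subseteq> carrier R\<rbrakk> \<Longrightarrow> conv f g [] = f [] \<otimes> g []"
  by (simp add: conv_def range_subsetD)

lemma conv_Cons:
  assumes "range f \<subseteq> carrier R" "range g \<subseteq> carrier R"
  shows "conv f g (x # w) = conv (\<lambda>v. f (x # v)) g w \<oplus> f [] \<otimes> g (x # w)"
  unfolding conv_def using assms by (simp del: finsum_Suc add: finsum_Suc2 range_subsetD Pi_def)

lemma conv_closed: "\<lbrakk>range f \<subseteq> carrier R; range g \<subseteq> carrier R\<rbrakk> \<Longrightarrow> conv f g w \<in> carrier R"
  unfolding conv_def by (rule finsum_closed) (auto simp: range_subsetD)

lemma conv_range: "\<lbrakk>range f \<subseteq> carrier R; range g \<subseteq> carrier R\<rbrakk> \<Longrightarrow> range (conv f g) \<subseteq> carrier R"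
  using conv_closed by blast

lemma range_Cons: "range f \<subseteq> carrier R \<Longrightarrow> range (\<lambda>v. f (x # v)) \<subseteq> carrier R"
  by blast

lemma conv_add_left:
  assumes "range f \<subseteq> carrier R" "range g \<subseteq> carrier R" "range h \<subseteq> carrier R"
  shows "conv (\<lambda>v. f v \<oplus> g v) h w = conv f h w \<oplus> conv g h w"
  unfolding conv_def using assms
  by (subst finsum_addf[symmetric]) (auto simp: range_subsetD l_distr intro!: finsum_cong')

lemma conv_add_right:
  assumes "range f \<subseteq> carrier R" "range g \<subseteq> carrier R" "range h \<subseteq> carrier R"
  shows "conv h (\<lambda>v. f v \<oplus> g v) w = conv h f w \<oplus> conv h g w"
  unfolding conv_def using assms
  by (subst finsum_addf[symmetric]) (auto simp: range_subsetD r_distr intro!: finsum_cong')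

lemma conv_smult_left:
  assumes "c \<in> carrier R" "range f \<subseteq> carrier R" "range g \<subseteq> carrier R"
  shows "conv (\<lambda>v. c \<otimes> f v) g w = c \<otimes> conv f g w"
  unfolding conv_def using assms
  by (subst finsum_rdistr) (auto simp: range_subsetD m_assoc intro!: finsum_cong')

text \<open>Splitting off the first letter turns associativity into an induction on the word.\<close>

lemma conv_assoc:
  assumes "range f \<subseteq> carrier R" and g: "range g \<subseteq> carrier R" and h: "range h \<subseteq> carrier R"
  shows "conv (conv f g) h w = conv f (conv g h) w"
  using assms(1)
proof (induction w arbitrary: f)
  case Nil
  then show ?case using g h by (simp add: conv_Nil conv_range range_subsetD m_assoc)
next
  case (Cons x w)
  note f = Cons.prems
  let ?f = "\<lambda>v. f (x # v)" and ?g = "\<lambda>v. g (x # v)"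
  note r = range_Cons[OF f, of x] range_Cons[OF g, of x]
  have f0: "f [] \<in> carrier R" and g0: "g [] \<in> carrier R" and hx: "h (x # w) \<in> carrier R"
    using f g h by (auto simp: range_subsetD)
  have "(\<lambda>v. conv f g (x # v)) = (\<lambda>v. conv ?f g v \<oplus> f [] \<otimes> ?g v)"
    using f g by (simp add: conv_Cons)
  moreover have "range (\<lambda>v. f [] \<otimes> ?g v) \<subseteq> carrier R" using f0 g by (auto simp: range_subsetD)
  ultimately have "conv (\<lambda>v. conv f g (x # v)) h w = conv (conv ?f g) h w \<oplus> f [] \<otimes> conv ?g h w"
    using conv_add_left[OF conv_range[OF r(1) g] _ h] conv_smult_left[OF f0 r(2) h] by simp
  then have "conv (conv f g) h (x # w) =
      (conv (conv ?f g) h w \<oplus> f [] \<otimes> conv ?g h w) \<oplus> (f [] \<otimes> g []) \<otimes> h (x # w)"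
    using f g h by (simp add: conv_Cons[OF conv_range[OF f g] h] conv_Nil)
  also have "\<dots> = conv ?f (conv g h) w \<oplus> f [] \<otimes> (conv ?g h w \<oplus> g [] \<otimes> h (x # w))"
    using Cons.IH[OF r(1)] conv_closed[OF r(1) conv_range[OF g h]] conv_closed[OF r(2) h] f0 g0 hx
    by (simp add: r_distr m_assoc a_assoc)
  also have "\<dots> = conv f (conv g h) (x # w)"
    using f g h by (simp add: conv_Cons conv_range)
  finally show ?case .
qed

lemma conv_zero_left: "range g \<subseteq> carrier R \<Longrightarrow> conv (\<lambda>v. \<zero>) g w = \<zero>"
  unfolding conv_def by (simp add: range_subsetD)

lemma conv_scalar_left:
  assumes c: "c \<in> carrier R" and g: "range g \<subseteq> carrier R"
  shows "conv (\<lambda>v :: 'x list. if v = [] then c else \<zero>) g w = c \<otimes> g w"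
proof -
  have r: "range (\<lambda>v :: 'x list. if v = [] then c else \<zero>) \<subseteq> carrier R" using c by auto
  have g': "g v \<in> carrier R" for v using g by auto
  show ?thesis
    by (cases w) (simp_all add: conv_Nil[OF r g] conv_Cons[OF r g] conv_zero_left[OF g] c g')
qed

lemma conv_scalar_right:
  assumes c: "c \<in> carrier R" and "range f \<subseteq> carrier R"
  shows "conv f (\<lambda>v. if v = [] then c else \<zero>) w = f w \<otimes> c"
  using assms(2)
proof (induction w arbitrary: f)
  case Nil
  then show ?case using c by (subst conv_Nil) (auto simp: image_subset_iff)
next
  case (Cons x w)
  then show ?case using c Cons.IH[OF range_Cons[OF Cons.prems, of x]]
    by (subst conv_Cons) (auto simp: image_subset_iff)
qed

lemma conv_gen_left:
  assumes g: "range g \<subseteq> carrier R"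
  shows "conv (free_gen R x) g w = (if w \<noteq> [] \<and> hd w = x then g (tl w) else \<zero>)"
proof (cases w)
  case Nil
  then show ?thesis using g by (subst Nil, subst conv_Nil) (auto simp: free_gen_def image_subset_iff)
next
  case (Cons y v)
  have eq: "(\<lambda>v. free_gen R x (y # v)) = (\<lambda>v. if v = [] then if y = x then \<one> else \<zero> else \<zero>)"
    by (auto simp: free_gen_def fun_eq_iff)
  have "conv (free_gen R x) g (y # v) = conv (\<lambda>v. free_gen R x (y # v)) g v \<oplus> free_gen R x [] \<otimes> g (y # v)"
    by (rule conv_Cons) (use g in \<open>auto simp: free_gen_def\<close>)
  also have "\<dots> = (if y = x then g v else \<zero>)"
    unfolding eq using g by (simp add: conv_scalar_left free_gen_def image_subset_iff)
  finally show ?thesis by (simp add: Cons)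
qed

lemma free_algebra_simps:
  "carrier (free_algebra R G) =
     {f. range f \<subseteq> carrier R \<and> finite {w. f w \<noteq> \<zero>} \<and> {w. f w \<noteq> \<zero>} \<subseteq> lists G}"
  "monoid.mult (free_algebra R G) = conv"
  "one (free_algebra R G) = (\<lambda>w. if w = [] then \<one> else \<zero>)"
  "zero (free_algebra R G) = (\<lambda>w. \<zero>)"
  "add (free_algebra R G) = (\<lambda>f g w. f w \<oplus> g w)"
  "smult (free_algebra R G) = (\<lambda>c f w. c \<otimes> f w)"
  by (simp_all add: free_algebra_def conv_def fun_eq_iff)

lemma free_algebraD:
  assumes "f \<in> carrier (free_algebra R G)"
  shows "range f \<subseteq> carrier R" "f w \<in> carrier R" "finite {w. f w \<noteq> \<zero>}" "{w. f w \<noteq> \<zero>} \<subseteq> lists G"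
  using assms by (auto simp: free_algebra_simps)

lemma free_algebraI:
  assumes "\<And>w. f w \<in> carrier R" "finite S" "S \<subseteq> lists G" "\<And>w. w \<notin> S \<Longrightarrow> f w = \<zero>"
  shows "f \<in> carrier (free_algebra R G)"
proof -
  have "{w. f w \<noteq> \<zero>} \<subseteq> S" using assms(4) by blast
  then show ?thesis using assms finite_subset by (auto simp: free_algebra_simps)
qed

lemma conv_support:
  assumes "conv f g w \<noteq> \<zero>" "range f \<subseteq> carrier R" "range g \<subseteq> carrier R"
  shows "\<exists>u v. w = u @ v \<and> f u \<noteq> \<zero> \<and> g v \<noteq> \<zero>"
proof (rule ccontr)
  assume n: "\<not> ?thesis"
  have "f (take i w) \<otimes> g (drop i w) = \<zero>" for i
  proof -
    have "f (take i w) = \<zero> \<or> g (drop i w) = \<zero>" using n by (metis append_take_drop_id)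
    then show ?thesis using assms(2,3) by (auto simp: range_subsetD)
  qed
  then have "conv f g w = \<zero>" unfolding conv_def by simp
  then show False using assms(1) by simp
qed

lemma free_algebra_ring: "ring (free_algebra R G)"
proof -
  let ?T = "free_algebra R G"
  note S = free_algebra_simps
  have add: "(\<lambda>w. f w \<oplus> g w) \<in> carrier ?T" if f: "f \<in> carrier ?T" and g: "g \<in> carrier ?T" for f g
    by (rule free_algebraI[where S = "{w. f w \<noteq> \<zero>} \<union> {w. g w \<noteq> \<zero>}"])
       (use free_algebraD[OF f] free_algebraD[OF g] in auto)
  have mult: "conv f g \<in> carrier ?T" if f: "f \<in> carrier ?T" and g: "g \<in> carrier ?T" for f g
  proof (rule free_algebraI[where S = "{u @ v | u v. f u \<noteq> \<zero> \<and> g v \<noteq> \<zero>}"])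
    show "conv f g w \<in> carrier R" for w
      by (rule conv_closed[OF free_algebraD(1)[OF f] free_algebraD(1)[OF g]])
    show "conv f g w = \<zero>" if "w \<notin> {u @ v | u v. f u \<noteq> \<zero> \<and> g v \<noteq> \<zero>}" for w
      using that conv_support[OF _ free_algebraD(1)[OF f] free_algebraD(1)[OF g], of w] by blast
    show "{u @ v | u v. f u \<noteq> \<zero> \<and> g v \<noteq> \<zero>} \<subseteq> lists G"
    proof
      fix w assume "w \<in> {u @ v | u v. f u \<noteq> \<zero> \<and> g v \<noteq> \<zero>}"
      then obtain u v where w: "w = u @ v" "f u \<noteq> \<zero>" "g v \<noteq> \<zero>" by blast
      then have "u \<in> lists G" "v \<in> lists G" using free_algebraD(4)[OF f] free_algebraD(4)[OF g] by blast+
      then show "w \<in> lists G" by (simp add: w(1))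
    qed
    show "finite {u @ v | u v. f u \<noteq> \<zero> \<and> g v \<noteq> \<zero>}"
      by (rule finite_image_set2[OF free_algebraD(3)[OF f] free_algebraD(3)[OF g]])
  qed
  have zero: "(\<lambda>w. \<zero>) \<in> carrier ?T" by (rule free_algebraI[where S = "{}"]) auto
  have one: "(\<lambda>w. if w = [] then \<one> else \<zero>) \<in> carrier ?T" by (rule free_algebraI[where S = "{[]}"]) auto
  have minus: "(\<lambda>w. \<ominus> f w) \<in> carrier ?T" if f: "f \<in> carrier ?T" for f
    by (rule free_algebraI[where S = "{w. f w \<noteq> \<zero>}"]) (use free_algebraD[OF f] in auto)
  have ag: "abelian_group ?T"
  proof (rule abelian_groupI)
    fix f assume f: "f \<in> carrier ?T"
    show "\<exists>g\<in>carrier ?T. g \<oplus>\<^bsub>?T\<^esub> f = \<zero>\<^bsub>?T\<^esub>"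
      using minus[OF f] free_algebraD(2)[OF f] by (intro bexI[of _ "\<lambda>w. \<ominus> f w"]) (auto simp: S(4,5) l_neg)
  qed (use free_algebraD(2)[of _ G] add zero in \<open>auto simp: S(4,5) a_ac\<close>)
  have mon: "monoid ?T"
  proof (rule monoidI)
    show "f \<otimes>\<^bsub>?T\<^esub> g \<otimes>\<^bsub>?T\<^esub> h = f \<otimes>\<^bsub>?T\<^esub> (g \<otimes>\<^bsub>?T\<^esub> h)"
      if f: "f \<in> carrier ?T" and g: "g \<in> carrier ?T" and h: "h \<in> carrier ?T" for f g h
      unfolding S(2)
      by (rule ext) (rule conv_assoc[OF free_algebraD(1)[OF f] free_algebraD(1)[OF g] free_algebraD(1)[OF h]])
    show "\<one>\<^bsub>?T\<^esub> \<otimes>\<^bsub>?T\<^esub> f = f" if f: "f \<in> carrier ?T" for f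
      unfolding S(2,3) using free_algebraD(1,2)[OF f] by (simp add: conv_scalar_left fun_eq_iff)
    show "f \<otimes>\<^bsub>?T\<^esub> \<one>\<^bsub>?T\<^esub> = f" if f: "f \<in> carrier ?T" for f
      unfolding S(2,3) using free_algebraD(1,2)[OF f] by (simp add: conv_scalar_right fun_eq_iff)
  qed (use mult one in \<open>simp_all add: S(2,3)\<close>)
  show ?thesis
  proof (rule ringI[OF ag mon])
    fix f g h assume f: "f \<in> carrier ?T" and g: "g \<in> carrier ?T" and h: "h \<in> carrier ?T"
    note r = free_algebraD(1)[OF f] free_algebraD(1)[OF g] free_algebraD(1)[OF h]
    show "(f \<oplus>\<^bsub>?T\<^esub> g) \<otimes>\<^bsub>?T\<^esub> h = f \<otimes>\<^bsub>?T\<^esub> h \<oplus>\<^bsub>?T\<^esub> g \<otimes>\<^bsub>?T\<^esub> h"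
      unfolding S(2,5) by (rule ext) (rule conv_add_left[OF r])
    show "h \<otimes>\<^bsub>?T\<^esub> (f \<oplus>\<^bsub>?T\<^esub> g) = h \<otimes>\<^bsub>?T\<^esub> f \<oplus>\<^bsub>?T\<^esub> h \<otimes>\<^bsub>?T\<^esub> g"
      unfolding S(2,5) by (rule ext) (rule conv_add_right[OF r])
  qed
qed

end

section \<open>The enveloping algebra\<close>

context lie_algebra
begin

abbreviation T where "T \<equiv> free_algebra K (carrier L)"
abbreviation J where "J \<equiv> Idl\<^bsub>T\<^esub> (uea_relations K L br)"
abbreviation U where "U \<equiv> uea K L br"

sublocale T: ring T by (rule free_algebra_ring)

lemma gen_T: "x \<in> carrier L \<Longrightarrow> free_gen K x \<in> carrier T"
  by (rule free_algebraI[where S = "{[x]}"]) (auto simp: free_gen_def)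

lemma smult_T: assumes c: "c \<in> carrier K" and f: "f \<in> carrier T" shows "c \<odot>\<^bsub>T\<^esub> f \<in> carrier T"
proof -
  note D = free_algebraD[OF f]
  show ?thesis unfolding free_algebra_simps(6)
    by (rule free_algebraI[where S = "{w. f w \<noteq> \<zero>}"]) (use c D in auto)
qed

lemma scalar_T: "c \<odot>\<^bsub>T\<^esub> \<one>\<^bsub>T\<^esub> = (\<lambda>w. if w = [] then c else \<zero>)" if "c \<in> carrier K"
  using that by (auto simp: free_algebra_simps fun_eq_iff)

lemma scalar_mult_T:
  assumes c: "c \<in> carrier K" and f: "f \<in> carrier T"
  shows "(c \<odot>\<^bsub>T\<^esub> \<one>\<^bsub>T\<^esub>) \<otimes>\<^bsub>T\<^esub> f = c \<odot>\<^bsub>T\<^esub> f" "f \<otimes>\<^bsub>T\<^esub> (c \<odot>\<^bsub>T\<^esub> \<one>\<^bsub>T\<^esub>) = c \<odot>\<^bsub>T\<^esub> f"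
proof -
  note D = free_algebraD[OF f]
  show "(c \<odot>\<^bsub>T\<^esub> \<one>\<^bsub>T\<^esub>) \<otimes>\<^bsub>T\<^esub> f = c \<odot>\<^bsub>T\<^esub> f"
    unfolding scalar_T[OF c] unfolding free_algebra_simps(2,6) by (rule ext) (rule conv_scalar_left[OF c D(1)])
  show "f \<otimes>\<^bsub>T\<^esub> (c \<odot>\<^bsub>T\<^esub> \<one>\<^bsub>T\<^esub>) = c \<odot>\<^bsub>T\<^esub> f"
    unfolding scalar_T[OF c] unfolding free_algebra_simps(2,6)
    by (rule ext) (use conv_scalar_right[OF c D(1)] D(2) c m_comm in simp)
qed

lemma relations_T: "uea_relations K L br \<subseteq> carrier T"
  unfolding uea_relations_def Let_def
  using gen_T smult_T br_closed by auto

lemma relationsI: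
  "\<lbrakk>x \<in> carrier L; y \<in> carrier L\<rbrakk> \<Longrightarrow>
    free_gen K (x \<oplus>\<^bsub>L\<^esub> y) \<ominus>\<^bsub>T\<^esub> (free_gen K x \<oplus>\<^bsub>T\<^esub> free_gen K y) \<in> uea_relations K L br"
  "\<lbrakk>c \<in> carrier K; x \<in> carrier L\<rbrakk> \<Longrightarrow>
    free_gen K (c \<odot>\<^bsub>L\<^esub> x) \<ominus>\<^bsub>T\<^esub> (c \<odot>\<^bsub>T\<^esub> free_gen K x) \<in> uea_relations K L br"
  "\<lbrakk>x \<in> carrier L; y \<in> carrier L\<rbrakk> \<Longrightarrow>
    (free_gen K x \<otimes>\<^bsub>T\<^esub> free_gen K y \<ominus>\<^bsub>T\<^esub> free_gen K y \<otimes>\<^bsub>T\<^esub> free_gen K x) \<ominus>\<^bsub>T\<^esub> free_gen K (br x y)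
      \<in> uea_relations K L br"
  unfolding uea_relations_def Let_def by blast+

sublocale J: ideal J T by (rule T.genideal_ideal[OF relations_T])

sublocale Q: ring "T Quot J" by (rule J.quotient_is_ring)

definition proj :: "('l list \<Rightarrow> 'k) \<Rightarrow> ('l list \<Rightarrow> 'k) set" where "proj f = J +>\<^bsub>T\<^esub> f"

lemma uea_simps:
  "carrier U = carrier (T Quot J)" "monoid.mult U = monoid.mult (T Quot J)"
  "one U = one (T Quot J)" "zero U = zero (T Quot J)" "add U = add (T Quot J)"
  "smult U = (\<lambda>c u. proj (c \<odot>\<^bsub>T\<^esub> \<one>\<^bsub>T\<^esub>) \<otimes>\<^bsub>T Quot J\<^esub> u)"
  by (simp_all add: uea_def Let_def proj_def)

sublocale U: ring U
proof -
  have "abelian_group U" by (rule Q.abelian_group_cong) (simp_all add: uea_simps)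
  moreover have "monoid U" by (rule monoidI) (simp_all add: uea_simps Q.m_assoc)
  ultimately show "ring U" by (rule ringI) (simp_all add: uea_simps Q.l_distr Q.r_distr)
qed

lemma proj_hom: "proj \<in> ring_hom T (T Quot J)"
  unfolding proj_def by (rule J.rcos_ring_hom)

lemma proj_closed: "f \<in> carrier T \<Longrightarrow> proj f \<in> carrier U"
  and proj_add: "\<lbrakk>f \<in> carrier T; g \<in> carrier T\<rbrakk> \<Longrightarrow> proj (f \<oplus>\<^bsub>T\<^esub> g) = proj f \<oplus>\<^bsub>U\<^esub> proj g"
  and proj_mult: "\<lbrakk>f \<in> carrier T; g \<in> carrier T\<rbrakk> \<Longrightarrow> proj (f \<otimes>\<^bsub>T\<^esub> g) = proj f \<otimes>\<^bsub>U\<^esub> proj g"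
  and proj_one: "proj \<one>\<^bsub>T\<^esub> = \<one>\<^bsub>U\<^esub>"
  using proj_hom unfolding uea_simps
  by (auto simp: ring_hom_closed ring_hom_add ring_hom_mult ring_hom_one)

lemma proj_surj: "u \<in> carrier U \<Longrightarrow> \<exists>f\<in>carrier T. u = proj f"
  by (auto simp: uea_simps FactRing_def A_RCOSETS_def' proj_def)

lemma proj_eqI:
  assumes "f \<ominus>\<^bsub>T\<^esub> g \<in> uea_relations K L br" "f \<in> carrier T" "g \<in> carrier T" shows "proj f = proj g"
  using T.quotient_eq_iff_same_a_r_cos[OF J.ideal_axioms assms(2,3)] T.genideal_self[OF relations_T] assms(1)
  unfolding proj_def by blast

lemma smult_U: "c \<in> carrier K \<Longrightarrow> c \<odot>\<^bsub>U\<^esub> u = proj (c \<odot>\<^bsub>T\<^esub> \<one>\<^bsub>T\<^esub>) \<otimes>\<^bsub>U\<^esub> u"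
  by (simp add: uea_simps)

lemma scalar_U: "c \<in> carrier K \<Longrightarrow> c \<odot>\<^bsub>U\<^esub> \<one>\<^bsub>U\<^esub> = proj (c \<odot>\<^bsub>T\<^esub> \<one>\<^bsub>T\<^esub>)"
  by (simp add: smult_U proj_closed smult_T)

lemma central_algebra_uea: "central_algebra K U"
proof (intro central_algebra.intro central_algebra_axioms.intro field_axioms U.ring_axioms)
  fix c assume c: "c \<in> carrier K"
  show "c \<odot>\<^bsub>U\<^esub> \<one>\<^bsub>U\<^esub> \<in> carrier U" using c by (simp add: scalar_U proj_closed smult_T)
  fix u assume u: "u \<in> carrier U"
  show "c \<odot>\<^bsub>U\<^esub> u = (c \<odot>\<^bsub>U\<^esub> \<one>\<^bsub>U\<^esub>) \<otimes>\<^bsub>U\<^esub> u" using c by (simp add: scalar_U) (simp add: smult_U)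
  obtain f where f: "f \<in> carrier T" "u = proj f" using proj_surj[OF u] by blast
  show "(c \<odot>\<^bsub>U\<^esub> \<one>\<^bsub>U\<^esub>) \<otimes>\<^bsub>U\<^esub> u = u \<otimes>\<^bsub>U\<^esub> (c \<odot>\<^bsub>U\<^esub> \<one>\<^bsub>U\<^esub>)"
    using c f by (simp add: scalar_U proj_mult[symmetric] smult_T scalar_mult_T)
next
  note one = T.one_closed
  fix c d assume c: "c \<in> carrier K" and d: "d \<in> carrier K"
  have "(c \<oplus> d) \<odot>\<^bsub>T\<^esub> \<one>\<^bsub>T\<^esub> = c \<odot>\<^bsub>T\<^esub> \<one>\<^bsub>T\<^esub> \<oplus>\<^bsub>T\<^esub> d \<odot>\<^bsub>T\<^esub> \<one>\<^bsub>T\<^esub>"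
    using c d by (auto simp: free_algebra_simps fun_eq_iff)
  then show "(c \<oplus> d) \<odot>\<^bsub>U\<^esub> \<one>\<^bsub>U\<^esub> = c \<odot>\<^bsub>U\<^esub> \<one>\<^bsub>U\<^esub> \<oplus>\<^bsub>U\<^esub> d \<odot>\<^bsub>U\<^esub> \<one>\<^bsub>U\<^esub>"
    using c d by (simp add: scalar_U proj_add smult_T)
  have "(c \<otimes> d) \<odot>\<^bsub>T\<^esub> \<one>\<^bsub>T\<^esub> = c \<odot>\<^bsub>T\<^esub> (d \<odot>\<^bsub>T\<^esub> \<one>\<^bsub>T\<^esub>)"
    using c d by (auto simp: free_algebra_simps fun_eq_iff)
  then show "(c \<otimes> d) \<odot>\<^bsub>U\<^esub> \<one>\<^bsub>U\<^esub> = (c \<odot>\<^bsub>U\<^esub> \<one>\<^bsub>U\<^esub>) \<otimes>\<^bsub>U\<^esub> (d \<odot>\<^bsub>U\<^esub> \<one>\<^bsub>U\<^esub>)"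
    using proj_mult[OF smult_T[OF c one] smult_T[OF d one]] scalar_mult_T(1)[OF c smult_T[OF d one]] c d
    by (simp add: scalar_U)
next
  have "\<one> \<odot>\<^bsub>T\<^esub> \<one>\<^bsub>T\<^esub> = \<one>\<^bsub>T\<^esub>" by (auto simp: free_algebra_simps fun_eq_iff)
  then show "\<one> \<odot>\<^bsub>U\<^esub> \<one>\<^bsub>U\<^esub> = \<one>\<^bsub>U\<^esub>" by (simp add: scalar_U proj_one)
qed

sublocale U: central_algebra K U by (rule central_algebra_uea)

text \<open>The canonical map of the Lie algebra to its enveloping algebra.\<close>

definition lie_emb :: "'l \<Rightarrow> ('l list \<Rightarrow> 'k) set" where "lie_emb x = proj (free_gen K x)"

lemma lie_emb_closed: "x \<in> carrier L \<Longrightarrow> lie_emb x \<in> carrier U"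
  by (simp add: lie_emb_def proj_closed gen_T)

lemma lie_emb_add:
  assumes "x \<in> carrier L" "y \<in> carrier L" shows "lie_emb (x \<oplus>\<^bsub>L\<^esub> y) = lie_emb x \<oplus>\<^bsub>U\<^esub> lie_emb y"
proof -
  have "proj (free_gen K (x \<oplus>\<^bsub>L\<^esub> y)) = proj (free_gen K x \<oplus>\<^bsub>T\<^esub> free_gen K y)"
    by (rule proj_eqI[OF relationsI(1)[OF assms]]) (use assms in \<open>simp_all add: gen_T\<close>)
  then show ?thesis using assms by (simp add: lie_emb_def proj_add gen_T)
qed

lemma lie_emb_smult:
  assumes "c \<in> carrier K" "x \<in> carrier L" shows "lie_emb (c \<odot>\<^bsub>L\<^esub> x) = U.\<eta> c \<otimes>\<^bsub>U\<^esub> lie_emb x"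
proof -
  have "proj (free_gen K (c \<odot>\<^bsub>L\<^esub> x)) = proj (c \<odot>\<^bsub>T\<^esub> free_gen K x)"
    by (rule proj_eqI[OF relationsI(2)[OF assms]]) (use assms in \<open>simp_all add: gen_T smult_T\<close>)
  also have "\<dots> = proj ((c \<odot>\<^bsub>T\<^esub> \<one>\<^bsub>T\<^esub>) \<otimes>\<^bsub>T\<^esub> free_gen K x)" using assms by (simp add: scalar_mult_T gen_T)
  also have "\<dots> = U.\<eta> c \<otimes>\<^bsub>U\<^esub> lie_emb x"
    using assms by (simp add: proj_mult smult_T gen_T U.\<eta>_def scalar_U lie_emb_def)
  finally show ?thesis by (simp add: lie_emb_def)
qed

lemma lie_emb_bracket:
  assumes x: "x \<in> carrier L" and y: "y \<in> carrier L" shows "U.ad (lie_emb x) (lie_emb y) = lie_emb (br x y)"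
proof -
  let ?\<iota> = "free_gen K"
  let ?d = "?\<iota> x \<otimes>\<^bsub>T\<^esub> ?\<iota> y \<ominus>\<^bsub>T\<^esub> ?\<iota> y \<otimes>\<^bsub>T\<^esub> ?\<iota> x"
  note c = gen_T[OF x] gen_T[OF y]
  have "proj ?d = proj (?\<iota> (br x y))"
    by (rule proj_eqI[OF relationsI(3)[OF x y]]) (use x y in \<open>simp_all add: gen_T br_closed\<close>)
  moreover have "?d \<oplus>\<^bsub>T\<^esub> ?\<iota> y \<otimes>\<^bsub>T\<^esub> ?\<iota> x = ?\<iota> x \<otimes>\<^bsub>T\<^esub> ?\<iota> y"
    using c by (simp add: T.minus_eq T.a_assoc T.l_neg)
  then have "proj ?d \<oplus>\<^bsub>U\<^esub> lie_emb y \<otimes>\<^bsub>U\<^esub> lie_emb x = lie_emb x \<otimes>\<^bsub>U\<^esub> lie_emb y"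
    using c by (metis T.m_closed T.minus_closed lie_emb_def proj_add proj_mult)
  ultimately have "lie_emb x \<otimes>\<^bsub>U\<^esub> lie_emb y = lie_emb (br x y) \<oplus>\<^bsub>U\<^esub> lie_emb y \<otimes>\<^bsub>U\<^esub> lie_emb x" by (simp add: lie_emb_def)
  then show ?thesis using lie_emb_closed x y br_closed by (simp add: U.ad_def U.minus_eq U.a_assoc U.r_neg)
qed

text \<open>Every element of the free algebra is a linear combination of words, and words are products of
  generators.\<close>

lemma uea_generated:
  assumes P: "stable (regular_module U) U.F P" and one: "\<one>\<^bsub>U\<^esub> \<in> P"
    and mult: "\<And>v x. \<lbrakk>v \<in> lie_emb ` carrier L; x \<in> P\<rbrakk> \<Longrightarrow> v \<otimes>\<^bsub>U\<^esub> x \<in> P"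
  shows "carrier U \<subseteq> P"
proof
  note Pd = stableD[OF P]
  let ?\<delta> = "\<lambda>w v. if v = w then \<one> else \<zero>"
  have \<delta>T: "?\<delta> w \<in> carrier T" if "w \<in> lists (carrier L)" for w
    by (rule free_algebraI[where S = "{w}"]) (use that in auto)
  have word: "proj (?\<delta> w) \<in> P" if "w \<in> lists (carrier L)" for w
    using that
  proof (induction w)
    case Nil
    have "?\<delta> [] = \<one>\<^bsub>T\<^esub>" by (simp add: free_algebra_simps)
    then show ?case using one proj_one by simp
  next
    case (Cons x w)
    have wT: "?\<delta> w \<in> carrier T" by (rule \<delta>T) (use Cons in auto)
    have xL: "x \<in> carrier L" using Cons by auto
    have "?\<delta> (x # w) = free_gen K x \<otimes>\<^bsub>T\<^esub> ?\<delta> w"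
    proof
      fix v
      have "conv (free_gen K x) (?\<delta> w) v = (if v \<noteq> [] \<and> hd v = x then ?\<delta> w (tl v) else \<zero>)"
        by (rule conv_gen_left[OF free_algebraD(1)[OF wT]])
      then show "?\<delta> (x # w) v = (free_gen K x \<otimes>\<^bsub>T\<^esub> ?\<delta> w) v"
        unfolding free_algebra_simps(2) by (cases v) auto
    qed
    then have "proj (?\<delta> (x # w)) = lie_emb x \<otimes>\<^bsub>U\<^esub> proj (?\<delta> w)"
      using gen_T[OF xL] wT by (simp add: proj_mult lie_emb_def)
    then show ?case using mult[of "lie_emb x"] xL Cons.IH Cons.prems by auto
  qed
  have supp: "proj f \<in> P" if "finite S" "f \<in> carrier T" "{w. f w \<noteq> \<zero>} \<subseteq> S" for S f
    using that
  proof (induction S arbitrary: f)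
    case empty
    then have "f = \<zero>\<^bsub>T\<^esub>" by (auto simp: free_algebra_simps)
    moreover have "proj \<zero>\<^bsub>T\<^esub> = \<zero>\<^bsub>U\<^esub>"
      using proj_add[of "\<zero>\<^bsub>T\<^esub>" "\<zero>\<^bsub>T\<^esub>"] proj_closed[of "\<zero>\<^bsub>T\<^esub>"] U.add.l_cancel_one by simp
    ultimately show ?case using Pd(2) by simp
  next
    case (insert w S)
    note D = free_algebraD[OF insert.prems(1)]
    show ?case
    proof (cases "f w = \<zero>")
      case True
      then show ?thesis using insert by blast
    next
      case False
      then have w: "w \<in> lists (carrier L)" using D(4) by blast
      let ?g = "f(w := \<zero>)"
      have g: "?g \<in> carrier T"
        by (rule free_algebraI[where S = "{w. f w \<noteq> \<zero>}"]) (use D in auto)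
      have c: "f w \<in> carrier K" by (rule D(2))
      let ?h = "(f w \<odot>\<^bsub>T\<^esub> \<one>\<^bsub>T\<^esub>) \<otimes>\<^bsub>T\<^esub> ?\<delta> w"
      have h: "?h = f w \<odot>\<^bsub>T\<^esub> ?\<delta> w" by (rule scalar_mult_T(1)[OF c \<delta>T[OF w]])
      have hT: "?h \<in> carrier T" unfolding h by (rule smult_T[OF c \<delta>T[OF w]])
      have "f = ?g \<oplus>\<^bsub>T\<^esub> ?h" unfolding h using D(2) by (auto simp: free_algebra_simps fun_eq_iff)
      then have "proj f = proj ?g \<oplus>\<^bsub>U\<^esub> proj ?h" using proj_add[OF g hT] by simp
      moreover have "proj ?h = U.\<eta> (f w) \<otimes>\<^bsub>U\<^esub> proj (?\<delta> w)"
        using proj_mult[OF smult_T[OF c T.one_closed] \<delta>T[OF w]] scalar_U[OF c] by (simp add: U.\<eta>_def)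
      then have "proj ?h \<in> P" using Pd(4)[OF U.F_I[OF c] word[OF w]] by simp
      moreover have "proj ?g \<in> P" by (rule insert.IH[OF g]) (use insert.prems in auto)
      ultimately show ?thesis using Pd(3) by simp
    qed
  qed
  fix u assume "u \<in> carrier U"
  then obtain f where "f \<in> carrier T" "u = proj f" using proj_surj by blast
  then show "u \<in> P" using supp[OF free_algebraD(3) _ subset_refl] by blast
qed

lemma add_pow_char: "[ring_char K] \<cdot>\<^bsub>U\<^esub> \<one>\<^bsub>U\<^esub> = \<zero>\<^bsub>U\<^esub>"
proof -
  have "[n] \<cdot>\<^bsub>U\<^esub> \<one>\<^bsub>U\<^esub> = U.\<eta> ([n] \<cdot> \<one>)" for n :: nat
    by (induction n) (simp_all add: U.\<eta>_zero U.\<eta>_add U.\<eta>_one)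
  moreover have "[ring_char K] \<cdot> \<one> = \<zero>"
    using R.add.pow_ord_eq_1[of \<one>] by (simp add: ring_char_def)
  ultimately show ?thesis by (simp add: U.\<eta>_zero)
qed

theorem uea_finite_over_center:
  assumes fin: "fin_dim" and p: "Factorial_Ring.prime (ring_char K)"
  shows "\<exists>Z B. finite_central_algebra K U Z B"
proof -
  obtain X where X: "finite X" "X \<subseteq> carrier L" "stable_span L (carrier K) X = carrier L"
    using fin unfolding fin_dim_iff_stable_span by blast
  let ?V = "lie_emb ` carrier L" and ?Y = "lie_emb ` X"
  interpret UM: left_module U "regular_module U" by (rule U.left_module_reg)
  have lie_emb_zero: "lie_emb \<zero>\<^bsub>L\<^esub> = \<zero>\<^bsub>U\<^esub>"
    using lie_emb_add[of "\<zero>\<^bsub>L\<^esub>" "\<zero>\<^bsub>L\<^esub>"] lie_emb_closed[of "\<zero>\<^bsub>L\<^esub>"] U.add.l_cancel_one by simp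
  have V: "stable (regular_module U) U.F ?V"
  proof (rule stableI)
    show "?V \<subseteq> carrier (regular_module U)" using lie_emb_closed by auto
    show "\<zero>\<^bsub>regular_module U\<^esub> \<in> ?V" using lie_emb_zero by (auto intro!: image_eqI[of _ _ "\<zero>\<^bsub>L\<^esub>"])
    show "x \<oplus>\<^bsub>regular_module U\<^esub> y \<in> ?V" if xy: "x \<in> ?V" "y \<in> ?V" for x y
    proof -
      obtain a b where *: "a \<in> carrier L" "b \<in> carrier L" "x = lie_emb a" "y = lie_emb b" using xy by blast
      then have "x \<oplus>\<^bsub>U\<^esub> y = lie_emb (a \<oplus>\<^bsub>L\<^esub> b)" by (simp add: lie_emb_add)
      then show ?thesis using * by simp
    qed
    show "c \<odot>\<^bsub>regular_module U\<^esub> x \<in> ?V" if cx: "c \<in> U.F" "x \<in> ?V" for c x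
    proof -
      obtain k a where *: "k \<in> carrier K" "c = U.\<eta> k" "a \<in> carrier L" "x = lie_emb a"
        using cx by (auto simp: U.F_def)
      then have "c \<otimes>\<^bsub>U\<^esub> x = lie_emb (k \<odot>\<^bsub>L\<^esub> a)" by (simp add: lie_emb_smult)
      then show ?thesis using * by simp
    qed
  qed
  have span: "?V \<subseteq> stable_span (regular_module U) U.F ?Y"
  proof clarify
    fix x assume "x \<in> carrier L"
    then have "x \<in> stable_span L (carrier K) X" using X by simp
    then have "x \<in> carrier L \<and> lie_emb x \<in> stable_span (regular_module U) U.F ?Y"
    proof induction
      case zero
      then show ?case using stable_span.zero[of "regular_module U"] lie_emb_zero by simp
    next
      case (gen x)
      then show ?case using X(2) by (auto intro: stable_span.gen)
    next
      case (add x y)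
      then show ?case using stable_span.add[of "lie_emb x" "regular_module U" U.F ?Y "lie_emb y"] by (simp add: lie_emb_add)
    next
      case (smult c x)
      then show ?case using stable_span.smult[of "U.\<eta> c" U.F "lie_emb x" "regular_module U" ?Y] U.F_I[of c]
        by (simp add: lie_emb_smult)
    qed
    then show "lie_emb x \<in> stable_span (regular_module U) U.F ?Y" by blast
  qed
  interpret G: lie_generated U U.F ?V ?Y "ring_char K"
  proof (unfold_locales)
    show "U.ad x y \<in> ?V" if xy: "x \<in> ?V" "y \<in> ?V" for x y
    proof -
      obtain a b where *: "a \<in> carrier L" "b \<in> carrier L" "x = lie_emb a" "y = lie_emb b" using xy by blast
      then show ?thesis using lie_emb_bracket br_closed by simp
    qed
    show "carrier U \<subseteq> P" if "stable (regular_module U) U.F P" "\<one>\<^bsub>U\<^esub> \<in> P"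
      "\<And>v x. v \<in> ?V \<Longrightarrow> x \<in> P \<Longrightarrow> v \<otimes>\<^bsub>U\<^esub> x \<in> P" for P
      by (rule uea_generated[OF that])
  qed (use V X span p add_pow_char in auto)
  obtain Z B where ZB: "finite Z" "Z \<subseteq> carrier U" "\<forall>z\<in>Z. \<forall>u\<in>carrier U. z \<otimes>\<^bsub>U\<^esub> u = u \<otimes>\<^bsub>U\<^esub> z"
    "finite B" "B \<subseteq> carrier U" "stable_span (regular_module U) (U.F \<union> Z) B = carrier U"
    using G.finite_over_center by (elim exE conjE)
  have "finite_central_algebra K U Z B"
    by (intro finite_central_algebra.intro finite_central_algebra_axioms.intro central_algebra_uea
        ZB(1,2,4-6) ZB(3)[rule_format])
  then show ?thesis by blast
qed

end

theorem theorem3p4: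
  fixes K :: "('k, 'c) ring_scheme"
    and L :: "('k, 'l, 'd) module_scheme"
    and br :: "'l \<Rightarrow> 'l \<Rightarrow> 'l"
  assumes "lie_algebra K L br"
    and "vectorspace.fin_dim K L"
    and "prime (ring_char K)"
  shows "injective_left_module TYPE('m) TYPE('n) (uea K L br) (continuous_dual_left K (uea K L br)) \<and>
    injective_right_module TYPE('m) TYPE('n) (uea K L br) (continuous_dual_right K (uea K L br))"
proof -
  interpret lie_algebra K L br by (rule assms(1))
  obtain Z B where "finite_central_algebra K (uea K L br) Z B"
    using uea_finite_over_center[OF assms(2,3)] by blast
  then interpret finite_central_algebra K "uea K L br" Z B .
  show ?thesis using injective_left injective_right by blast
qed

end
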